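(* Let $\mathscr G$ be an ample groupoid. Suppose that $\mathcal O$ is a $\mathscr G$-sheaf of fields and that $\Gamma_c(\mathscr G^{(0)},\mathcal O)$ is a maximal commutative subring of $\Gamma_c(\mathscr G,\mathcal O)$. Then $\Gamma_c(\mathscr G,\mathcal O)$ is left primitive if and only if $\mathscr G^{(0)}$ has a dense orbit (i.e. there is $x\in\mathscr G^{(0)}$ with $\overline{\mathrm{Orb}(x)}=\mathscr G^{(0)}$).
   Context: "Compact" includes Hausdorff. A groupoid $\mathscr G$ (identified with its set of arrows) has unit space $\mathscr G^{(0)}$, $\boldsymbol d(\gamma)=\gamma^{-1}\gamma$, $\boldsymbol r(\gamma)=\gamma\gamma^{-1}$. It is ample if it is a topological groupoid such that $\mathscr G^{(0)}$ is locally compact Hausdorff with a basis of compact open sets and $\boldsymbol r$ is a local homeomorphism ($\mathscr G$ itself need not be Hausdorff). A bisection is a subset on which $\boldsymbol d$ and $\boldsymbol r$ are injective. For $x\in\mathscr G^{(0)}$, $\mathrm{Orb}(x)=\boldsymbol r(\boldsymbol d^{-1}(x))$. A $\mathscr G$-sheaf $(E,p,\alpha)$ is a space $E$, a local homeomorphism $p:E\to\mathscr G^{(0)}$ and a continuous map $\alpha:\mathscr G\times_{\boldsymbol d,p}E\to E$, $(\gamma,e)\mapsto\alpha_\gamma(e)$, with $\alpha_{p(e)}(e)=e$, $p(\alpha_\gamma(e))=\boldsymbol r(\gamma)$, and $\alpha_\beta(\alpha_\gamma(e))=\alpha_{\beta\gamma}(e)$ whenever defined. The stalk at $x$ is $p^{-1}(x)$.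 A $\mathscr G$-sheaf of rings $\mathcal O=(E,p,\alpha)$ is a $\mathscr G$-sheaf with a unital ring structure on each stalk $\mathcal O_x$ such that fiberwise addition and multiplication $E\times_{p,p}E\to E$ and the unit section $x\mapsto 1_x$ are continuous, and each $\alpha_\gamma:\mathcal O_{\boldsymbol d(\gamma)}\to\mathcal O_{\boldsymbol r(\gamma)}$ is a (unital) ring homomorphism. It is a sheaf of fields if every stalk is a field. $\Gamma_c(\mathscr G,\mathcal O)$ is the additive group generated by all maps $f:\mathscr G\to E$ with $p\circ f=\boldsymbol r$ for which there is a compact open bisection $U$ with $f|_U$ continuous and $f=0$ off $U$. It is a ring under pointwise addition and convolution $(f*g)(\gamma)=\sum_{\beta\rho=\gamma}f(\beta)\alpha_\beta(g(\rho))$. $\Gamma_c(\mathscr G^{(0)},\mathcal O)$ is the ring of compactly supported continuous sections $\mathscr G^{(0)}\to E$ of $p$ with pointwise operations, viewed as a subring of $\Gamma_c(\mathscr G,\mathcal O)$ by extending by zero. A ring $R$ is left primitive if it has a faithful simple left module; a simple left $R$-module is a module $N$ with $RN\neq 0$ whose only submodules are $0$ and $N$. *)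

theory Defs
  imports "HOL-Analysis.Analysis" "HOL-Algebra.Module" "HOL-Algebra.Generated_Groups"
begin

no_notation eq_closure_of (\<open>closure'_of\<index>\<close>)

section \<open>Nonunital rings and their modules\<close>

text \<open>The convolution ring of an ample groupoid has an identity only if the unit space is
  compact. We keep the library's \<open>ring\<close> record, but its field \<open>one\<close> is irrelevant here.
  Likewise, the library's locale \<open>module\<close> is about unital modules over commutative rings; of it we
  use only the record, for its scalar multiplication.\<close>

locale nonunital_ring = abelian_group R for R (structure) +
  assumes m_closed: "\<lbrakk>a \<in> carrier R; b \<in> carrier R\<rbrakk> \<Longrightarrow> a \<otimes> b \<in> carrier R"
    and m_assoc: "\<lbrakk>a \<in> carrier R; b \<in> carrier R; c \<in> carrier R\<rbrakk>
      \<Longrightarrow> (a \<otimes> b) \<otimes> c = a \<otimes> (b \<otimes> c)"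
    and l_distr: "\<lbrakk>a \<in> carrier R; b \<in> carrier R; c \<in> carrier R\<rbrakk>
      \<Longrightarrow> (a \<oplus> b) \<otimes> c = a \<otimes> c \<oplus> b \<otimes> c"
    and r_distr: "\<lbrakk>a \<in> carrier R; b \<in> carrier R; c \<in> carrier R\<rbrakk>
      \<Longrightarrow> c \<otimes> (a \<oplus> b) = c \<otimes> a \<oplus> c \<otimes> b"

locale left_module = R?: nonunital_ring R + M?: abelian_group M for R (structure) and M (structure) +
  assumes smult_closed: "\<lbrakk>a \<in> carrier R; x \<in> carrier M\<rbrakk> \<Longrightarrow> a \<odot>\<^bsub>M\<^esub> x \<in> carrier M"
    and smult_l_distr: "\<lbrakk>a \<in> carrier R; b \<in> carrier R; x \<in> carrier M\<rbrakk>
      \<Longrightarrow> (a \<oplus>\<^bsub>R\<^esub> b) \<odot>\<^bsub>M\<^esub> x = a \<odot>\<^bsub>M\<^esub> x \<oplus>\<^bsub>M\<^esub> b \<odot>\<^bsub>M\<^esub> x"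
    and smult_r_distr: "\<lbrakk>a \<in> carrier R; x \<in> carrier M; y \<in> carrier M\<rbrakk>
      \<Longrightarrow> a \<odot>\<^bsub>M\<^esub> (x \<oplus>\<^bsub>M\<^esub> y) = a \<odot>\<^bsub>M\<^esub> x \<oplus>\<^bsub>M\<^esub> a \<odot>\<^bsub>M\<^esub> y"
    and smult_assoc: "\<lbrakk>a \<in> carrier R; b \<in> carrier R; x \<in> carrier M\<rbrakk>
      \<Longrightarrow> (a \<otimes>\<^bsub>R\<^esub> b) \<odot>\<^bsub>M\<^esub> x = a \<odot>\<^bsub>M\<^esub> (b \<odot>\<^bsub>M\<^esub> x)"

definition simple_left_module :: "('r, 'a) ring_scheme \<Rightarrow> ('r, 'm, 'b) module_scheme \<Rightarrow> bool" where
  "simple_left_module R M \<longleftrightarrow> left_module R M \<and>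
     (\<exists>a \<in> carrier R. \<exists>x \<in> carrier M. a \<odot>\<^bsub>M\<^esub> x \<noteq> \<zero>\<^bsub>M\<^esub>) \<and>
     (\<forall>H. submodule H R M \<longrightarrow> H = {\<zero>\<^bsub>M\<^esub>} \<or> H = carrier M)"

definition faithful_left_module :: "('r, 'a) ring_scheme \<Rightarrow> ('r, 'm, 'b) module_scheme \<Rightarrow> bool" where
  "faithful_left_module R M \<longleftrightarrow> left_module R M \<and>
     (\<forall>a \<in> carrier R. (\<forall>x \<in> carrier M. a \<odot>\<^bsub>M\<^esub> x = \<zero>\<^bsub>M\<^esub>) \<longrightarrow> a = \<zero>\<^bsub>R\<^esub>)"

text \<open>HOL cannot quantify over the type carrying the module. There is no loss in letting it be
  \<^typ>\<open>'r set\<close>: a simple module is cyclic, hence isomorphic to a quotient of the ring, whose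
  elements are cosets. See \<open>left_primitiveI\<close> below.\<close>

definition left_primitive :: "('r, 'a) ring_scheme \<Rightarrow> bool" where
  "left_primitive R \<longleftrightarrow>
     (\<exists>M :: ('r, 'r set) module. simple_left_module R M \<and> faithful_left_module R M)"

definition comm_subrng :: "'r set \<Rightarrow> ('r, 'a) ring_scheme \<Rightarrow> bool" where
  "comm_subrng B R \<longleftrightarrow> subgroup B (add_monoid R) \<and>
     (\<forall>a \<in> B. \<forall>b \<in> B. a \<otimes>\<^bsub>R\<^esub> b \<in> B \<and> a \<otimes>\<^bsub>R\<^esub> b = b \<otimes>\<^bsub>R\<^esub> a)"

definition maximal_comm_subrng :: "'r set \<Rightarrow> ('r, 'a) ring_scheme \<Rightarrow> bool" where
  "maximal_comm_subrng B R \<longleftrightarrow> comm_subrng B R \<and>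
     (\<forall>C. comm_subrng C R \<and> B \<subseteq> C \<longrightarrow> C = B)"


section \<open>Topological preliminaries\<close>

definition local_homeomorphism :: "'a topology \<Rightarrow> 'b topology \<Rightarrow> ('a \<Rightarrow> 'b) \<Rightarrow> bool" where
  "local_homeomorphism X Y f \<longleftrightarrow>
     (\<forall>x \<in> topspace X. \<exists>U. openin X U \<and> x \<in> U \<and> openin Y (f ` U) \<and>
        homeomorphic_map (subtopology X U) (subtopology Y (f ` U)) f)"

text \<open>Compact sets are Hausdorff by convention, which matters in non-Hausdorff spaces.\<close>

definition compact_Hausdorff_in :: "'a topology \<Rightarrow> 'a set \<Rightarrow> bool" where
  "compact_Hausdorff_in X K \<longleftrightarrow> compactin X K \<and> Hausdorff_space (subtopology X K)"


section \<open>Ample groupoids\<close>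

text \<open>A groupoid is identified with its set of arrows, the space underlying \<open>arrow_top\<close>.
  A product \<open>gcomp G \<beta> \<gamma>\<close> is meaningful only if \<open>gdom G \<beta> = gran G \<gamma>\<close>.\<close>

record 'g groupoid =
  arrow_top :: "'g topology"
  gcomp :: "'g \<Rightarrow> 'g \<Rightarrow> 'g"
  ginv :: "'g \<Rightarrow> 'g"

definition arrows :: "'g groupoid \<Rightarrow> 'g set" where
  "arrows G = topspace (arrow_top G)"

definition gdom :: "'g groupoid \<Rightarrow> 'g \<Rightarrow> 'g" where
  "gdom G \<gamma> = gcomp G (ginv G \<gamma>) \<gamma>"

definition gran :: "'g groupoid \<Rightarrow> 'g \<Rightarrow> 'g" where
  "gran G \<gamma> = gcomp G \<gamma> (ginv G \<gamma>)"

definition units :: "'g groupoid \<Rightarrow> 'g set" where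
  "units G = gdom G ` arrows G"

definition unit_top :: "'g groupoid \<Rightarrow> 'g topology" where
  "unit_top G = subtopology (arrow_top G) (units G)"

definition orbit :: "'g groupoid \<Rightarrow> 'g \<Rightarrow> 'g set" where
  "orbit G x = gran G ` {\<gamma> \<in> arrows G. gdom G \<gamma> = x}"

definition bisection :: "'g groupoid \<Rightarrow> 'g set \<Rightarrow> bool" where
  "bisection G U \<longleftrightarrow> U \<subseteq> arrows G \<and> inj_on (gdom G) U \<and> inj_on (gran G) U"

locale groupoid =
  fixes G :: "'g groupoid"
  assumes inv_closed: "\<gamma> \<in> arrows G \<Longrightarrow> ginv G \<gamma> \<in> arrows G"
    and inv_inv: "\<gamma> \<in> arrows G \<Longrightarrow> ginv G (ginv G \<gamma>) = \<gamma>"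
    and comp_closed: "\<lbrakk>\<beta> \<in> arrows G; \<gamma> \<in> arrows G; gdom G \<beta> = gran G \<gamma>\<rbrakk>
      \<Longrightarrow> gcomp G \<beta> \<gamma> \<in> arrows G"
    and dom_comp: "\<lbrakk>\<beta> \<in> arrows G; \<gamma> \<in> arrows G; gdom G \<beta> = gran G \<gamma>\<rbrakk>
      \<Longrightarrow> gdom G (gcomp G \<beta> \<gamma>) = gdom G \<gamma>"
    and ran_comp: "\<lbrakk>\<beta> \<in> arrows G; \<gamma> \<in> arrows G; gdom G \<beta> = gran G \<gamma>\<rbrakk>
      \<Longrightarrow> gran G (gcomp G \<beta> \<gamma>) = gran G \<beta>"
    and comp_assoc: "\<lbrakk>\<beta> \<in> arrows G; \<gamma> \<in> arrows G; \<delta> \<in> arrows G;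
        gdom G \<beta> = gran G \<gamma>; gdom G \<gamma> = gran G \<delta>\<rbrakk>
      \<Longrightarrow> gcomp G (gcomp G \<beta> \<gamma>) \<delta> = gcomp G \<beta> (gcomp G \<gamma> \<delta>)"
    and comp_dom: "\<gamma> \<in> arrows G \<Longrightarrow> gcomp G \<gamma> (gdom G \<gamma>) = \<gamma>"
    and ran_comp_left: "\<gamma> \<in> arrows G \<Longrightarrow> gcomp G (gran G \<gamma>) \<gamma> = \<gamma>"

locale topological_groupoid = groupoid +
  assumes continuous_comp:
      "continuous_map
         (subtopology (prod_topology (arrow_top G) (arrow_top G)) {(\<beta>, \<gamma>). gdom G \<beta> = gran G \<gamma>})
         (arrow_top G) (\<lambda>(\<beta>, \<gamma>). gcomp G \<beta> \<gamma>)"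
    and continuous_inv: "continuous_map (arrow_top G) (arrow_top G) (ginv G)"

locale ample_groupoid = topological_groupoid +
  assumes Hausdorff_units: "Hausdorff_space (unit_top G)"
    and locally_compact_units: "locally_compact_space (unit_top G)"
    and compact_open_basis:
      "openin (unit_top G) =
         arbitrary union_of (\<lambda>K. openin (unit_top G) K \<and> compact_Hausdorff_in (unit_top G) K)"
    and local_homeomorphism_ran: "local_homeomorphism (arrow_top G) (unit_top G) (gran G)"


section \<open>Sheaves over an ample groupoid\<close>

record ('g, 'e) gsheaf =
  total :: "'e topology"
  proj :: "'e \<Rightarrow> 'g"
  act :: "'g \<Rightarrow> 'e \<Rightarrow> 'e"

text \<open>The stalks are disjoint, so their ring operations are the restrictions of a single pair of
  operations on the total space, meaningful only for arguments in the same stalk.\<close>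

record ('g, 'e) ring_gsheaf = "('g, 'e) gsheaf" +
  fadd :: "'e \<Rightarrow> 'e \<Rightarrow> 'e"
  fmult :: "'e \<Rightarrow> 'e \<Rightarrow> 'e"
  fzero :: "'g \<Rightarrow> 'e"
  fone :: "'g \<Rightarrow> 'e"

definition stalk :: "('g, 'e) ring_gsheaf \<Rightarrow> 'g \<Rightarrow> 'e ring" where
  "stalk S x = \<lparr>carrier = {e \<in> topspace (total S). proj S e = x},
     mult = fmult S, one = fone S x, zero = fzero S x, add = fadd S\<rparr>"

locale gsheaf = ample_groupoid G for G :: "'g groupoid" +
  fixes S :: "('g, 'e, 's) gsheaf_scheme"
  assumes local_homeomorphism_proj: "local_homeomorphism (total S) (unit_top G) (proj S)"
    and act_closed: "\<lbrakk>\<gamma> \<in> arrows G; e \<in> topspace (total S); gdom G \<gamma> = proj S e\<rbrakk>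
      \<Longrightarrow> act S \<gamma> e \<in> topspace (total S)"
    and continuous_act:
      "continuous_map
         (subtopology (prod_topology (arrow_top G) (total S)) {(\<gamma>, e). gdom G \<gamma> = proj S e})
         (total S) (\<lambda>(\<gamma>, e). act S \<gamma> e)"
    and act_unit: "e \<in> topspace (total S) \<Longrightarrow> act S (proj S e) e = e"
    and proj_act: "\<lbrakk>\<gamma> \<in> arrows G; e \<in> topspace (total S); gdom G \<gamma> = proj S e\<rbrakk>
      \<Longrightarrow> proj S (act S \<gamma> e) = gran G \<gamma>"
    and act_act: "\<lbrakk>\<beta> \<in> arrows G; \<gamma> \<in> arrows G; e \<in> topspace (total S);
        gdom G \<gamma> = proj S e; gdom G \<beta> = gran G \<gamma>\<rbrakk>
      \<Longrightarrow> act S \<beta> (act S \<gamma> e) = act S (gcomp G \<beta> \<gamma>) e"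

locale gsheaf_of_rings = gsheaf G S
  for G :: "'g groupoid" and S :: "('g, 'e) ring_gsheaf" +
  assumes ring_stalk: "x \<in> units G \<Longrightarrow> ring (stalk S x)"
    and continuous_fadd:
      "continuous_map
         (subtopology (prod_topology (total S) (total S)) {(e, e'). proj S e = proj S e'})
         (total S) (\<lambda>(e, e'). fadd S e e')"
    and continuous_fmult:
      "continuous_map
         (subtopology (prod_topology (total S) (total S)) {(e, e'). proj S e = proj S e'})
         (total S) (\<lambda>(e, e'). fmult S e e')"
    and continuous_fone: "continuous_map (unit_top G) (total S) (fone S)"
    and act_ring_hom:
      "\<gamma> \<in> arrows G \<Longrightarrow> act S \<gamma> \<in> ring_hom (stalk S (gdom G \<gamma>)) (stalk S (gran G \<gamma>))"

locale gsheaf_of_fields = gsheaf_of_rings +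
  assumes field_stalk: "x \<in> units G \<Longrightarrow> field (stalk S x)"


section \<open>The convolution ring\<close>

text \<open>Maps on the set of arrows are represented by functions that are \<^term>\<open>undefined\<close>
  elsewhere, so that equality of maps is equality of functions.\<close>

definition section_group :: "'g groupoid \<Rightarrow> ('g, 'e) ring_gsheaf \<Rightarrow> ('g \<Rightarrow> 'e) monoid" where
  "section_group G S =
     \<lparr>carrier = {f \<in> extensional (arrows G).
        \<forall>\<gamma> \<in> arrows G. f \<gamma> \<in> topspace (total S) \<and> proj S (f \<gamma>) = gran G \<gamma>},
      mult = (\<lambda>f g. \<lambda>\<gamma>\<in>arrows G. fadd S (f \<gamma>) (g \<gamma>)),
      one = (\<lambda>\<gamma>\<in>arrows G. fzero S (gran G \<gamma>))\<rparr>"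

definition bisection_sections :: "'g groupoid \<Rightarrow> ('g, 'e) ring_gsheaf \<Rightarrow> ('g \<Rightarrow> 'e) set" where
  "bisection_sections G S =
     {f \<in> carrier (section_group G S).
        \<exists>U. bisection G U \<and> openin (arrow_top G) U \<and> compact_Hausdorff_in (arrow_top G) U \<and>
          continuous_map (subtopology (arrow_top G) U) (total S) f \<and>
          (\<forall>\<gamma> \<in> arrows G - U. f \<gamma> = fzero S (gran G \<gamma>))}"

text \<open>For elements of the convolution ring only finitely many terms of the sum are nonzero.
  As \<open>finsum\<close> is zero by convention over every infinite index set, the zero terms have to be
  left out.\<close>

definition convolution ::
    "'g groupoid \<Rightarrow> ('g, 'e) ring_gsheaf \<Rightarrow> ('g \<Rightarrow> 'e) \<Rightarrow> ('g \<Rightarrow> 'e) \<Rightarrow> 'g \<Rightarrow> 'e" where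
  "convolution G S f g = (\<lambda>\<gamma>\<in>arrows G.
     finsum (stalk S (gran G \<gamma>)) (\<lambda>(\<beta>, \<rho>). fmult S (f \<beta>) (act S \<beta> (g \<rho>)))
       {(\<beta>, \<rho>). \<beta> \<in> arrows G \<and> \<rho> \<in> arrows G \<and> gdom G \<beta> = gran G \<rho> \<and> gcomp G \<beta> \<rho> = \<gamma> \<and>
          fmult S (f \<beta>) (act S \<beta> (g \<rho>)) \<noteq> fzero S (gran G \<gamma>)})"

definition extend_by_zero ::
    "'g groupoid \<Rightarrow> ('g, 'e) ring_gsheaf \<Rightarrow> ('g \<Rightarrow> 'e) \<Rightarrow> 'g \<Rightarrow> 'e" where
  "extend_by_zero G S s = (\<lambda>\<gamma>\<in>arrows G. if \<gamma> \<in> units G then s \<gamma> else fzero S (gran G \<gamma>))"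

text \<open>The field \<open>one\<close> is the identity of the ring if the unit space is compact, and has no meaning
  otherwise.\<close>

definition Gamma_c :: "'g groupoid \<Rightarrow> ('g, 'e) ring_gsheaf \<Rightarrow> ('g \<Rightarrow> 'e) ring" where
  "Gamma_c G S =
     \<lparr>carrier = generate (section_group G S) (bisection_sections G S),
      mult = convolution G S,
      one = extend_by_zero G S (fone S),
      zero = \<one>\<^bsub>section_group G S\<^esub>,
      add = mult (section_group G S)\<rparr>"

definition compactly_supported_sections :: "'g groupoid \<Rightarrow> ('g, 'e) ring_gsheaf \<Rightarrow> ('g \<Rightarrow> 'e) set"
  where "compactly_supported_sections G S =
     {s. continuous_map (unit_top G) (total S) s \<and> (\<forall>x \<in> units G. proj S (s x) = x) \<and>
         compact_Hausdorff_in (unit_top G) (unit_top G closure_of {x \<in> units G. s x \<noteq> fzero S x})}"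

definition Gamma_c_units :: "'g groupoid \<Rightarrow> ('g, 'e) ring_gsheaf \<Rightarrow> ('g \<Rightarrow> 'e) set" where
  "Gamma_c_units G S = extend_by_zero G S ` compactly_supported_sections G S"


section \<open>Independence of left primitivity from the carrier type of the module\<close>

context left_module
begin

lemma zero_smult: "x \<in> carrier M \<Longrightarrow> \<zero>\<^bsub>R\<^esub> \<odot>\<^bsub>M\<^esub> x = \<zero>\<^bsub>M\<^esub>"
  using smult_l_distr[of "\<zero>\<^bsub>R\<^esub>" "\<zero>\<^bsub>R\<^esub>" x] smult_closed[of "\<zero>\<^bsub>R\<^esub>" x]
  by (metis M.add.l_cancel_one' R.l_zero R.zero_closed)

lemma smult_zero: "a \<in> carrier R \<Longrightarrow> a \<odot>\<^bsub>M\<^esub> \<zero>\<^bsub>M\<^esub> = \<zero>\<^bsub>M\<^esub>"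
  using smult_r_distr[of a "\<zero>\<^bsub>M\<^esub>" "\<zero>\<^bsub>M\<^esub>"] smult_closed[of a "\<zero>\<^bsub>M\<^esub>"]
  by (metis M.add.l_cancel_one' M.l_zero M.zero_closed)

lemma minus_smult:
  assumes "a \<in> carrier R" "x \<in> carrier M"
  shows "\<ominus>\<^bsub>M\<^esub> (a \<odot>\<^bsub>M\<^esub> x) = (\<ominus>\<^bsub>R\<^esub> a) \<odot>\<^bsub>M\<^esub> x"
proof -
  have "(\<ominus>\<^bsub>R\<^esub> a) \<odot>\<^bsub>M\<^esub> x \<oplus>\<^bsub>M\<^esub> a \<odot>\<^bsub>M\<^esub> x = \<zero>\<^bsub>M\<^esub>"
    using smult_l_distr[of "\<ominus>\<^bsub>R\<^esub> a" a x] assms zero_smult by (simp add: R.l_neg)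
  then show ?thesis
    using assms by (intro M.minus_equality) (auto intro: smult_closed)
qed

lemma smult_minus:
  assumes "a \<in> carrier R" "x \<in> carrier M"
  shows "a \<odot>\<^bsub>M\<^esub> (\<ominus>\<^bsub>M\<^esub> x) = \<ominus>\<^bsub>M\<^esub> (a \<odot>\<^bsub>M\<^esub> x)"
proof -
  have "a \<odot>\<^bsub>M\<^esub> (\<ominus>\<^bsub>M\<^esub> x) \<oplus>\<^bsub>M\<^esub> a \<odot>\<^bsub>M\<^esub> x = \<zero>\<^bsub>M\<^esub>"
    using smult_r_distr[of a "\<ominus>\<^bsub>M\<^esub> x" x] assms smult_zero by (simp add: M.l_neg)
  then show ?thesis
    using assms by (intro M.minus_equality[symmetric]) (auto intro: smult_closed)
qed

lemma submoduleI:
  assumes "H \<subseteq> carrier M" "\<zero>\<^bsub>M\<^esub> \<in> H"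
    and "\<And>x y. \<lbrakk>x \<in> H; y \<in> H\<rbrakk> \<Longrightarrow> x \<oplus>\<^bsub>M\<^esub> y \<in> H"
    and "\<And>x. x \<in> H \<Longrightarrow> \<ominus>\<^bsub>M\<^esub> x \<in> H"
    and "\<And>a x. \<lbrakk>a \<in> carrier R; x \<in> H\<rbrakk> \<Longrightarrow> a \<odot>\<^bsub>M\<^esub> x \<in> H"
  shows "submodule H R M"
proof -
  have "subgroup H (add_monoid M)"
    using assms by (intro M.add.subgroupI) auto
  then show ?thesis
    using assms(5) by (simp add: submodule_def submodule_axioms_def)
qed

lemma simple_imp_cyclic:
  assumes "simple_left_module R M"
  obtains n where "n \<in> carrier M" "carrier M = (\<lambda>a. a \<odot>\<^bsub>M\<^esub> n) ` carrier R"
proof -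
  from assms obtain a n where a: "a \<in> carrier R" and n: "n \<in> carrier M" and nz: "a \<odot>\<^bsub>M\<^esub> n \<noteq> \<zero>\<^bsub>M\<^esub>"
    unfolding simple_left_module_def by blast
  let ?H = "(\<lambda>a. a \<odot>\<^bsub>M\<^esub> n) ` carrier R"
  have "submodule ?H R M"
  proof (rule submoduleI)
    show "?H \<subseteq> carrier M"
      using n by (auto intro: smult_closed)
    show "\<zero>\<^bsub>M\<^esub> \<in> ?H"
      using zero_smult[OF n] R.zero_closed by force
    show "x \<oplus>\<^bsub>M\<^esub> y \<in> ?H" if "x \<in> ?H" "y \<in> ?H" for x y
      using that n by (auto simp: smult_l_distr[symmetric])
    show "\<ominus>\<^bsub>M\<^esub> x \<in> ?H" if "x \<in> ?H" for x
      using that n by (auto simp: minus_smult)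
    show "b \<odot>\<^bsub>M\<^esub> x \<in> ?H" if "b \<in> carrier R" "x \<in> ?H" for b x
      using that n by (auto simp: smult_assoc[symmetric] intro: R.m_closed)
  qed
  moreover have "?H \<noteq> {\<zero>\<^bsub>M\<^esub>}"
    using a nz by blast
  ultimately have "carrier M = ?H"
    using assms unfolding simple_left_module_def by metis
  with n show thesis
    by (rule that)
qed

end

lemma left_module_transport:
  fixes R :: "('r, 'a) ring_scheme" and M :: "('r, 'm, 'b) module_scheme" and \<phi> :: "'m \<Rightarrow> 'n"
  defines "\<psi> \<equiv> inv_into (carrier M) \<phi>"
  defines "N \<equiv> \<lparr>carrier = \<phi> ` carrier M, mult = undefined, one = undefined, zero = \<phi> \<zero>\<^bsub>M\<^esub>,
    add = (\<lambda>x y. \<phi> (\<psi> x \<oplus>\<^bsub>M\<^esub> \<psi> y)), smult = (\<lambda>a x. \<phi> (a \<odot>\<^bsub>M\<^esub> \<psi> x))\<rparr>"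
  assumes M: "left_module R M" and inj: "inj_on \<phi> (carrier M)"
  shows "left_module R N"
    and "simple_left_module R M \<Longrightarrow> simple_left_module R N"
    and "faithful_left_module R M \<Longrightarrow> faithful_left_module R N"
proof -
  interpret M: left_module R M by (rule M)
  have \<psi>: "\<psi> (\<phi> x) = x" if "x \<in> carrier M" for x
    unfolding \<psi>_def using inj that by simp
  note closed = M.smult_closed
  have N_simps: "carrier N = \<phi> ` carrier M" "\<zero>\<^bsub>N\<^esub> = \<phi> \<zero>\<^bsub>M\<^esub>"
    "x \<oplus>\<^bsub>N\<^esub> y = \<phi> (\<psi> x \<oplus>\<^bsub>M\<^esub> \<psi> y)" "a \<odot>\<^bsub>N\<^esub> x = \<phi> (a \<odot>\<^bsub>M\<^esub> \<psi> x)" for a x y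
    by (simp_all add: N_def)
  have eq_iff: "\<phi> x = \<phi> y \<longleftrightarrow> x = y" if "x \<in> carrier M" "y \<in> carrier M" for x y
    using inj that by (simp add: inj_on_eq_iff)
  have N: "abelian_group N"
  proof (rule abelian_groupI)
    show "\<exists>y \<in> carrier N. y \<oplus>\<^bsub>N\<^esub> x = \<zero>\<^bsub>N\<^esub>" if "x \<in> carrier N" for x
    proof -
      from that obtain x' where "x' \<in> carrier M" "x = \<phi> x'"
        by (auto simp: N_simps)
      then have "\<phi> (\<ominus>\<^bsub>M\<^esub> x') \<in> carrier N" "\<phi> (\<ominus>\<^bsub>M\<^esub> x') \<oplus>\<^bsub>N\<^esub> x = \<zero>\<^bsub>N\<^esub>"
        by (simp_all add: N_simps \<psi> M.M.l_neg)
      then show ?thesis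
        by blast
    qed
  qed (auto simp: N_simps \<psi> M.M.a_ac)
  interpret N: abelian_group N by (rule N)
  show left_N: "left_module R N"
    by unfold_locales
      (auto simp: N_simps \<psi> closed M.smult_l_distr M.smult_r_distr M.smult_assoc M.R.m_closed)
  then interpret N: left_module R N .
  show "faithful_left_module R N" if "faithful_left_module R M"
    using that left_N by (simp add: faithful_left_module_def N_simps \<psi> eq_iff closed)
  show "simple_left_module R N" if simple: "simple_left_module R M"
    unfolding simple_left_module_def
  proof (intro conjI allI impI left_N)
    show "\<exists>a\<in>carrier R. \<exists>x\<in>carrier N. a \<odot>\<^bsub>N\<^esub> x \<noteq> \<zero>\<^bsub>N\<^esub>"
      using simple by (simp add: simple_left_module_def N_simps \<psi> eq_iff closed)
  next
    fix H assume H: "submodule H R N"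
    then interpret H: subgroup H "add_monoid N"
      by (simp add: submodule_def)
    have H_smult: "a \<odot>\<^bsub>N\<^esub> x \<in> H" if "a \<in> carrier R" "x \<in> H" for a x
      using H that by (simp add: submodule_def submodule_axioms_def)
    let ?H = "{x \<in> carrier M. \<phi> x \<in> H}"
    have "H \<subseteq> \<phi> ` carrier M"
      using H.subset by (simp add: N_simps)
    then have H_eq: "H = \<phi> ` ?H"
      by blast
    have "submodule ?H R M"
    proof (rule M.submoduleI)
      show "\<zero>\<^bsub>M\<^esub> \<in> ?H"
        using H.one_closed by (simp add: N_simps)
      show "x \<oplus>\<^bsub>M\<^esub> y \<in> ?H" if "x \<in> ?H" "y \<in> ?H" for x y
        using that H.m_closed[of "\<phi> x" "\<phi> y"] by (simp add: N_simps \<psi>)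
      show "\<ominus>\<^bsub>M\<^esub> x \<in> ?H" if x: "x \<in> ?H" for x
      proof -
        have "\<ominus>\<^bsub>N\<^esub> (\<phi> x) = \<phi> (\<ominus>\<^bsub>M\<^esub> x)"
          using x by (intro N.minus_equality) (auto simp: N_simps \<psi> M.M.l_neg)
        then show ?thesis
          using x H.m_inv_closed[of "\<phi> x"] by (simp add: a_inv_def)
      qed
      show "a \<odot>\<^bsub>M\<^esub> x \<in> ?H" if "a \<in> carrier R" "x \<in> ?H" for a x
        using that H_smult[of a "\<phi> x"] by (simp add: N_simps \<psi> closed)
    qed auto
    then have "?H = {\<zero>\<^bsub>M\<^esub>} \<or> ?H = carrier M"
      using simple by (simp add: simple_left_module_def)
    then show "H = {\<zero>\<^bsub>N\<^esub>} \<or> H = carrier N"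
    proof
      assume "?H = {\<zero>\<^bsub>M\<^esub>}"
      then have "H = \<phi> ` {\<zero>\<^bsub>M\<^esub>}"
        by (rule subst) (rule H_eq)
      then show ?thesis
        by (simp add: N_simps)
    next
      assume "?H = carrier M"
      then have "H = \<phi> ` carrier M"
        by (rule subst) (rule H_eq)
      then show ?thesis
        by (simp add: N_simps)
    qed
  qed
qed

lemma left_primitiveI:
  fixes R :: "('r, 'a) ring_scheme" and M :: "('r, 'm, 'b) module_scheme"
  assumes simple: "simple_left_module R M" and faithful: "faithful_left_module R M"
  shows "left_primitive R"
proof -
  interpret left_module R M
    using simple by (simp add: simple_left_module_def)
  obtain n where n: "carrier M = (\<lambda>a. a \<odot>\<^bsub>M\<^esub> n) ` carrier R"
    using simple_imp_cyclic[OF simple] by blast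
  define \<phi> where "\<phi> x = {a \<in> carrier R. a \<odot>\<^bsub>M\<^esub> n = x}" for x
  have "inj_on \<phi> (carrier M)"
    unfolding inj_on_def \<phi>_def n by auto
  from left_module_transport(2,3)[OF left_module_axioms this] show ?thesis
    unfolding left_primitive_def using simple faithful by blast
qed

end

theory Submission
  imports Defs
begin

text \<open>Write \<open>A\<close> for the subring \<open>Gamma_c_units\<close> of sections on the unit space. If \<open>A\<close> is maximal
  commutative, then every nonzero ideal of the convolution ring meets \<open>A\<close> nontrivially.

  Suppose that the orbit of \<open>x\<close> is dense. The sections vanishing at all arrows with domain \<open>x\<close> form a
  left ideal \<open>J\<close>, and the characteristic function of any compact open neighbourhood of \<open>x\<close> in the unit
  space is a right identity modulo \<open>J\<close>. So \<open>J\<close> lies in a maximal left ideal \<open>L\<close>, with a simple quotient.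
  If its annihilator were nonzero, it would contain a nonzero \<open>h\<close> in \<open>A\<close>. As the stalks are fields, the
  support of \<open>h\<close> is open, hence meets the orbit of \<open>x\<close>; conjugating \<open>h\<close> by a bisection gives an element
  of \<open>A\<close> in the annihilator that is invertible at \<open>x\<close>, which forces \<open>L\<close> to be the whole ring.

  Conversely, a simple faithful module has a nonzero germ at some unit \<open>x\<close>. The elements whose germs
  vanish on the orbit of \<open>x\<close> form a proper submodule, hence there are none but zero. So the characteristic
  function of a compact open set disjoint from the orbit annihilates the module and is therefore zero.\<close>

section \<open>Maximal commutative subrings and maximal left ideals\<close>

text \<open>The groupoid need not be Hausdorff, so a sum of bisection sections may fail to be
  continuous, and the set where it is nonzero may fail to be open. Arguments on open supports are
  available only for elements continuous on the unit space, which is why an ideal is first pushed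
  into \<open>Gamma_c_units\<close>. In the whole ring the number of bisection sections in a sum
  replaces the support as a measure of size.

  The ring need not have an identity. Characteristic functions of compact open sets of units act as
  local identities: they make a maximal left ideal exist, make the action on the quotient nonzero,
  and show that a module element is determined by its germs.

  The contradiction after conjugating rests on what \<open>J\<close> sees of \<open>e\<close>: among
  the arrows with domain \<open>x\<close>, only the unit \<open>x\<close> carries a nonzero value of
  \<open>e\<close>. So if a diagonal \<open>b\<close> in the annihilator is invertible at
  \<open>x\<close>, and a diagonal \<open>c\<close> takes the inverse value there, then
  \<open>c \<star> (b \<star> e)\<close> equals \<open>e\<close> modulo \<open>J\<close>. As
  \<open>b \<star> e\<close> lies in \<open>L\<close>, so does \<open>e\<close>.\<close>

lemma (in nonunital_ring) l_null: "a \<in> carrier R \<Longrightarrow> \<zero> \<otimes> a = \<zero>"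
  using l_distr[of \<zero> \<zero> a] m_closed[of \<zero> a] by (metis add.l_cancel_one' l_zero zero_closed)

lemma (in nonunital_ring) r_null: "a \<in> carrier R \<Longrightarrow> a \<otimes> \<zero> = \<zero>"
  using r_distr[of \<zero> \<zero> a] m_closed[of a \<zero>] by (metis add.l_cancel_one' l_zero zero_closed)

lemma (in nonunital_ring) l_minus:
  assumes "a \<in> carrier R" "b \<in> carrier R"
  shows "(\<ominus> a) \<otimes> b = \<ominus> (a \<otimes> b)"
  using l_distr[of "\<ominus> a" a b] assms l_null
  by (intro minus_equality[symmetric]) (auto simp: m_closed l_neg)

lemma (in nonunital_ring) r_minus:
  assumes "a \<in> carrier R" "b \<in> carrier R"
  shows "a \<otimes> (\<ominus> b) = \<ominus> (a \<otimes> b)"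
  using r_distr[of "\<ominus> b" b a] assms r_null
  by (intro minus_equality[symmetric]) (auto simp: m_closed l_neg)

lemma (in abelian_group) minus_eq_zeroD:
  assumes "a \<in> carrier G" "b \<in> carrier G" "a \<ominus> b = \<zero>"
  shows "a = b"
proof -
  have "(a \<ominus> b) \<oplus> b = a"
    using assms(1,2) by (simp add: minus_eq a_assoc l_neg)
  then show ?thesis
    using assms by simp
qed

definition centralizer :: "('r, 'a) ring_scheme \<Rightarrow> 'r set \<Rightarrow> 'r set" where
  "centralizer R X = {a \<in> carrier R. \<forall>x \<in> X. a \<otimes>\<^bsub>R\<^esub> x = x \<otimes>\<^bsub>R\<^esub> a}"

lemma (in nonunital_ring) subgroup_centralizer:
  assumes "X \<subseteq> carrier R"
  shows "subgroup (centralizer R X) (add_monoid R)"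
proof (rule add.subgroupI)
  have "\<zero> \<in> centralizer R X"
    using assms by (auto simp: centralizer_def l_null r_null)
  then show "centralizer R X \<noteq> {}" by blast
next
  show "\<ominus> a \<in> centralizer R X" if "a \<in> centralizer R X" for a
    using that assms by (auto simp: centralizer_def l_minus r_minus subset_iff)
  show "a \<oplus> b \<in> centralizer R X" if "a \<in> centralizer R X" "b \<in> centralizer R X" for a b
    using that assms by (auto simp: centralizer_def l_distr r_distr subset_iff)
qed (auto simp: centralizer_def)

lemma (in nonunital_ring) mult_in_centralizer:
  assumes "X \<subseteq> carrier R" "a \<in> centralizer R X" "b \<in> centralizer R X"
  shows "a \<otimes> b \<in> centralizer R X"
  unfolding centralizer_def
proof (intro CollectI conjI ballI)
  have a: "a \<in> carrier R" and b: "b \<in> carrier R"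
    using assms by (auto simp: centralizer_def)
  then show "a \<otimes> b \<in> carrier R" by (rule m_closed)
  fix x assume x: "x \<in> X"
  then have xR: "x \<in> carrier R" using assms by blast
  have "(a \<otimes> b) \<otimes> x = a \<otimes> (x \<otimes> b)"
    using a b x xR assms by (simp add: m_assoc centralizer_def)
  also have "\<dots> = (a \<otimes> x) \<otimes> b"
    using a b xR by (simp add: m_assoc)
  also have "\<dots> = (x \<otimes> a) \<otimes> b"
    using assms x by (simp add: centralizer_def)
  finally show "(a \<otimes> b) \<otimes> x = x \<otimes> (a \<otimes> b)"
    using a b xR by (simp add: m_assoc)
qed

text \<open>The double centralizer of a commutative set is a commutative subring containing it.\<close>

lemma (in nonunital_ring) in_maximal_comm_subrngI:
  assumes B: "maximal_comm_subrng B R" and f: "f \<in> carrier R"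
    and comm: "\<And>b. b \<in> B \<Longrightarrow> b \<otimes> f = f \<otimes> b"
  shows "f \<in> B"
proof -
  from B have cB: "comm_subrng B R"
    and max: "\<And>C. comm_subrng C R \<Longrightarrow> B \<subseteq> C \<Longrightarrow> C = B"
    by (auto simp: maximal_comm_subrng_def)
  have BR: "B \<subseteq> carrier R"
    using cB subgroup.subset by (fastforce simp: comm_subrng_def)
  define X where "X = insert f B"
  define C where "C = centralizer R (centralizer R X)"
  have XR: "X \<subseteq> carrier R"
    using BR f by (simp add: X_def)
  have ZR: "centralizer R X \<subseteq> carrier R"
    by (auto simp: centralizer_def)
  have X: "X \<subseteq> centralizer R X"
    using XR cB comm by (auto simp: centralizer_def comm_subrng_def X_def)
  have XC: "X \<subseteq> C"
    using XR by (auto simp: C_def centralizer_def)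
  \<comment> \<open>\<open>C\<close> commutes with the centralizer of \<open>X\<close>, and that
    contains \<open>X\<close> because \<open>X\<close> is commutative. So \<open>C\<close> lies in
    the centralizer of \<open>X\<close>, with which it commutes by definition; hence
    \<open>C\<close> is commutative.\<close>
  have CZ: "C \<subseteq> centralizer R X"
    using X by (auto simp: C_def centralizer_def)
  have "a \<otimes> b = b \<otimes> a" if "a \<in> C" "b \<in> C" for a b
  proof -
    have "b \<in> centralizer R X" using that CZ by blast
    then show ?thesis using that(1) by (auto simp: C_def centralizer_def)
  qed
  then have "comm_subrng C R"
    unfolding comm_subrng_def C_def
    using subgroup_centralizer[OF ZR] mult_in_centralizer[OF ZR] by (auto simp: C_def)
  then have "C = B"
    using XC by (intro max) (auto simp: X_def)
  then show ?thesis
    using XC by (auto simp: X_def)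
qed

section \<open>Left ideals and their quotient modules\<close>

locale left_ideal = nonunital_ring R for R (structure) +
  fixes L
  assumes subgroup_L: "subgroup L (add_monoid R)"
    and l_mult_closed: "\<lbrakk>a \<in> carrier R; b \<in> L\<rbrakk> \<Longrightarrow> a \<otimes> b \<in> L"
begin

lemma L_subset: "L \<subseteq> carrier R"
  using subgroup.subset[OF subgroup_L] by simp

lemma zero_in: "\<zero> \<in> L"
  using subgroup.one_closed[OF subgroup_L] by simp

lemma add_in: "\<lbrakk>a \<in> L; b \<in> L\<rbrakk> \<Longrightarrow> a \<oplus> b \<in> L"
  using subgroup.m_closed[OF subgroup_L] by simp

lemma neg_in: "a \<in> L \<Longrightarrow> \<ominus> a \<in> L"
  using subgroup.m_inv_closed[OF subgroup_L] by (simp add: a_inv_def)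

definition coset where "coset a = {b \<in> carrier R. b \<ominus> a \<in> L}"

definition rep :: "'a set \<Rightarrow> 'a" where "rep X = (SOME a. a \<in> X)"

text \<open>The operations act through chosen representatives \<open>rep\<close>. That they do not
  depend on the choice is the content of \<open>quotient_add\<close> and
  \<open>quotient_smult\<close>, after which representatives no longer appear.\<close>

definition quotient_module :: "('a, 'a set) module" where
  "quotient_module = \<lparr>carrier = coset ` carrier R, mult = undefined, one = undefined,
     zero = coset \<zero>, add = (\<lambda>X Y. coset (rep X \<oplus> rep Y)), smult = (\<lambda>a X. coset (a \<otimes> rep X))\<rparr>"

lemma coset_eq_iff:
  assumes a: "a \<in> carrier R" and b: "b \<in> carrier R"
  shows "coset a = coset b \<longleftrightarrow> a \<ominus> b \<in> L"
proof
  assume "coset a = coset b"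
  moreover have "a \<in> coset a"
    using a zero_in by (simp add: coset_def minus_eq r_neg)
  ultimately show "a \<ominus> b \<in> L"
    by (simp add: coset_def)
next
  assume ab: "a \<ominus> b \<in> L"
  have ba: "b \<ominus> a \<in> L"
    using neg_in[OF ab] a b by (simp add: minus_eq minus_add a_comm)
  have *: "c \<ominus> e = (c \<ominus> d) \<oplus> (d \<ominus> e)" if "c \<in> carrier R" "d \<in> carrier R" "e \<in> carrier R" for c d e
    using that by (simp add: minus_eq a_assoc r_neg1)
  have "c \<ominus> a \<in> L \<longleftrightarrow> c \<ominus> b \<in> L" if c: "c \<in> carrier R" for c
    using *[OF c a b] *[OF c b a] add_in[OF _ ab] add_in[OF _ ba] by metis
  then show "coset a = coset b"
    by (auto simp: coset_def)
qed

lemma rep_coset: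
  assumes a: "a \<in> carrier R"
  shows "rep (coset a) \<in> carrier R" "rep (coset a) \<ominus> a \<in> L"
proof -
  have "a \<in> coset a"
    using a zero_in by (simp add: coset_def minus_eq r_neg)
  then have "rep (coset a) \<in> coset a"
    unfolding rep_def by (rule someI)
  then show "rep (coset a) \<in> carrier R" "rep (coset a) \<ominus> a \<in> L"
    by (auto simp: coset_def)
qed

lemma quotient_carrier: "carrier quotient_module = coset ` carrier R"
  and quotient_zero: "\<zero>\<^bsub>quotient_module\<^esub> = coset \<zero>"
  by (simp_all add: quotient_module_def)

lemma quotient_add:
  assumes a: "a \<in> carrier R" and b: "b \<in> carrier R"
  shows "coset a \<oplus>\<^bsub>quotient_module\<^esub> coset b = coset (a \<oplus> b)"
proof -
  let ?a = "rep (coset a)" and ?b = "rep (coset b)"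
  have "(?a \<oplus> ?b) \<ominus> (a \<oplus> b) = (?a \<ominus> a) \<oplus> (?b \<ominus> b)"
    using a b rep_coset by (simp add: minus_eq minus_add a_ac)
  then show ?thesis
    using a b rep_coset add_in by (simp add: quotient_module_def coset_eq_iff)
qed

lemma quotient_smult:
  assumes a: "a \<in> carrier R" and b: "b \<in> carrier R"
  shows "a \<odot>\<^bsub>quotient_module\<^esub> coset b = coset (a \<otimes> b)"
proof -
  let ?b = "rep (coset b)"
  have "a \<otimes> ?b \<ominus> a \<otimes> b = a \<otimes> (?b \<ominus> b)"
    using a b rep_coset by (simp add: minus_eq r_distr r_minus)
  then show ?thesis
    using a b rep_coset l_mult_closed by (simp add: quotient_module_def coset_eq_iff m_closed)
qed

lemma left_module_quotient: "left_module R quotient_module"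
proof -
  have "abelian_group quotient_module"
  proof (rule abelian_groupI)
    show "\<exists>y \<in> carrier quotient_module. y \<oplus>\<^bsub>quotient_module\<^esub> x = \<zero>\<^bsub>quotient_module\<^esub>"
      if "x \<in> carrier quotient_module" for x
    proof -
      from that obtain a where "a \<in> carrier R" "x = coset a"
        by (auto simp: quotient_carrier)
      then have "coset (\<ominus> a) \<in> carrier quotient_module"
        "coset (\<ominus> a) \<oplus>\<^bsub>quotient_module\<^esub> x = \<zero>\<^bsub>quotient_module\<^esub>"
        by (auto simp: quotient_carrier quotient_add quotient_zero l_neg)
      then show ?thesis by blast
    qed
  qed (auto simp: quotient_carrier quotient_add quotient_zero a_ac)
  then interpret M: abelian_group quotient_module .
  show ?thesis
    by unfold_locales
      (auto simp: quotient_carrier quotient_add quotient_zero quotient_smult l_distr r_distr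
        m_assoc m_closed)
qed

lemma coset_eq_zero_iff: "a \<in> carrier R \<Longrightarrow> coset a = \<zero>\<^bsub>quotient_module\<^esub> \<longleftrightarrow> a \<in> L"
  by (simp add: quotient_zero coset_eq_iff minus_eq a_inv_def)

text \<open>Submodules correspond to left ideals between \<open>L\<close> and the ring. The product
  \<open>e \<otimes> b\<close> outside \<open>L\<close> secures a nonzero action, which maximality
  alone does not give in a ring without identity.\<close>

lemma simple_quotient:
  assumes e: "e \<in> carrier R" "b \<in> carrier R" "e \<otimes> b \<notin> L"
    and max: "\<And>K. left_ideal R K \<Longrightarrow> L \<subseteq> K \<Longrightarrow> K = L \<or> K = carrier R"
  shows "simple_left_module R quotient_module"
  unfolding simple_left_module_def
proof (intro conjI allI impI left_module_quotient)
  have "coset b \<in> carrier quotient_module" "e \<odot>\<^bsub>quotient_module\<^esub> coset b \<noteq> \<zero>\<^bsub>quotient_module\<^esub>"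
    using e by (auto simp: quotient_carrier quotient_smult coset_eq_zero_iff m_closed)
  then show "\<exists>a\<in>carrier R. \<exists>x\<in>carrier quotient_module.
      a \<odot>\<^bsub>quotient_module\<^esub> x \<noteq> \<zero>\<^bsub>quotient_module\<^esub>"
    using e by blast
next
  interpret M: left_module R quotient_module
    by (rule left_module_quotient)
  fix H assume H: "submodule H R quotient_module"
  then interpret H: subgroup H "add_monoid quotient_module"
    by (simp add: submodule_def)
  have H_smult: "a \<odot>\<^bsub>quotient_module\<^esub> x \<in> H" if "a \<in> carrier R" "x \<in> H" for a x
    using H that by (simp add: submodule_def submodule_axioms_def)
  let ?K = "{a \<in> carrier R. coset a \<in> H}"
  have neg: "\<ominus>\<^bsub>quotient_module\<^esub> (coset a) = coset (\<ominus> a)" if "a \<in> carrier R" for a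
    using that by (intro M.M.minus_equality) (auto simp: quotient_carrier quotient_add quotient_zero l_neg)
  have H0: "coset \<zero> \<in> H"
    using H.one_closed by (simp add: quotient_zero)
  have "subgroup ?K (add_monoid R)"
  proof (rule add.subgroupI)
    show "?K \<noteq> {}" using H0 by blast
    show "\<ominus> a \<in> ?K" if "a \<in> ?K" for a
      using that H.m_inv_closed[of "coset a"] neg[of a]
      by (simp add: a_inv_def[symmetric])
    show "a \<oplus> b \<in> ?K" if "a \<in> ?K" "b \<in> ?K" for a b
      using that H.m_closed[of "coset a" "coset b"] by (simp add: quotient_add)
  qed auto
  then have "left_ideal R ?K"
    using H_smult
    by (intro left_ideal.intro left_ideal_axioms.intro nonunital_ring_axioms)
      (auto simp: m_closed quotient_smult[symmetric])
  moreover have "L \<subseteq> ?K"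
  proof
    fix a assume "a \<in> L"
    then show "a \<in> ?K"
      using L_subset H0 coset_eq_zero_iff[of a] by (auto simp: quotient_zero)
  qed
  ultimately have K: "?K = L \<or> ?K = carrier R"
    by (rule max)
  have HK: "H = coset ` ?K"
    using H.subset by (auto simp: quotient_carrier)
  from K show "H = {\<zero>\<^bsub>quotient_module\<^esub>} \<or> H = carrier quotient_module"
  proof
    assume "?K = L"
    then have "H = coset ` L" using HK by simp
    moreover have "coset ` L = {coset \<zero>}"
      using zero_in L_subset coset_eq_zero_iff quotient_zero by (auto simp: subset_iff)
    ultimately show ?thesis by (simp add: quotient_zero)
  next
    assume "?K = carrier R"
    then show ?thesis using HK by (simp add: quotient_carrier)
  qed
qed

end

text \<open>Zorn's lemma. Without an identity, the union of a chain of proper left ideals may be the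
  whole ring; avoiding a fixed element does pass to unions.\<close>

lemma (in nonunital_ring) exists_maximal_left_ideal_avoiding:
  assumes J: "left_ideal R J" and e: "e \<notin> J"
  obtains L where "left_ideal R L" "J \<subseteq> L" "e \<notin> L"
    "\<And>K. left_ideal R K \<Longrightarrow> L \<subseteq> K \<Longrightarrow> e \<notin> K \<Longrightarrow> K = L"
proof -
  define F where "F = {L. left_ideal R L \<and> J \<subseteq> L \<and> e \<notin> L}"
  have "\<exists>M\<in>F. \<forall>X\<in>F. M \<subseteq> X \<longrightarrow> X = M"
  proof (rule subset_Zorn_nonempty)
    show "F \<noteq> {}" using J e by (auto simp: F_def)
    fix C assume C: "C \<noteq> {}" "subset.chain F C"
    then have CF: "C \<subseteq> F" and tot: "\<And>X Y. X \<in> C \<Longrightarrow> Y \<in> C \<Longrightarrow> X \<subseteq> Y \<or> Y \<subseteq> X"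
      by (auto simp: subset.chain_def)
    have ideal: "left_ideal R X" if "X \<in> C" for X
      using that CF by (auto simp: F_def)
    have sub: "\<Union>C \<subseteq> carrier R"
      using left_ideal.L_subset[OF ideal] by blast
    have "subgroup (\<Union>C) (add_monoid R)"
    proof (rule add.subgroupI)
      show "\<Union>C \<subseteq> carrier R" by (rule sub)
      show "\<Union>C \<noteq> {}" using C(1) left_ideal.zero_in[OF ideal] by blast
      show "\<ominus> a \<in> \<Union>C" if "a \<in> \<Union>C" for a
        using that left_ideal.neg_in[OF ideal] by blast
      show "a \<oplus> b \<in> \<Union>C" if "a \<in> \<Union>C" "b \<in> \<Union>C" for a b
      proof -
        from that tot obtain X where "X \<in> C" "a \<in> X" "b \<in> X"
          by blast
        then show ?thesis
          using left_ideal.add_in[OF ideal] by blast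
      qed
    qed
    then have "left_ideal R (\<Union>C)"
      using left_ideal.l_mult_closed[OF ideal]
      by (intro left_ideal.intro left_ideal_axioms.intro nonunital_ring_axioms) auto
    then show "\<Union>C \<in> F"
      using C(1) CF by (auto simp: F_def)
  qed
  then obtain M where "M \<in> F" "\<forall>X\<in>F. M \<subseteq> X \<longrightarrow> X = M"
    by blast
  then show ?thesis
    by (intro that[of M]) (auto simp: F_def)
qed

section \<open>Local homeomorphisms and compact open bisections\<close>

lemma continuous_map_locallyI:
  assumes "\<And>x. x \<in> topspace X \<Longrightarrow> \<exists>U. openin X U \<and> x \<in> U \<and> continuous_map (subtopology X U) Y f"
  shows "continuous_map X Y f"
  by (rule pasting_lemma[where I = "{U. openin X U \<and> continuous_map (subtopology X U) Y f}"
        and T = "\<lambda>U. U" and f = "\<lambda>_. f"]) (use assms in auto)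

lemma local_homeomorphism_imp_continuous_map:
  assumes "local_homeomorphism X Y f"
  shows "continuous_map X Y f"
proof (rule continuous_map_locallyI)
  fix x assume "x \<in> topspace X"
  then obtain U where U: "openin X U" "x \<in> U"
    "homeomorphic_map (subtopology X U) (subtopology Y (f ` U)) f"
    using assms unfolding local_homeomorphism_def by blast
  then have "continuous_map (subtopology X U) Y f"
    using homeomorphic_imp_continuous_map continuous_map_into_fulltopology by blast
  with U show "\<exists>U. openin X U \<and> x \<in> U \<and> continuous_map (subtopology X U) Y f"
    by blast
qed

lemma local_homeomorphism_imp_open_map:
  assumes "local_homeomorphism X Y f"
  shows "open_map X Y f"
  unfolding open_map_def
proof (intro allI impI)
  fix W assume W: "openin X W"
  show "openin Y (f ` W)"
  proof (subst openin_subopen, intro ballI)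
    fix y assume "y \<in> f ` W"
    then obtain x where x: "x \<in> W" "y = f x" by blast
    with W have "x \<in> topspace X" using openin_subset by blast
    then obtain U where U: "openin X U" "x \<in> U" "openin Y (f ` U)"
      "homeomorphic_map (subtopology X U) (subtopology Y (f ` U)) f"
      using assms unfolding local_homeomorphism_def by blast
    have "openin (subtopology X U) (W \<inter> U)"
      using W by (rule openin_subtopology_Int)
    then have "openin (subtopology Y (f ` U)) (f ` (W \<inter> U))"
      using homeomorphic_imp_open_map[OF U(4)] by (simp add: open_map_def)
    then have "openin Y (f ` (W \<inter> U))"
      using U(3) by (rule openin_trans_full)
    then show "\<exists>T. openin Y T \<and> y \<in> T \<and> T \<subseteq> f ` W"
      using x U(2) by blast
  qed
qed

lemma local_homeomorphism_locally_inj: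
  assumes "local_homeomorphism X Y f" "x \<in> topspace X"
  obtains U where "openin X U" "x \<in> U" "inj_on f U"
proof -
  obtain U where U: "openin X U" "x \<in> U"
    "homeomorphic_map (subtopology X U) (subtopology Y (f ` U)) f"
    using assms unfolding local_homeomorphism_def by blast
  then have "inj_on f U"
    using homeomorphic_imp_injective_map[OF U(3)] openin_subset[OF U(1)]
    by (simp add: topspace_subtopology inf_absorb2)
  with U that show thesis by blast
qed

text \<open>The preimage of an open \<open>W\<close> under the inverse is the image of
  \<open>U \<inter> W\<close>, which is open.\<close>

lemma open_map_continuous_section:
  assumes f: "open_map X Y f" and U: "openin X U" and inj: "inj_on f U"
  shows "continuous_map (subtopology Y (f ` U)) X (inv_into U f)"
proof -
  have fU: "f ` U \<subseteq> topspace Y"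
    using f U openin_subset unfolding open_map_def by blast
  have "openin (subtopology Y (f ` U)) {y \<in> f ` U. inv_into U f y \<in> W}" if W: "openin X W" for W
  proof -
    have "{y \<in> f ` U. inv_into U f y \<in> W} = f ` (U \<inter> W)"
      using inj by auto
    moreover have "openin Y (f ` (U \<inter> W))"
      using f U W by (simp add: open_map_def openin_Int)
    ultimately show ?thesis
      by (metis (no_types, lifting) Int_lower1 image_mono openin_subset_topspace_eq openin_subtopology_Int2 inf.absorb_iff2)
  qed
  moreover have "inv_into U f y \<in> topspace X" if "y \<in> f ` U" for y
    using that inv_into_into[OF that] openin_subset[OF U] by blast
  ultimately show ?thesis
    using fU by (simp add: continuous_map_def inf_absorb2)
qed

text \<open>Near a common value \<open>f z\<close> the map \<open>p\<close> is injective on an open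
  \<open>U\<close>, so \<open>f\<close> and \<open>g\<close> agree wherever both stay in
  \<open>U\<close>. Every passage from an identity in one stalk to an identity on a neighbourhood
  goes through this lemma.\<close>

lemma local_homeomorphism_agree:
  assumes p: "local_homeomorphism E X p"
    and f: "continuous_map Z E f" and g: "continuous_map Z E g"
    and pfg: "\<And>z. z \<in> topspace Z \<Longrightarrow> p (f z) = p (g z)"
  shows "openin Z {z \<in> topspace Z. f z = g z}"
proof (subst openin_subopen, intro ballI)
  fix z assume "z \<in> {z \<in> topspace Z. f z = g z}"
  then have z: "z \<in> topspace Z" "f z = g z" by auto
  have "f z \<in> topspace E"
    using f z(1) by (simp add: continuous_map_def Pi_iff)
  with p obtain U where U: "openin E U" "f z \<in> U" "inj_on p U"
    by (rule local_homeomorphism_locally_inj)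
  let ?T = "{z \<in> topspace Z. f z \<in> U} \<inter> {z \<in> topspace Z. g z \<in> U}"
  have "openin Z ?T"
    using f g U(1) by (intro openin_Int) (auto simp: continuous_map_def)
  moreover have "z \<in> ?T"
    using z U(2) by auto
  moreover have "?T \<subseteq> {z \<in> topspace Z. f z = g z}"
    using U(3) pfg by (auto dest: inj_onD)
  ultimately show "\<exists>T. openin Z T \<and> z \<in> T \<and> T \<subseteq> {z \<in> topspace Z. f z = g z}"
    by blast
qed

section \<open>Cancellation in a groupoid\<close>

context groupoid
begin

lemma dom_inv: "\<gamma> \<in> arrows G \<Longrightarrow> gdom G (ginv G \<gamma>) = gran G \<gamma>"
  by (simp add: gdom_def gran_def inv_inv)

lemma ran_inv: "\<gamma> \<in> arrows G \<Longrightarrow> gran G (ginv G \<gamma>) = gdom G \<gamma>"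
  by (simp add: gdom_def gran_def inv_inv)

lemma dom_in_units: "\<gamma> \<in> arrows G \<Longrightarrow> gdom G \<gamma> \<in> units G"
  by (simp add: units_def)

lemma ran_in_units: "\<gamma> \<in> arrows G \<Longrightarrow> gran G \<gamma> \<in> units G"
  using dom_in_units[OF inv_closed, of \<gamma>] by (simp add: dom_inv)

lemma dom_closed: "\<gamma> \<in> arrows G \<Longrightarrow> gdom G \<gamma> \<in> arrows G"
  using comp_closed[OF inv_closed, of \<gamma> \<gamma>] by (simp add: dom_inv) (simp add: gdom_def)

lemma units_subset: "units G \<subseteq> arrows G"
  by (auto simp: units_def dom_closed)

lemma unit_closed: "x \<in> units G \<Longrightarrow> x \<in> arrows G"
  using units_subset by blast

lemma ran_closed: "\<gamma> \<in> arrows G \<Longrightarrow> gran G \<gamma> \<in> arrows G"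
  by (simp add: ran_in_units unit_closed)

lemma dom_dom: "\<gamma> \<in> arrows G \<Longrightarrow> gdom G (gdom G \<gamma>) = gdom G \<gamma>"
  using dom_comp[OF inv_closed, of \<gamma> \<gamma>] by (simp add: dom_inv) (simp add: gdom_def)

lemma ran_dom: "\<gamma> \<in> arrows G \<Longrightarrow> gran G (gdom G \<gamma>) = gdom G \<gamma>"
  using ran_comp[OF inv_closed, of \<gamma> \<gamma>] by (simp add: dom_inv ran_inv) (simp add: gdom_def)

lemma dom_unit: "x \<in> units G \<Longrightarrow> gdom G x = x"
  by (auto simp: units_def dom_dom)

lemma ran_unit: "x \<in> units G \<Longrightarrow> gran G x = x"
  by (auto simp: units_def ran_dom)

lemma unit_iff_ran: "\<gamma> \<in> arrows G \<Longrightarrow> \<gamma> \<in> units G \<longleftrightarrow> gran G \<gamma> = \<gamma>"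
  using ran_unit ran_in_units by metis

lemma inv_comp_cancel:
  assumes "\<beta> \<in> arrows G" "\<gamma> \<in> arrows G" "gdom G \<beta> = gran G \<gamma>"
  shows "gcomp G (ginv G \<beta>) (gcomp G \<beta> \<gamma>) = \<gamma>"
proof -
  have "gcomp G (ginv G \<beta>) (gcomp G \<beta> \<gamma>) = gcomp G (gcomp G (ginv G \<beta>) \<beta>) \<gamma>"
    using assms by (intro comp_assoc[symmetric]) (auto simp: inv_closed dom_inv)
  then show ?thesis
    using assms ran_comp_left[of \<gamma>] by (simp add: gdom_def[symmetric])
qed

lemma comp_inv_cancel:
  assumes "\<beta> \<in> arrows G" "\<gamma> \<in> arrows G" "gran G \<beta> = gran G \<gamma>"
  shows "gcomp G \<beta> (gcomp G (ginv G \<beta>) \<gamma>) = \<gamma>"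
  using inv_comp_cancel[of "ginv G \<beta>" \<gamma>] assms by (simp add: inv_closed inv_inv dom_inv)

lemma inv_comp:
  assumes "\<beta> \<in> arrows G" "\<gamma> \<in> arrows G" "gran G \<beta> = gran G \<gamma>"
  shows "gcomp G (ginv G \<beta>) \<gamma> \<in> arrows G" "gran G (gcomp G (ginv G \<beta>) \<gamma>) = gdom G \<beta>"
    "gdom G (gcomp G (ginv G \<beta>) \<gamma>) = gdom G \<gamma>"
  using assms by (simp_all add: comp_closed inv_closed dom_inv ran_comp dom_comp ran_inv)

lemma inv_comp_self:
  "\<beta> \<in> arrows G \<Longrightarrow> gcomp G (ginv G \<beta>) \<beta> = gdom G \<beta>"
  by (simp add: gdom_def)

lemma comp_inv_self:
  "\<beta> \<in> arrows G \<Longrightarrow> gcomp G \<beta> (ginv G \<beta>) = gran G \<beta>"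
  by (simp add: gran_def)

lemma inv_unit:
  assumes "x \<in> units G"
  shows "ginv G x = x"
proof -
  have x: "x \<in> arrows G" using assms by (rule unit_closed)
  then show ?thesis
    using comp_dom[OF inv_closed[OF x]] assms by (simp add: dom_inv ran_unit inv_comp_self dom_unit)
qed

text \<open>In associativity of convolution, \<open>g \<star> h\<close> is evaluated at the inverse
  of \<beta> times \<gamma>, and its summation variable is the inverse of \<beta> times \<delta>.
  This identity removes \<beta> from the argument of the last factor.\<close>

lemma inv_comp_inv_comp:
  assumes "\<beta> \<in> arrows G" "\<delta> \<in> arrows G" "\<gamma> \<in> arrows G" "gran G \<beta> = gran G \<gamma>" "gran G \<delta> = gran G \<gamma>"
  shows "gcomp G (ginv G (gcomp G (ginv G \<beta>) \<delta>)) (gcomp G (ginv G \<beta>) \<gamma>) = gcomp G (ginv G \<delta>) \<gamma>"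
proof -
  let ?\<epsilon> = "gcomp G (ginv G \<beta>) \<delta>" and ?\<gamma>' = "gcomp G (ginv G \<delta>) \<gamma>"
  have \<epsilon>: "?\<epsilon> \<in> arrows G" "gdom G ?\<epsilon> = gdom G \<delta>" "gran G ?\<epsilon> = gdom G \<beta>"
    using assms inv_comp[of \<beta> \<delta>] by auto
  have \<gamma>': "?\<gamma>' \<in> arrows G" "gran G ?\<gamma>' = gdom G \<delta>"
    using assms inv_comp[of \<delta> \<gamma>] by auto
  have "gcomp G ?\<epsilon> ?\<gamma>' = gcomp G (ginv G \<beta>) (gcomp G \<delta> ?\<gamma>')"
    using assms \<gamma>' by (intro comp_assoc) (auto simp: inv_closed dom_inv)
  also have "\<dots> = gcomp G (ginv G \<beta>) \<gamma>"
    using assms comp_inv_cancel[of \<delta> \<gamma>] by simp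
  finally show ?thesis
    using inv_comp_cancel[of ?\<epsilon> ?\<gamma>'] \<epsilon> \<gamma>' by simp
qed

lemma orbit_subset: "orbit G x \<subseteq> units G"
  by (auto simp: orbit_def ran_in_units)

end

section \<open>Compact open bisections and their products\<close>

definition cob :: "'g groupoid \<Rightarrow> 'g set \<Rightarrow> bool" where
  "cob G U \<longleftrightarrow> bisection G U \<and> openin (arrow_top G) U \<and> compactin (arrow_top G) U"

definition set_comp :: "'g groupoid \<Rightarrow> 'g set \<Rightarrow> 'g set \<Rightarrow> 'g set" where
  "set_comp G U V = {gcomp G \<beta> \<rho> |\<beta> \<rho>. \<beta> \<in> U \<and> \<rho> \<in> V \<and> gdom G \<beta> = gran G \<rho>}"

context topological_groupoid
begin

lemma topspace_unit_top: "topspace (unit_top G) = units G"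
  using units_subset by (auto simp: unit_top_def arrows_def)

lemma continuous_gcomp:
  assumes "continuous_map Z (arrow_top G) f" "continuous_map Z (arrow_top G) g"
    and "\<And>z. z \<in> topspace Z \<Longrightarrow> gdom G (f z) = gran G (g z)"
  shows "continuous_map Z (arrow_top G) (\<lambda>z. gcomp G (f z) (g z))"
proof -
  have "continuous_map Z (subtopology (prod_topology (arrow_top G) (arrow_top G))
      {(\<beta>, \<gamma>). gdom G \<beta> = gran G \<gamma>}) (\<lambda>z. (f z, g z))"
    using assms by (intro continuous_map_into_subtopology continuous_map_pairedI) auto
  from continuous_map_compose[OF this continuous_comp] show ?thesis
    by (simp add: o_def)
qed

lemma continuous_ginv:
  assumes "continuous_map Z (arrow_top G) f"
  shows "continuous_map Z (arrow_top G) (\<lambda>z. ginv G (f z))"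
  using continuous_map_compose[OF assms continuous_inv] by (simp add: o_def)

lemma image_inv_eq: "U \<subseteq> arrows G \<Longrightarrow> ginv G ` U = {\<gamma> \<in> arrows G. ginv G \<gamma> \<in> U}"
  using inv_inv inv_closed by (auto simp: image_iff) (metis subsetD)

lemma openin_image_inv:
  assumes "openin (arrow_top G) U"
  shows "openin (arrow_top G) (ginv G ` U)"
proof -
  have "U \<subseteq> arrows G"
    using openin_subset[OF assms] by (simp add: arrows_def)
  then show ?thesis
    using continuous_inv assms by (simp add: image_inv_eq continuous_map_def arrows_def)
qed

end

context ample_groupoid
begin

lemma continuous_ran: "continuous_map (arrow_top G) (unit_top G) (gran G)"
  by (rule local_homeomorphism_imp_continuous_map[OF local_homeomorphism_ran])

lemma open_ran: "open_map (arrow_top G) (unit_top G) (gran G)"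
  by (rule local_homeomorphism_imp_open_map[OF local_homeomorphism_ran])

lemma continuous_dom: "continuous_map (arrow_top G) (unit_top G) (gdom G)"
proof (rule continuous_map_eq)
  show "continuous_map (arrow_top G) (unit_top G) (gran G \<circ> ginv G)"
    using continuous_inv continuous_ran by (rule continuous_map_compose)
qed (simp add: ran_inv arrows_def)

text \<open>Near a unit \<open>x\<close> the range map is injective on some open \<open>U\<close>.
  If \<gamma> and its range both lie in \<open>U\<close>, they have the same range, so \<gamma>
  equals its range and is a unit.\<close>

lemma openin_units: "openin (arrow_top G) (units G)"
proof (subst openin_subopen, intro ballI)
  fix x assume x: "x \<in> units G"
  then have "x \<in> topspace (arrow_top G)"
    using unit_closed by (simp add: arrows_def)
  with local_homeomorphism_ran obtain U
    where U: "openin (arrow_top G) U" "x \<in> U" "inj_on (gran G) U"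
    by (rule local_homeomorphism_locally_inj)
  let ?T = "U \<inter> {\<gamma> \<in> topspace (arrow_top G). gran G \<gamma> \<in> U \<inter> units G}"
  have "openin (unit_top G) (U \<inter> units G)"
    unfolding unit_top_def using U(1) by (rule openin_subtopology_Int)
  then have "openin (arrow_top G) ?T"
    using continuous_ran U(1) unfolding continuous_map_def by (intro openin_Int) blast+
  moreover have "x \<in> ?T"
    using x U unit_closed[OF x] by (simp add: ran_unit arrows_def)
  moreover have "\<gamma> \<in> units G" if \<gamma>: "\<gamma> \<in> ?T" for \<gamma>
  proof -
    have "gran G \<gamma> \<in> U" "\<gamma> \<in> U" "gran G (gran G \<gamma>) = gran G \<gamma>"
      using \<gamma> by (auto simp: ran_unit)
    then have "gran G \<gamma> = \<gamma>"
      using U(3) by (auto dest: inj_onD)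
    then show ?thesis using \<gamma> by auto
  qed
  ultimately show "\<exists>T. openin (arrow_top G) T \<and> x \<in> T \<and> T \<subseteq> units G"
    by blast
qed

lemma openin_unit_top: "openin (unit_top G) V \<longleftrightarrow> openin (arrow_top G) V \<and> V \<subseteq> units G"
  unfolding unit_top_def by (rule openin_open_subtopology[OF openin_units])

lemma compactin_unit_top: "compactin (unit_top G) K \<longleftrightarrow> compactin (arrow_top G) K \<and> K \<subseteq> units G"
  unfolding unit_top_def by (rule compactin_subtopology)

lemma closedin_compact_units: "compactin (unit_top G) K \<Longrightarrow> closedin (unit_top G) K"
  by (rule compactin_imp_closedin[OF Hausdorff_units])

lemma bisection_units: "K \<subseteq> units G \<Longrightarrow> bisection G K"
  using units_subset by (auto simp: bisection_def inj_on_def dom_unit ran_unit subset_iff)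

lemma cob_units_iff:
  assumes "K \<subseteq> units G"
  shows "cob G K \<longleftrightarrow> openin (unit_top G) K \<and> compactin (unit_top G) K"
  using assms bisection_units by (auto simp: cob_def openin_unit_top compactin_unit_top)

lemma cob_subset: "cob G U \<Longrightarrow> U \<subseteq> arrows G"
  by (simp add: cob_def bisection_def)

text \<open>The range map sends a bisection injectively and continuously into the Hausdorff unit
  space. So \<open>cob\<close> describes the same sets as the compact open bisections in
  \<open>bisection_sections\<close>, although the groupoid itself may not be Hausdorff.\<close>

lemma cob_Hausdorff:
  assumes "cob G U"
  shows "compact_Hausdorff_in (arrow_top G) U"
proof -
  have "Hausdorff_space (subtopology (arrow_top G) U)"
  proof (rule Hausdorff_space_injective_preimage[OF Hausdorff_units])
    show "continuous_map (subtopology (arrow_top G) U) (unit_top G) (gran G)"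
      by (rule continuous_map_from_subtopology[OF continuous_ran])
    show "inj_on (gran G) (topspace (subtopology (arrow_top G) U))"
      using assms by (auto simp: cob_def bisection_def intro: inj_on_subset)
  qed
  then show ?thesis
    using assms by (simp add: cob_def compact_Hausdorff_in_def)
qed

lemma cob_Un:
  assumes "cob G K" "cob G L" "K \<subseteq> units G" "L \<subseteq> units G"
  shows "cob G (K \<union> L)"
  using assms by (simp add: cob_units_iff openin_Un compactin_Un)

lemma cob_Int:
  assumes "cob G K" "cob G L" "K \<subseteq> units G" "L \<subseteq> units G"
  shows "cob G (K \<inter> L)"
  using assms compactin_Int[OF Hausdorff_units, of K L] by (auto simp: cob_units_iff openin_Int le_infI1)

lemma cob_empty: "cob G {}"
  by (simp add: cob_def bisection_def)

lemma cob_unit_nbhd: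
  assumes V: "openin (unit_top G) V" and x: "x \<in> V"
  obtains K where "cob G K" "x \<in> K" "K \<subseteq> V"
proof -
  have "(arbitrary union_of (\<lambda>K. openin (unit_top G) K \<and> compact_Hausdorff_in (unit_top G) K)) V"
    using V compact_open_basis by metis
  then obtain K where K: "openin (unit_top G) K" "compactin (unit_top G) K" "x \<in> K" "K \<subseteq> V"
    using x by (auto simp: union_of_def compact_Hausdorff_in_def)
  moreover have "K \<subseteq> units G"
    using K(1) by (simp add: openin_unit_top)
  ultimately show thesis
    by (intro that[of K]) (simp_all add: cob_units_iff)
qed

text \<open>\<open>U\<close> is the image of its set of ranges under the local inverse of the range
  map, which is continuous. Compactness can thus be checked in the unit space, where compact sets
  are closed.\<close>

lemma compactin_open_bisectionI:
  assumes U: "openin (arrow_top G) U" and inj: "inj_on (gran G) U"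
    and K: "compactin (unit_top G) (gran G ` U)"
  shows "compactin (arrow_top G) U"
proof -
  have "continuous_map (subtopology (unit_top G) (gran G ` U)) (arrow_top G) (inv_into U (gran G))"
    using open_ran U inj by (rule open_map_continuous_section)
  moreover have "compactin (subtopology (unit_top G) (gran G ` U)) (gran G ` U)"
    using K by (simp add: compactin_subtopology)
  ultimately have "compactin (arrow_top G) (inv_into U (gran G) ` gran G ` U)"
    using image_compactin by blast
  moreover have "inv_into U (gran G) ` gran G ` U = U"
    using inj by (simp add: inv_into_image_cancel)
  ultimately show ?thesis by simp
qed

text \<open>Only the range map is given as a local homeomorphism. Injectivity of the domain map
  comes from an injectivity neighbourhood \<open>B\<close> of the inverse arrow, and compactness
  from cutting down to the arrows whose range lies in a compact open set of units.\<close>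

lemma cob_nbhd:
  assumes W: "openin (arrow_top G) W" and \<gamma>: "\<gamma> \<in> W"
  obtains U where "cob G U" "\<gamma> \<in> U" "U \<subseteq> W"
proof -
  have WA: "W \<subseteq> arrows G"
    using openin_subset[OF W] by (simp add: arrows_def)
  with \<gamma> have \<gamma>A: "\<gamma> \<in> topspace (arrow_top G)" and i\<gamma>A: "ginv G \<gamma> \<in> topspace (arrow_top G)"
    using inv_closed by (auto simp: arrows_def)
  obtain A where A: "openin (arrow_top G) A" "\<gamma> \<in> A" "inj_on (gran G) A"
    using local_homeomorphism_ran \<gamma>A by (rule local_homeomorphism_locally_inj)
  obtain B where B: "openin (arrow_top G) B" "ginv G \<gamma> \<in> B" "inj_on (gran G) B"
    using local_homeomorphism_ran i\<gamma>A by (rule local_homeomorphism_locally_inj)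
  define C where "C = W \<inter> A \<inter> ginv G ` B"
  have BA: "B \<subseteq> arrows G"
    using openin_subset[OF B(1)] by (simp add: arrows_def)
  have C: "openin (arrow_top G) C"
    unfolding C_def using W A(1) openin_image_inv[OF B(1)] by (intro openin_Int)
  have "\<gamma> \<in> ginv G ` B"
    using B(2) \<gamma>A BA by (simp add: image_inv_eq arrows_def)
  with \<gamma> A have \<gamma>C: "\<gamma> \<in> C" by (simp add: C_def)
  have "openin (unit_top G) (gran G ` C)"
    using open_ran C by (simp add: open_map_def)
  moreover have "gran G \<gamma> \<in> gran G ` C"
    using \<gamma>C by blast
  ultimately obtain K where K: "cob G K" "gran G \<gamma> \<in> K" "K \<subseteq> gran G ` C"
    by (rule cob_unit_nbhd)
  define U where "U = C \<inter> {\<gamma> \<in> topspace (arrow_top G). gran G \<gamma> \<in> K}"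
  have CA: "C \<subseteq> arrows G"
    using WA by (auto simp: C_def)
  have KU: "K \<subseteq> units G"
    using K(3) CA ran_in_units by blast
  have Kc: "openin (unit_top G) K" "compactin (unit_top G) K"
    using K(1) KU by (auto simp: cob_units_iff)
  have UU: "openin (arrow_top G) U"
    unfolding U_def using C continuous_ran Kc(1) by (intro openin_Int) (simp_all add: continuous_map_def)
  have inj: "inj_on (gran G) U"
    using A(3) by (rule inj_on_subset) (auto simp: U_def C_def)
  have "inj_on (gdom G) U"
  proof (rule inj_onI)
    fix \<beta> \<delta> assume bd: "\<beta> \<in> U" "\<delta> \<in> U" "gdom G \<beta> = gdom G \<delta>"
    then have "\<beta> \<in> arrows G" "\<delta> \<in> arrows G" "ginv G \<beta> \<in> B" "ginv G \<delta> \<in> B"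
      using BA by (auto simp: U_def C_def image_inv_eq)
    then have "ginv G \<beta> = ginv G \<delta>"
      using inj_onD[OF B(3), of "ginv G \<beta>" "ginv G \<delta>"] bd(3) by (simp add: ran_inv)
    then show "\<beta> = \<delta>"
      using \<open>\<beta> \<in> arrows G\<close> \<open>\<delta> \<in> arrows G\<close> inv_inv by metis
  qed
  then have bis: "bisection G U"
    using inj CA by (auto simp: bisection_def U_def)
  have "gran G ` U = K"
    using K(3) CA by (auto simp: U_def arrows_def)
  with Kc have "compactin (arrow_top G) U"
    by (intro compactin_open_bisectionI UU inj) simp
  then have "cob G U"
    using bis UU by (simp add: cob_def)
  moreover have "\<gamma> \<in> U" "U \<subseteq> W"
    using \<gamma>C \<gamma>A K(2) by (auto simp: U_def C_def)
  ultimately show thesis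
    by (rule that)
qed

lemma cob_ran:
  assumes "cob G U"
  shows "cob G (gran G ` U)" "gran G ` U \<subseteq> units G"
proof -
  show sub: "gran G ` U \<subseteq> units G"
    using cob_subset[OF assms] ran_in_units by blast
  have "openin (unit_top G) (gran G ` U)"
    using assms open_ran by (simp add: cob_def open_map_def)
  moreover have "compactin (unit_top G) (gran G ` U)"
    using assms continuous_ran by (auto simp: cob_def intro: image_compactin)
  ultimately show "cob G (gran G ` U)"
    using sub by (simp add: cob_units_iff)
qed

lemma cob_inv:
  assumes "cob G U"
  shows "cob G (ginv G ` U)"
proof -
  have U: "U \<subseteq> arrows G" using assms by (rule cob_subset)
  have eqi: "\<gamma> = \<delta>" if "\<gamma> \<in> arrows G" "\<delta> \<in> arrows G" "ginv G \<gamma> = ginv G \<delta>" for \<gamma> \<delta>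
    using that inv_inv by metis
  have "inj_on (gdom G) U" "inj_on (gran G) U"
    using assms by (auto simp: cob_def bisection_def)
  then have "bisection G (ginv G ` U)"
    using U unfolding bisection_def
    by (auto simp: inj_on_def inv_closed dom_inv ran_inv subset_iff)
  moreover have "openin (arrow_top G) (ginv G ` U)"
    using assms by (simp add: cob_def openin_image_inv)
  moreover have "compactin (arrow_top G) (ginv G ` U)"
    using assms continuous_inv by (auto simp: cob_def intro: image_compactin)
  ultimately show ?thesis
    by (simp add: cob_def)
qed

lemma cob_section:
  assumes "cob G U"
  shows "continuous_map (subtopology (arrow_top G) {\<gamma> \<in> arrows G. gran G \<gamma> \<in> gran G ` U}) (arrow_top G)
    (\<lambda>\<gamma>. inv_into U (gran G) (gran G \<gamma>))"
proof -
  have "continuous_map (subtopology (unit_top G) (gran G ` U)) (arrow_top G) (inv_into U (gran G))"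
    using assms open_ran by (intro open_map_continuous_section) (auto simp: cob_def bisection_def)
  moreover have "continuous_map (subtopology (arrow_top G) {\<gamma> \<in> arrows G. gran G \<gamma> \<in> gran G ` U})
      (subtopology (unit_top G) (gran G ` U)) (gran G)"
    by (intro continuous_map_into_subtopology continuous_map_from_subtopology continuous_ran) auto
  ultimately have "continuous_map (subtopology (arrow_top G) {\<gamma> \<in> arrows G. gran G \<gamma> \<in> gran G ` U})
      (arrow_top G) (inv_into U (gran G) \<circ> gran G)"
    by (rule continuous_map_compose[rotated])
  then show ?thesis
    by (simp add: o_def)
qed

text \<open>The only possible left factor of \<gamma> in \<open>U\<close> is the arrow of
  \<open>U\<close> with the same range. So membership in the product becomes a condition on a
  function of \<gamma> that is continuous by \<open>cob_left_factor\<close>.\<close>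

lemma set_comp_factor:
  assumes U: "bisection G U" and V: "bisection G V"
  shows "\<gamma> \<in> set_comp G U V \<longleftrightarrow> \<gamma> \<in> arrows G \<and> gran G \<gamma> \<in> gran G ` U \<and>
    gcomp G (ginv G (inv_into U (gran G) (gran G \<gamma>))) \<gamma> \<in> V"
proof
  assume "\<gamma> \<in> set_comp G U V"
  then obtain \<beta> \<rho> where b: "\<beta> \<in> U" "\<rho> \<in> V" "gdom G \<beta> = gran G \<rho>" "\<gamma> = gcomp G \<beta> \<rho>"
    by (auto simp: set_comp_def)
  then have A: "\<beta> \<in> arrows G" "\<rho> \<in> arrows G"
    using U V by (auto simp: bisection_def)
  have "inv_into U (gran G) (gran G \<gamma>) = \<beta>"
    using U b A by (simp add: bisection_def ran_comp)
  then show "\<gamma> \<in> arrows G \<and> gran G \<gamma> \<in> gran G ` U \<and>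
    gcomp G (ginv G (inv_into U (gran G) (gran G \<gamma>))) \<gamma> \<in> V"
    using b A by (simp add: comp_closed ran_comp inv_comp_cancel)
next
  assume *: "\<gamma> \<in> arrows G \<and> gran G \<gamma> \<in> gran G ` U \<and>
    gcomp G (ginv G (inv_into U (gran G) (gran G \<gamma>))) \<gamma> \<in> V"
  then obtain \<beta> where b: "\<beta> \<in> U" "gran G \<gamma> = gran G \<beta>" by auto
  have bA: "\<beta> \<in> arrows G" using b U by (auto simp: bisection_def)
  have "inv_into U (gran G) (gran G \<gamma>) = \<beta>"
    using U b by (simp add: bisection_def)
  with * have "gcomp G (ginv G \<beta>) \<gamma> \<in> V" by simp
  moreover have "gran G (gcomp G (ginv G \<beta>) \<gamma>) = gdom G \<beta>"
    using inv_comp(2)[OF bA] * b(2) by auto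
  moreover have "gcomp G \<beta> (gcomp G (ginv G \<beta>) \<gamma>) = \<gamma>"
    using comp_inv_cancel[OF bA] * b(2) by auto
  ultimately show "\<gamma> \<in> set_comp G U V"
    unfolding set_comp_def using b(1) by (metis (mono_tags, lifting) mem_Collect_eq)
qed

lemma cob_left_factor:
  assumes U: "cob G U"
  shows "continuous_map (subtopology (arrow_top G) {\<gamma> \<in> arrows G. gran G \<gamma> \<in> gran G ` U}) (arrow_top G)
    (\<lambda>\<gamma>. gcomp G (ginv G (inv_into U (gran G) (gran G \<gamma>))) \<gamma>)"
proof (rule continuous_gcomp[OF continuous_ginv[OF cob_section[OF U]]])
  fix \<gamma> assume "\<gamma> \<in> topspace (subtopology (arrow_top G) {\<gamma> \<in> arrows G. gran G \<gamma> \<in> gran G ` U})"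
  then have "gran G \<gamma> \<in> gran G ` U" by simp
  then have "inv_into U (gran G) (gran G \<gamma>) \<in> U"
    "gran G (inv_into U (gran G) (gran G \<gamma>)) = gran G \<gamma>"
    by (auto intro: inv_into_into f_inv_into_f)
  then show "gdom G (ginv G (inv_into U (gran G) (gran G \<gamma>))) = gran G \<gamma>"
    using dom_inv cob_subset[OF U] by auto
qed (simp add: continuous_map_from_subtopology)

lemma openin_ran_preimage:
  assumes "openin (unit_top G) V"
  shows "openin (arrow_top G) {\<gamma> \<in> arrows G. gran G \<gamma> \<in> V}"
  using continuous_ran assms by (simp add: continuous_map_def arrows_def)

lemma cob_set_comp:
  assumes U: "cob G U" and V: "cob G V"
  shows "cob G (set_comp G U V)"
proof -
  have bU: "bisection G U" and bV: "bisection G V"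
    using U V by (auto simp: cob_def)
  have A: "U \<subseteq> arrows G" "V \<subseteq> arrows G"
    using U V by (auto simp: cob_subset)
  let ?D = "{\<gamma> \<in> arrows G. gran G \<gamma> \<in> gran G ` U}"
  let ?\<rho> = "\<lambda>\<gamma>. gcomp G (ginv G (inv_into U (gran G) (gran G \<gamma>))) \<gamma>"
  have D: "openin (arrow_top G) ?D"
    using cob_ran[OF U] by (intro openin_ran_preimage) (simp add: cob_units_iff)
  have "openin (subtopology (arrow_top G) ?D) {\<gamma> \<in> ?D. ?\<rho> \<gamma> \<in> V}"
    using cob_left_factor[OF U] V openin_subset[OF D]
    by (simp add: continuous_map_def cob_def inf_absorb2)
  then have "openin (arrow_top G) {\<gamma> \<in> ?D. ?\<rho> \<gamma> \<in> V}"
    using D by (rule openin_trans_full)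
  moreover have "set_comp G U V = {\<gamma> \<in> ?D. ?\<rho> \<gamma> \<in> V}"
    using set_comp_factor[OF bU bV] by auto
  ultimately have op: "openin (arrow_top G) (set_comp G U V)" by simp
  have sub: "set_comp G U V \<subseteq> arrows G"
    using A by (auto simp: set_comp_def comp_closed subset_iff)
  \<comment> \<open>Equal ranges of the products force equal left factors, then equal ranges of the
    right factors, hence equal right factors; equal domains work from the other end. Both
    injectivity claims below reduce to this.\<close>
  have eq: "\<beta> = \<beta>' \<and> \<rho> = \<rho>'" if "\<beta> \<in> U" "\<rho> \<in> V" "gdom G \<beta> = gran G \<rho>" "\<beta>' \<in> U" "\<rho>' \<in> V"
    "gdom G \<beta>' = gran G \<rho>'" "gran G \<beta> = gran G \<beta>' \<or> gdom G \<rho> = gdom G \<rho>'" for \<beta> \<rho> \<beta>' \<rho>'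
  proof -
    have i: "inj_on (gdom G) U" "inj_on (gran G) U" "inj_on (gdom G) V" "inj_on (gran G) V"
      using bU bV by (auto simp: bisection_def)
    have "\<rho> = \<rho>'" if "\<beta> = \<beta>'"
      using that \<open>\<rho> \<in> V\<close> \<open>\<rho>' \<in> V\<close> \<open>gdom G \<beta> = _\<close> \<open>gdom G \<beta>' = _\<close> inj_onD[OF i(4), of \<rho> \<rho>'] by simp
    moreover have "\<beta> = \<beta>'" if "\<rho> = \<rho>'"
      using that \<open>\<beta> \<in> U\<close> \<open>\<beta>' \<in> U\<close> \<open>gdom G \<beta> = _\<close> \<open>gdom G \<beta>' = _\<close> inj_onD[OF i(1), of \<beta> \<beta>'] by simp
    ultimately show ?thesis
      using that inj_onD[OF i(2), of \<beta> \<beta>'] inj_onD[OF i(3), of \<rho> \<rho>'] by blast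
  qed
  have inj: "inj_on (gran G) (set_comp G U V)"
  proof (rule inj_onI)
    fix \<gamma> \<delta> assume "\<gamma> \<in> set_comp G U V" "\<delta> \<in> set_comp G U V" and r: "gran G \<gamma> = gran G \<delta>"
    then obtain \<beta> \<rho> \<beta>' \<rho>' where b: "\<beta> \<in> U" "\<rho> \<in> V" "gdom G \<beta> = gran G \<rho>" "\<beta>' \<in> U" "\<rho>' \<in> V"
      "gdom G \<beta>' = gran G \<rho>'" "\<gamma> = gcomp G \<beta> \<rho>" "\<delta> = gcomp G \<beta>' \<rho>'"
      by (auto simp: set_comp_def)
    moreover have "gran G \<gamma> = gran G \<beta>" "gran G \<delta> = gran G \<beta>'"
      using b A by (auto simp: ran_comp subset_iff)
    ultimately show "\<gamma> = \<delta>" using r eq by metis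
  qed
  have injd: "inj_on (gdom G) (set_comp G U V)"
  proof (rule inj_onI)
    fix \<gamma> \<delta> assume "\<gamma> \<in> set_comp G U V" "\<delta> \<in> set_comp G U V" and r: "gdom G \<gamma> = gdom G \<delta>"
    then obtain \<beta> \<rho> \<beta>' \<rho>' where b: "\<beta> \<in> U" "\<rho> \<in> V" "gdom G \<beta> = gran G \<rho>" "\<beta>' \<in> U" "\<rho>' \<in> V"
      "gdom G \<beta>' = gran G \<rho>'" "\<gamma> = gcomp G \<beta> \<rho>" "\<delta> = gcomp G \<beta>' \<rho>'"
      by (auto simp: set_comp_def)
    moreover have "gdom G \<gamma> = gdom G \<rho>" "gdom G \<delta> = gdom G \<rho>'"
      using b A by (auto simp: dom_comp subset_iff)
    ultimately show "\<gamma> = \<delta>" using r eq by metis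
  qed
  \<comment> \<open>The arrows of \<open>U\<close> that can be composed with some arrow of
    \<open>V\<close> form \<open>?W \<inter> U\<close>. The ranges of \<open>V\<close> form a
    compact, hence closed, subset of the Hausdorff unit space. So \<open>?W\<close> is closed and
    \<open>?W \<inter> U\<close> is compact, and it has the same ranges as the product.\<close>
  let ?W = "{\<beta> \<in> arrows G. gdom G \<beta> \<in> gran G ` V}"
  have "closedin (arrow_top G) ?W"
    using continuous_dom closedin_compact_units cob_ran[OF V] 
    by (simp add: continuous_map_closedin arrows_def cob_units_iff)
  then have "compactin (arrow_top G) (?W \<inter> U)"
    using U by (intro closed_Int_compactin) (auto simp: cob_def)
  then have "compactin (unit_top G) (gran G ` (?W \<inter> U))"
    using continuous_ran by (rule image_compactin)
  moreover have "gran G ` (?W \<inter> U) = gran G ` set_comp G U V"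
  proof (intro equalityI subsetI)
    fix x assume "x \<in> gran G ` (?W \<inter> U)"
    then obtain \<beta> \<rho> where b: "\<beta> \<in> U" "\<rho> \<in> V" "gdom G \<beta> = gran G \<rho>" "x = gran G \<beta>" by auto
    then have "gcomp G \<beta> \<rho> \<in> set_comp G U V" "x = gran G (gcomp G \<beta> \<rho>)"
      using A by (auto simp: set_comp_def ran_comp subset_iff)
    then show "x \<in> gran G ` set_comp G U V" by blast
  next
    fix x assume "x \<in> gran G ` set_comp G U V"
    then obtain \<beta> \<rho> where b: "\<beta> \<in> U" "\<rho> \<in> V" "gdom G \<beta> = gran G \<rho>" "x = gran G (gcomp G \<beta> \<rho>)"
      by (auto simp: set_comp_def)
    then have "\<beta> \<in> ?W \<inter> U" "x = gran G \<beta>"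
      using A by (auto simp: ran_comp subset_iff)
    then show "x \<in> gran G ` (?W \<inter> U)" by blast
  qed
  ultimately have "compactin (arrow_top G) (set_comp G U V)"
    by (intro compactin_open_bisectionI op inj) simp
  then show ?thesis
    using op inj injd sub by (simp add: cob_def bisection_def)
qed

end

section \<open>Sections of a sheaf of rings\<close>

lemma (in abelian_monoid) finsum_swap:
  assumes "finite A" "finite B" "\<And>i j. i \<in> A \<Longrightarrow> j \<in> B \<Longrightarrow> f i j \<in> carrier G"
  shows "(\<Oplus>i\<in>A. \<Oplus>j\<in>B. f i j) = (\<Oplus>j\<in>B. \<Oplus>i\<in>A. f i j)"
  using assms(1,3)
proof (induction A)
  case empty
  then show ?case by simp
next
  case (insert a A)
  have "(\<Oplus>j\<in>B. \<Oplus>i\<in>insert a A. f i j) = (\<Oplus>j\<in>B. f a j \<oplus> (\<Oplus>i\<in>A. f i j))"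
    using insert by (intro finsum_cong') (auto intro!: finsum_closed a_closed)
  also have "\<dots> = (\<Oplus>j\<in>B. f a j) \<oplus> (\<Oplus>j\<in>B. \<Oplus>i\<in>A. f i j)"
    using insert by (intro finsum_addf) (auto intro!: finsum_closed)
  also have "\<dots> = (\<Oplus>i\<in>insert a A. \<Oplus>j\<in>B. f i j)"
    using insert by (subst finsum_insert) (auto intro!: finsum_closed)
  finally show ?case by simp
qed

lemma ring_hom_finsum:
  assumes "ring R" "ring T" "h \<in> ring_hom R T" "finite A" "f \<in> A \<rightarrow> carrier R"
  shows "h (finsum R f A) = finsum T (\<lambda>i. h (f i)) A"
proof -
  interpret R: ring R by fact
  interpret T: ring T by fact
  note h = assms(3)
  from assms(4,5) show ?thesis
  proof (induction A)
    case empty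
    then show ?case
      using ring_hom_zero[OF h R.ring_axioms T.ring_axioms] by simp
  next
    case (insert a A)
    then show ?case
      using ring_hom_add[OF h] ring_hom_closed[OF h] by (simp add: Pi_def)
  qed
qed

text \<open>The local inverse of \<open>proj S\<close> on an injectivity neighbourhood of
  \<open>e\<close>.\<close>

lemma (in gsheaf) local_section:
  assumes e: "e \<in> topspace (total S)"
  obtains N q where "openin (unit_top G) N" "proj S e \<in> N"
    "continuous_map (subtopology (unit_top G) N) (total S) q"
    "\<And>y. y \<in> N \<Longrightarrow> q y \<in> topspace (total S) \<and> proj S (q y) = y" "q (proj S e) = e"
proof -
  obtain U where U: "openin (total S) U" "e \<in> U" "inj_on (proj S) U"
    using local_homeomorphism_proj e by (rule local_homeomorphism_locally_inj)
  have op: "open_map (total S) (unit_top G) (proj S)"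
    using local_homeomorphism_proj by (rule local_homeomorphism_imp_open_map)
  show thesis
  proof (rule that)
    show "openin (unit_top G) (proj S ` U)"
      using op U(1) by (simp add: open_map_def)
    show "proj S e \<in> proj S ` U"
      using U(2) by (rule imageI)
    show "continuous_map (subtopology (unit_top G) (proj S ` U)) (total S) (inv_into U (proj S))"
      using op U(1,3) by (rule open_map_continuous_section)
    show "inv_into U (proj S) y \<in> topspace (total S) \<and> proj S (inv_into U (proj S) y) = y"
      if "y \<in> proj S ` U" for y
      using inv_into_into[OF that] f_inv_into_f[OF that] openin_subset[OF U(1)] by blast
    show "inv_into U (proj S) (proj S e) = e"
      using U(2,3) by simp
  qed
qed

context gsheaf_of_rings
begin

lemma stalk_simps:
  "fmult S = mult (stalk S x)" "fadd S = add (stalk S x)" "fzero S x = zero (stalk S x)"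
  "fone S x = one (stalk S x)"
  by (simp_all add: stalk_def)

lemma in_stalk_iff: "e \<in> carrier (stalk S x) \<longleftrightarrow> e \<in> topspace (total S) \<and> proj S e = x"
  by (simp add: stalk_def)

lemma continuous_proj: "continuous_map (total S) (unit_top G) (proj S)"
  by (rule local_homeomorphism_imp_continuous_map[OF local_homeomorphism_proj])

lemma proj_in_units: "e \<in> topspace (total S) \<Longrightarrow> proj S e \<in> units G"
  using continuous_proj by (auto simp: continuous_map_def topspace_unit_top)

lemma fzero_closed: "x \<in> units G \<Longrightarrow> fzero S x \<in> carrier (stalk S x)"
  using ring.ring_simprules(2)[OF ring_stalk] by (simp add: stalk_simps(3))

lemma fone_closed: "x \<in> units G \<Longrightarrow> fone S x \<in> carrier (stalk S x)"
  using ring.ring_simprules(6)[OF ring_stalk] by (simp add: stalk_simps(4))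

lemma continuous_map_fadd:
  assumes "continuous_map Z (total S) f" "continuous_map Z (total S) g"
    and "\<And>z. z \<in> topspace Z \<Longrightarrow> proj S (f z) = proj S (g z)"
  shows "continuous_map Z (total S) (\<lambda>z. fadd S (f z) (g z))"
proof -
  have "continuous_map Z (subtopology (prod_topology (total S) (total S))
      {(e, e'). proj S e = proj S e'}) (\<lambda>z. (f z, g z))"
    using assms by (intro continuous_map_into_subtopology continuous_map_pairedI) auto
  from continuous_map_compose[OF this continuous_fadd] show ?thesis
    by (simp add: o_def)
qed

lemma continuous_map_fmult:
  assumes "continuous_map Z (total S) f" "continuous_map Z (total S) g"
    and "\<And>z. z \<in> topspace Z \<Longrightarrow> proj S (f z) = proj S (g z)"
  shows "continuous_map Z (total S) (\<lambda>z. fmult S (f z) (g z))"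
proof -
  have "continuous_map Z (subtopology (prod_topology (total S) (total S))
      {(e, e'). proj S e = proj S e'}) (\<lambda>z. (f z, g z))"
    using assms by (intro continuous_map_into_subtopology continuous_map_pairedI) auto
  from continuous_map_compose[OF this continuous_fmult] show ?thesis
    by (simp add: o_def)
qed

lemma continuous_map_act:
  assumes "continuous_map Z (arrow_top G) f" "continuous_map Z (total S) g"
    and "\<And>z. z \<in> topspace Z \<Longrightarrow> gdom G (f z) = proj S (g z)"
  shows "continuous_map Z (total S) (\<lambda>z. act S (f z) (g z))"
proof -
  have "continuous_map Z (subtopology (prod_topology (arrow_top G) (total S))
      {(\<gamma>, e). gdom G \<gamma> = proj S e}) (\<lambda>z. (f z, g z))"
    using assms by (intro continuous_map_into_subtopology continuous_map_pairedI) auto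
  from continuous_map_compose[OF this continuous_act] show ?thesis
    by (simp add: o_def)
qed

lemma continuous_map_comp_unit:
  assumes "continuous_map (unit_top G) (total S) s" "continuous_map Z (unit_top G) f"
  shows "continuous_map Z (total S) (\<lambda>z. s (f z))"
  using continuous_map_compose[OF assms(2,1)] by (simp add: o_def)

text \<open>Continuity of zero and of negation is automatic: a continuous local section that solves
  \<open>t + t = t\<close> (or \<open>e + t = 0\<close>) at one point solves it nearby.\<close>

lemma continuous_fzero: "continuous_map (unit_top G) (total S) (fzero S)"
proof (rule continuous_map_locallyI)
  fix x assume "x \<in> topspace (unit_top G)"
  then have x: "x \<in> units G" by (simp add: topspace_unit_top)
  then have "fzero S x \<in> topspace (total S)" and px: "proj S (fzero S x) = x"
    using fzero_closed by (auto simp: in_stalk_iff)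
  then obtain N q where N: "openin (unit_top G) N" "x \<in> N"
    and q: "continuous_map (subtopology (unit_top G) N) (total S) q"
    and qs: "\<And>y. y \<in> N \<Longrightarrow> q y \<in> topspace (total S) \<and> proj S (q y) = y" "q x = fzero S x"
    using local_section by metis
  have NU: "N \<subseteq> units G"
    using N(1) by (simp add: openin_unit_top)
  have tN: "topspace (subtopology (unit_top G) N) = N"
    using NU by (simp add: topspace_unit_top inf_absorb2)
  have qs': "y \<in> units G \<and> q y \<in> carrier (stalk S y)" if "y \<in> N" for y
    using qs that NU by (auto simp: in_stalk_iff)
  let ?T = "{y \<in> N. fadd S (q y) (q y) = q y}"
  have "openin (subtopology (unit_top G) N)
    {y \<in> topspace (subtopology (unit_top G) N). fadd S (q y) (q y) = q y}"
  proof (rule local_homeomorphism_agree[OF local_homeomorphism_proj continuous_map_fadd q])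
    fix y assume "y \<in> topspace (subtopology (unit_top G) N)"
    then have y: "y \<in> units G" "q y \<in> carrier (stalk S y)" using qs' tN by auto
    then interpret ring "stalk S y" by (intro ring_stalk)
    have "fadd S (q y) (q y) \<in> carrier (stalk S y)"
      using y by (simp add: stalk_simps[of y])
    then show "proj S (fadd S (q y) (q y)) = proj S (q y)"
      using y by (simp add: in_stalk_iff)
  qed (use q in auto)
  then have "openin (subtopology (unit_top G) N) ?T"
    unfolding tN .
  then have T: "openin (unit_top G) ?T"
    using N(1) by (rule openin_trans_full)
  have eq: "q y = fzero S y" if "y \<in> ?T" for y
  proof -
    have y: "y \<in> units G" "q y \<in> carrier (stalk S y)" "fadd S (q y) (q y) = q y"
      using that qs' by auto
    then interpret ring "stalk S y" by (intro ring_stalk)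
    show ?thesis
      using y by (simp add: stalk_simps[of y])
  qed
  have "x \<in> ?T"
  proof -
    interpret ring "stalk S x" using x by (rule ring_stalk)
    show ?thesis
      using N(2) qs(2) by (simp add: stalk_simps[of x])
  qed
  moreover have "continuous_map (subtopology (unit_top G) ?T) (total S) (fzero S)"
  proof (rule continuous_map_eq)
    show "continuous_map (subtopology (unit_top G) ?T) (total S) q"
      by (rule continuous_map_from_subtopology_mono[OF q]) auto
    fix y assume "y \<in> topspace (subtopology (unit_top G) ?T)"
    then have "y \<in> ?T" unfolding topspace_subtopology by (rule IntD2)
    then show "q y = fzero S y" by (rule eq)
  qed
  ultimately show "\<exists>U. openin (unit_top G) U \<and> x \<in> U \<and>
      continuous_map (subtopology (unit_top G) U) (total S) (fzero S)"
    using T by blast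
qed

lemma continuous_neg: "continuous_map (total S) (total S) (\<lambda>e. \<ominus>\<^bsub>stalk S (proj S e)\<^esub> e)"
proof (rule continuous_map_locallyI)
  fix e assume e: "e \<in> topspace (total S)"
  define x where "x = proj S e"
  have x: "x \<in> units G" using e by (simp add: x_def proj_in_units)
  have es: "e \<in> carrier (stalk S x)" using e by (simp add: in_stalk_iff x_def)
  interpret x: ring "stalk S x" using x by (rule ring_stalk)
  have "\<ominus>\<^bsub>stalk S x\<^esub> e \<in> carrier (stalk S x)" using es by simp
  then have "\<ominus>\<^bsub>stalk S x\<^esub> e \<in> topspace (total S)" "proj S (\<ominus>\<^bsub>stalk S x\<^esub> e) = x"
    by (auto simp: in_stalk_iff)
  then obtain N q where N: "openin (unit_top G) N" "x \<in> N"
    and q: "continuous_map (subtopology (unit_top G) N) (total S) q"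
    and qs: "\<And>y. y \<in> N \<Longrightarrow> q y \<in> topspace (total S) \<and> proj S (q y) = y" "q x = \<ominus>\<^bsub>stalk S x\<^esub> e"
    using local_section by metis
  have NU: "N \<subseteq> units G"
    using N(1) by (simp add: openin_unit_top)
  let ?M = "{e \<in> topspace (total S). proj S e \<in> N}"
  have M: "openin (total S) ?M"
    using continuous_proj N(1) by (simp add: continuous_map_def)
  have tM: "topspace (subtopology (total S) ?M) = ?M" by auto
  have pM: "continuous_map (subtopology (total S) ?M) (unit_top G) (proj S)"
    by (rule continuous_map_from_subtopology[OF continuous_proj])
  then have "continuous_map (subtopology (total S) ?M) (subtopology (unit_top G) N) (proj S)"
    by (rule continuous_map_into_subtopology) auto
  then have qp: "continuous_map (subtopology (total S) ?M) (total S) (\<lambda>d. q (proj S d))"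
    using continuous_map_compose[OF _ q] by (simp add: o_def)
  have zp: "continuous_map (subtopology (total S) ?M) (total S) (\<lambda>d. fzero S (proj S d))"
    using continuous_fzero pM by (rule continuous_map_comp_unit)
  have id: "continuous_map (subtopology (total S) ?M) (total S) (\<lambda>d. d)"
    by (rule continuous_map_from_subtopology) simp
  \<comment> \<open>The candidate for negation on the total space is \<open>q\<close> pulled back
    along \<open>proj S\<close>. It depends on the base point only, and it is correct exactly on
    \<open>?T\<close>.\<close>
  let ?T = "{d \<in> ?M. fadd S d (q (proj S d)) = fzero S (proj S d)}"
  have "openin (subtopology (total S) ?M)
    {d \<in> topspace (subtopology (total S) ?M). fadd S d (q (proj S d)) = fzero S (proj S d)}"
  proof (rule local_homeomorphism_agree[OF local_homeomorphism_proj continuous_map_fadd[OF id qp] zp])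
    fix d assume "d \<in> topspace (subtopology (total S) ?M)"
    then have d: "d \<in> topspace (total S)" "proj S d \<in> N" by auto
    then show "proj S d = proj S (q (proj S d))"
      using qs by simp
    have y: "proj S d \<in> units G" using d NU by blast
    then interpret ring "stalk S (proj S d)" by (rule ring_stalk)
    have "d \<in> carrier (stalk S (proj S d))" "q (proj S d) \<in> carrier (stalk S (proj S d))"
      using d qs by (auto simp: in_stalk_iff)
    then have "fadd S d (q (proj S d)) \<in> carrier (stalk S (proj S d))"
      by (simp add: stalk_simps[of "proj S d"])
    then show "proj S (fadd S d (q (proj S d))) = proj S (fzero S (proj S d))"
      using fzero_closed[OF y] by (simp add: in_stalk_iff)
  qed
  then have "openin (subtopology (total S) ?M) ?T"
    unfolding tM by simp
  then have T: "openin (total S) ?T"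
    using M by (rule openin_trans_full)
  have eq: "q (proj S d) = \<ominus>\<^bsub>stalk S (proj S d)\<^esub> d" if "d \<in> ?T" for d
  proof -
    have d: "d \<in> topspace (total S)" "proj S d \<in> N" "fadd S d (q (proj S d)) = fzero S (proj S d)"
      using that by auto
    have y: "proj S d \<in> units G" using d NU by blast
    then interpret ring "stalk S (proj S d)" by (rule ring_stalk)
    have dq: "d \<in> carrier (stalk S (proj S d))" "q (proj S d) \<in> carrier (stalk S (proj S d))"
      using d qs by (auto simp: in_stalk_iff)
    then have "q (proj S d) \<oplus>\<^bsub>stalk S (proj S d)\<^esub> d = \<zero>\<^bsub>stalk S (proj S d)\<^esub>"
      using d(3) by (simp add: stalk_simps[of "proj S d"] a_comm)
    then show ?thesis
      using dq by (intro minus_equality[symmetric]) auto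
  qed
  have "e \<in> ?T"
    using e N(2) qs(2) es by (simp add: x_def[symmetric] stalk_simps[of x] x.r_neg)
  moreover have "continuous_map (subtopology (total S) ?T) (total S) (\<lambda>e. \<ominus>\<^bsub>stalk S (proj S e)\<^esub> e)"
  proof (rule continuous_map_eq)
    show "continuous_map (subtopology (total S) ?T) (total S) (\<lambda>d. q (proj S d))"
      by (rule continuous_map_from_subtopology_mono[OF qp]) auto
    fix d assume "d \<in> topspace (subtopology (total S) ?T)"
    then have "d \<in> ?T" unfolding topspace_subtopology by (rule IntD2)
    then show "q (proj S d) = \<ominus>\<^bsub>stalk S (proj S d)\<^esub> d" by (rule eq)
  qed
  ultimately show "\<exists>U. openin (total S) U \<and> e \<in> U \<and>
      continuous_map (subtopology (total S) U) (total S) (\<lambda>e. \<ominus>\<^bsub>stalk S (proj S e)\<^esub> e)"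
    using T by blast
qed

section \<open>The additive group of sections\<close>

abbreviation R :: "('g \<Rightarrow> 'e) ring" where
  "R \<equiv> Gamma_c G S"

abbreviation conv (infixl \<open>\<star>\<close> 70) where
  "f \<star> g \<equiv> f \<otimes>\<^bsub>R\<^esub> g"

abbreviation secs :: "('g \<Rightarrow> 'e) set" where
  "secs \<equiv> carrier (section_group G S)"

lemma secs_iff:
  "f \<in> secs \<longleftrightarrow> f \<in> extensional (arrows G) \<and> (\<forall>\<gamma> \<in> arrows G. f \<gamma> \<in> carrier (stalk S (gran G \<gamma>)))"
  by (simp add: section_group_def in_stalk_iff)

lemma secs_apply: "\<lbrakk>f \<in> secs; \<gamma> \<in> arrows G\<rbrakk> \<Longrightarrow> f \<gamma> \<in> carrier (stalk S (gran G \<gamma>))"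
  by (simp add: secs_iff)

lemma secs_ext:
  "\<lbrakk>f \<in> secs; g \<in> secs; \<And>\<gamma>. \<gamma> \<in> arrows G \<Longrightarrow> f \<gamma> = g \<gamma>\<rbrakk> \<Longrightarrow> f = g"
  using extensionalityI[of f "arrows G" g] by (simp add: secs_iff)

lemma ring_at: "\<gamma> \<in> arrows G \<Longrightarrow> ring (stalk S (gran G \<gamma>))"
  by (simp add: ring_stalk ran_in_units)

lemma add_apply: "\<gamma> \<in> arrows G \<Longrightarrow> (f \<oplus>\<^bsub>R\<^esub> g) \<gamma> = f \<gamma> \<oplus>\<^bsub>stalk S (gran G \<gamma>)\<^esub> g \<gamma>"
  by (simp add: Gamma_c_def section_group_def stalk_def)

lemma zero_apply: "\<gamma> \<in> arrows G \<Longrightarrow> \<zero>\<^bsub>R\<^esub> \<gamma> = \<zero>\<^bsub>stalk S (gran G \<gamma>)\<^esub>"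
  by (simp add: Gamma_c_def section_group_def stalk_def)

lemma add_in_secs: "\<lbrakk>f \<in> secs; g \<in> secs\<rbrakk> \<Longrightarrow> f \<oplus>\<^bsub>R\<^esub> g \<in> secs"
  using ring.ring_simprules(1)[OF ring_at]
  by (auto simp: secs_iff add_apply) (simp add: Gamma_c_def section_group_def)

lemma zero_in_secs: "\<zero>\<^bsub>R\<^esub> \<in> secs"
  using ring.ring_simprules(2)[OF ring_at]
  by (auto simp: secs_iff zero_apply) (simp add: Gamma_c_def section_group_def)

text \<open>The inverse \<open>\<ominus>\<close> of the ring is chosen inside its carrier and comes
  without a pointwise formula. This one is pointwise and exists for all sections;
  \<open>Gamma_neg\<close> shows that the two agree.\<close>

definition neg :: "('g \<Rightarrow> 'e) \<Rightarrow> 'g \<Rightarrow> 'e" where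
  "neg f = (\<lambda>\<gamma>\<in>arrows G. \<ominus>\<^bsub>stalk S (gran G \<gamma>)\<^esub> f \<gamma>)"

lemma neg_apply: "\<gamma> \<in> arrows G \<Longrightarrow> neg f \<gamma> = \<ominus>\<^bsub>stalk S (gran G \<gamma>)\<^esub> f \<gamma>"
  by (simp add: neg_def)

lemma neg_in_secs: "f \<in> secs \<Longrightarrow> neg f \<in> secs"
  using ring.ring_simprules(3)[OF ring_at]
  by (auto simp: secs_iff neg_apply) (simp add: neg_def)

lemma neg_add: "f \<in> secs \<Longrightarrow> neg f \<oplus>\<^bsub>R\<^esub> f = \<zero>\<^bsub>R\<^esub>"
proof (rule secs_ext)
  fix \<gamma> assume f: "f \<in> secs" and \<gamma>: "\<gamma> \<in> arrows G"
  interpret ring "stalk S (gran G \<gamma>)" using \<gamma> by (rule ring_at)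
  show "(neg f \<oplus>\<^bsub>R\<^esub> f) \<gamma> = \<zero>\<^bsub>R\<^esub> \<gamma>"
    using f \<gamma> secs_apply[OF f \<gamma>] by (simp add: add_apply neg_apply zero_apply l_neg)
qed (auto intro: add_in_secs neg_in_secs zero_in_secs)

lemma section_group_simps:
  "mult (section_group G S) = add R" "one (section_group G S) = zero R"
  by (simp_all add: Gamma_c_def)

lemma comm_group_section_group: "comm_group (section_group G S)"
proof (rule comm_groupI)
  show "\<exists>y\<in>secs. y \<otimes>\<^bsub>section_group G S\<^esub> f = \<one>\<^bsub>section_group G S\<^esub>" if "f \<in> secs" for f
    using neg_add[OF that] neg_in_secs[OF that] by (auto simp: section_group_simps)
next
  fix f g h assume f: "f \<in> secs" and g: "g \<in> secs" and h: "h \<in> secs"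
  show "f \<otimes>\<^bsub>section_group G S\<^esub> g \<otimes>\<^bsub>section_group G S\<^esub> h =
    f \<otimes>\<^bsub>section_group G S\<^esub> (g \<otimes>\<^bsub>section_group G S\<^esub> h)"
    unfolding section_group_simps
  proof (rule secs_ext)
    fix \<gamma> assume \<gamma>: "\<gamma> \<in> arrows G"
    show "(f \<oplus>\<^bsub>R\<^esub> g \<oplus>\<^bsub>R\<^esub> h) \<gamma> = (f \<oplus>\<^bsub>R\<^esub> (g \<oplus>\<^bsub>R\<^esub> h)) \<gamma>"
      using ring.ring_simprules(7)[OF ring_at[OF \<gamma>]] f g h \<gamma> by (simp add: add_apply secs_apply)
  qed (use f g h in \<open>auto intro: add_in_secs\<close>)
next
  fix f g assume f: "f \<in> secs" and g: "g \<in> secs"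
  show "f \<otimes>\<^bsub>section_group G S\<^esub> g = g \<otimes>\<^bsub>section_group G S\<^esub> f"
    unfolding section_group_simps
  proof (rule secs_ext)
    fix \<gamma> assume \<gamma>: "\<gamma> \<in> arrows G"
    show "(f \<oplus>\<^bsub>R\<^esub> g) \<gamma> = (g \<oplus>\<^bsub>R\<^esub> f) \<gamma>"
      using ring.ring_simprules(10)[OF ring_at[OF \<gamma>]] f g \<gamma> by (simp add: add_apply secs_apply)
  qed (use f g in \<open>auto intro: add_in_secs\<close>)
next
  fix f assume f: "f \<in> secs"
  show "\<one>\<^bsub>section_group G S\<^esub> \<otimes>\<^bsub>section_group G S\<^esub> f = f"
    unfolding section_group_simps
  proof (rule secs_ext)
    fix \<gamma> assume \<gamma>: "\<gamma> \<in> arrows G"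
    show "(\<zero>\<^bsub>R\<^esub> \<oplus>\<^bsub>R\<^esub> f) \<gamma> = f \<gamma>"
      using ring.ring_simprules(8)[OF ring_at[OF \<gamma>]] f \<gamma> by (simp add: add_apply zero_apply secs_apply)
  qed (use f in \<open>auto intro: add_in_secs zero_in_secs\<close>)
qed (simp_all add: section_group_simps add_in_secs zero_in_secs)

text \<open>The bisection is kept as a parameter because the argument on ideals has to know that
  negatives and commutators with diagonal elements live on the same bisection as before.\<close>

definition bis_section :: "'g set \<Rightarrow> ('g \<Rightarrow> 'e) \<Rightarrow> bool" where
  "bis_section U f \<longleftrightarrow> f \<in> secs \<and> cob G U \<and>
     continuous_map (subtopology (arrow_top G) U) (total S) f \<and>
     (\<forall>\<gamma> \<in> arrows G - U. f \<gamma> = \<zero>\<^bsub>stalk S (gran G \<gamma>)\<^esub>)"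

lemma bisection_sections_iff: "f \<in> bisection_sections G S \<longleftrightarrow> (\<exists>U. bis_section U f)"
proof
  assume "f \<in> bisection_sections G S"
  then show "\<exists>U. bis_section U f"
    unfolding bisection_sections_def bis_section_def cob_def compact_Hausdorff_in_def
      stalk_simps(3) by blast
next
  assume "\<exists>U. bis_section U f"
  then show "f \<in> bisection_sections G S"
    using cob_Hausdorff unfolding bisection_sections_def bis_section_def cob_def
      stalk_simps(3) by blast
qed

lemma bis_section_neg:
  assumes "bis_section U f"
  shows "bis_section U (neg f)"
proof -
  have f: "f \<in> secs" "cob G U" "continuous_map (subtopology (arrow_top G) U) (total S) f"
    and z: "\<And>\<gamma>. \<gamma> \<in> arrows G - U \<Longrightarrow> f \<gamma> = \<zero>\<^bsub>stalk S (gran G \<gamma>)\<^esub>"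
    using assms by (auto simp: bis_section_def)
  have "continuous_map (subtopology (arrow_top G) U) (total S) (\<lambda>\<gamma>. \<ominus>\<^bsub>stalk S (proj S (f \<gamma>))\<^esub> f \<gamma>)"
    using continuous_map_compose[OF f(3) continuous_neg] by (simp add: o_def)
  then have "continuous_map (subtopology (arrow_top G) U) (total S) (neg f)"
  proof (rule continuous_map_eq)
    fix \<gamma> assume "\<gamma> \<in> topspace (subtopology (arrow_top G) U)"
    then have "\<gamma> \<in> arrows G" by (simp add: arrows_def)
    then show "\<ominus>\<^bsub>stalk S (proj S (f \<gamma>))\<^esub> f \<gamma> = neg f \<gamma>"
      using secs_apply[OF f(1)] by (simp add: neg_apply in_stalk_iff)
  qed
  moreover have "neg f \<gamma> = \<zero>\<^bsub>stalk S (gran G \<gamma>)\<^esub>" if \<gamma>: "\<gamma> \<in> arrows G - U" for \<gamma>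
  proof -
    interpret ring "stalk S (gran G \<gamma>)" using \<gamma> by (intro ring_at) simp
    show ?thesis using z \<gamma> by (simp add: neg_apply)
  qed
  ultimately show ?thesis
    using f by (simp add: bis_section_def neg_in_secs)
qed

lemma Gamma_carrier: "carrier R = generate (section_group G S) (bisection_sections G S)"
  by (simp add: Gamma_c_def)

lemma bis_in_Gamma: "bis_section U f \<Longrightarrow> f \<in> carrier R"
  unfolding Gamma_carrier by (rule generate.incl) (auto simp: bisection_sections_iff)

text \<open>Generation as a group includes inverses. The negative of a bisection section is again a
  section on the same bisection, so inverses need no case of their own.\<close>

lemma Gamma_induct [consumes 1, case_names zero bis add]:
  assumes f: "f \<in> carrier R"
    and "P \<zero>\<^bsub>R\<^esub>"
    and bis: "\<And>U f. bis_section U f \<Longrightarrow> P f"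
    and "\<And>f g. \<lbrakk>f \<in> carrier R; g \<in> carrier R; P f; P g\<rbrakk>
      \<Longrightarrow> P (f \<oplus>\<^bsub>R\<^esub> g)"
  shows "P f"
  using f unfolding Gamma_carrier
proof (induction rule: generate.induct)
  case one
  then show ?case using assms(2) by (simp add: section_group_simps)
next
  case (incl h)
  then show ?case using bis by (auto simp: bisection_sections_iff)
next
  case (inv h)
  then obtain U where U: "bis_section U h" by (auto simp: bisection_sections_iff)
  interpret comm_group "section_group G S" by (rule comm_group_section_group)
  have "h \<in> secs" using U by (simp add: bis_section_def)
  then have "inv\<^bsub>section_group G S\<^esub> h = neg h"
    using neg_add neg_in_secs by (intro inv_equality) (simp_all add: section_group_simps)
  then show ?case using bis bis_section_neg[OF U] by simp
next
  case (eng f g)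
  then show ?case using assms(4) by (simp add: section_group_simps Gamma_carrier)
qed

section \<open>Sections with finitely many nonzero values in each range fibre\<close>

definition supp_at :: "('g \<Rightarrow> 'e) \<Rightarrow> 'g \<Rightarrow> 'g set" where
  "supp_at f x = {\<beta> \<in> arrows G. gran G \<beta> = x \<and> f \<beta> \<noteq> \<zero>\<^bsub>stalk S x\<^esub>}"

text \<open>This alone makes every convolution sum finite. The ring laws are proved for such
  sections without any continuity; that \<open>carrier R\<close> is closed under convolution is a
  separate matter.\<close>

definition finsec :: "('g \<Rightarrow> 'e) \<Rightarrow> bool" where
  "finsec f \<longleftrightarrow> f \<in> secs \<and> (\<forall>x \<in> units G. finite (supp_at f x))"

lemma finsec_secs: "finsec f \<Longrightarrow> f \<in> secs"
  by (simp add: finsec_def)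

lemma finsec_add:
  assumes "finsec f" "finsec g"
  shows "finsec (f \<oplus>\<^bsub>R\<^esub> g)"
  unfolding finsec_def
proof (intro conjI ballI)
  show "f \<oplus>\<^bsub>R\<^esub> g \<in> secs" using assms by (simp add: finsec_def add_in_secs)
  fix x assume x: "x \<in> units G"
  interpret ring "stalk S x" using x by (rule ring_stalk)
  have "supp_at (f \<oplus>\<^bsub>R\<^esub> g) x \<subseteq> supp_at f x \<union> supp_at g x"
  proof
    fix \<beta> assume "\<beta> \<in> supp_at (f \<oplus>\<^bsub>R\<^esub> g) x"
    then have b: "\<beta> \<in> arrows G" "gran G \<beta> = x" "f \<beta> \<oplus>\<^bsub>stalk S x\<^esub> g \<beta> \<noteq> \<zero>\<^bsub>stalk S x\<^esub>"
      using add_apply[of \<beta> f g] by (auto simp: supp_at_def)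
    have "f \<beta> \<oplus>\<^bsub>stalk S x\<^esub> g \<beta> = \<zero>\<^bsub>stalk S x\<^esub>"
      if "f \<beta> = \<zero>\<^bsub>stalk S x\<^esub>" "g \<beta> = \<zero>\<^bsub>stalk S x\<^esub>"
      using that by simp
    with b(3) have "f \<beta> \<noteq> \<zero>\<^bsub>stalk S x\<^esub> \<or> g \<beta> \<noteq> \<zero>\<^bsub>stalk S x\<^esub>"
      by blast
    then show "\<beta> \<in> supp_at f x \<union> supp_at g x"
      using b by (auto simp: supp_at_def)
  qed
  then show "finite (supp_at (f \<oplus>\<^bsub>R\<^esub> g) x)"
    by (rule finite_subset) (use assms x in \<open>simp add: finsec_def\<close>)
qed

lemma bis_section_supp:
  assumes "bis_section U f" "\<beta> \<in> supp_at f x"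
  shows "\<beta> \<in> U"
  using assms by (auto simp: bis_section_def supp_at_def)

lemma bis_section_finsec:
  assumes f: "bis_section U f"
  shows "finsec f"
  unfolding finsec_def
proof (intro conjI ballI)
  show "f \<in> secs" using f by (simp add: bis_section_def)
  fix x
  have "inj_on (gran G) (supp_at f x)"
    using f bis_section_supp[OF f]
    by (auto simp: bis_section_def cob_def bisection_def intro: inj_on_subset[of _ U])
  moreover have "gran G ` supp_at f x \<subseteq> {x}" by (auto simp: supp_at_def)
  ultimately show "finite (supp_at f x)"
    using inj_on_finite by blast
qed

lemma Gamma_finsec: "f \<in> carrier R \<Longrightarrow> finsec f"
proof (induction rule: Gamma_induct)
  case zero
  have "supp_at \<zero>\<^bsub>R\<^esub> x = {}" for x
    by (auto simp: supp_at_def zero_apply)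
  then show ?case by (simp add: finsec_def zero_in_secs)
qed (auto intro: bis_section_finsec finsec_add)

lemma Gamma_secs: "f \<in> carrier R \<Longrightarrow> f \<in> secs"
  by (simp add: Gamma_finsec finsec_secs)

lemma abelian_group_Gamma: "abelian_group R"
proof (rule abelian_groupI)
  interpret comm_group "section_group G S" by (rule comm_group_section_group)
  note C = Gamma_carrier section_group_simps[symmetric]
  show "f \<oplus>\<^bsub>R\<^esub> g \<in> carrier R"
    if "f \<in> carrier R" "g \<in> carrier R" for f g
    using that unfolding C by (rule generate.eng)
  show "\<zero>\<^bsub>R\<^esub> \<in> carrier R"
    unfolding C by (rule generate.one)
  fix f assume f: "f \<in> carrier R"
  show "\<zero>\<^bsub>R\<^esub> \<oplus>\<^bsub>R\<^esub> f = f"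
    using l_one Gamma_secs[OF f] by (simp add: section_group_simps)
  show "f \<oplus>\<^bsub>R\<^esub> g = g \<oplus>\<^bsub>R\<^esub> f" if "g \<in> carrier R" for g
    using m_comm Gamma_secs[OF f] Gamma_secs[OF that] by (simp add: section_group_simps)
  show "(f \<oplus>\<^bsub>R\<^esub> g) \<oplus>\<^bsub>R\<^esub> h = f \<oplus>\<^bsub>R\<^esub> (g \<oplus>\<^bsub>R\<^esub> h)"
    if "g \<in> carrier R" "h \<in> carrier R" for g h
    using m_assoc Gamma_secs[OF f] Gamma_secs[OF that(1)] Gamma_secs[OF that(2)]
    by (simp add: section_group_simps)
  have "neg f \<in> carrier R"
  proof -
    have "bisection_sections G S \<subseteq> secs"
      by (auto simp: bisection_sections_def)
    then have "inv\<^bsub>section_group G S\<^esub> f \<in> carrier R"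
      using f generate_m_inv_closed unfolding Gamma_carrier by blast
    moreover have "inv\<^bsub>section_group G S\<^esub> f = neg f"
      using neg_add neg_in_secs Gamma_secs[OF f] by (intro inv_equality) (simp_all add: section_group_simps)
    ultimately show ?thesis by simp
  qed
  then show "\<exists>g\<in>carrier R. g \<oplus>\<^bsub>R\<^esub> f = \<zero>\<^bsub>R\<^esub>"
    using neg_add[OF Gamma_secs[OF f]] by blast
qed

section \<open>The convolution product\<close>

text \<open>In a factorisation of \<gamma> the right factor is determined by the left one. So the
  sum over pairs becomes a sum over the left factor \<beta> alone, taken from the arrows with the
  range of \<gamma>.\<close>

definition cterm :: "('g \<Rightarrow> 'e) \<Rightarrow> ('g \<Rightarrow> 'e) \<Rightarrow> 'g \<Rightarrow> 'g \<Rightarrow> 'e" where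
  "cterm f g \<gamma> \<beta> = f \<beta> \<otimes>\<^bsub>stalk S (gran G \<gamma>)\<^esub> act S \<beta> (g (gcomp G (ginv G \<beta>) \<gamma>))"

lemma mult_eq: "f \<star> g = convolution G S f g"
  by (simp add: Gamma_c_def)

lemma act_in: "\<lbrakk>\<beta> \<in> arrows G; e \<in> carrier (stalk S (gdom G \<beta>))\<rbrakk>
    \<Longrightarrow> act S \<beta> e \<in> carrier (stalk S (gran G \<beta>))"
  by (rule ring_hom_closed[OF act_ring_hom])

lemma ring_dom: "\<gamma> \<in> arrows G \<Longrightarrow> ring (stalk S (gdom G \<gamma>))"
  by (simp add: ring_stalk dom_in_units)

lemma act_zero: "\<beta> \<in> arrows G \<Longrightarrow>
    act S \<beta> \<zero>\<^bsub>stalk S (gdom G \<beta>)\<^esub> = \<zero>\<^bsub>stalk S (gran G \<beta>)\<^esub>"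
  by (rule ring_hom_zero[OF act_ring_hom ring_dom ring_at])

lemma act_one: "\<beta> \<in> arrows G \<Longrightarrow>
    act S \<beta> \<one>\<^bsub>stalk S (gdom G \<beta>)\<^esub> = \<one>\<^bsub>stalk S (gran G \<beta>)\<^esub>"
  by (rule ring_hom_one[OF act_ring_hom])

lemma shifted_in:
  assumes "g \<in> secs" "\<gamma> \<in> arrows G" "\<beta> \<in> arrows G" "gran G \<beta> = gran G \<gamma>"
  shows "g (gcomp G (ginv G \<beta>) \<gamma>) \<in> carrier (stalk S (gdom G \<beta>))"
    "act S \<beta> (g (gcomp G (ginv G \<beta>) \<gamma>)) \<in> carrier (stalk S (gran G \<gamma>))"
proof -
  show "g (gcomp G (ginv G \<beta>) \<gamma>) \<in> carrier (stalk S (gdom G \<beta>))"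
    using secs_apply[OF assms(1)] inv_comp[OF assms(3,2,4)] by metis
  then show "act S \<beta> (g (gcomp G (ginv G \<beta>) \<gamma>)) \<in> carrier (stalk S (gran G \<gamma>))"
    using act_in[OF assms(3)] assms(4) by metis
qed

lemma cterm_closed:
  assumes "f \<in> secs" "g \<in> secs" "\<gamma> \<in> arrows G" "\<beta> \<in> arrows G" "gran G \<beta> = gran G \<gamma>"
  shows "cterm f g \<gamma> \<beta> \<in> carrier (stalk S (gran G \<gamma>))"
proof -
  interpret ring "stalk S (gran G \<gamma>)" using assms(3) by (rule ring_at)
  show ?thesis
    unfolding cterm_def using shifted_in(2)[OF assms(2-5)] secs_apply[OF assms(1,4)] assms(5) by simp
qed

lemma cterm_zero:
  assumes "f \<in> secs" "g \<in> secs" "\<gamma> \<in> arrows G" "\<beta> \<in> arrows G" "gran G \<beta> = gran G \<gamma>"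
    and "f \<beta> = \<zero>\<^bsub>stalk S (gran G \<gamma>)\<^esub> \<or> g (gcomp G (ginv G \<beta>) \<gamma>) = \<zero>\<^bsub>stalk S (gdom G \<beta>)\<^esub>"
  shows "cterm f g \<gamma> \<beta> = \<zero>\<^bsub>stalk S (gran G \<gamma>)\<^esub>"
proof -
  interpret ring "stalk S (gran G \<gamma>)" using assms(3) by (rule ring_at)
  show ?thesis
    using assms(6)
  proof
    assume "f \<beta> = \<zero>\<^bsub>stalk S (gran G \<gamma>)\<^esub>"
    then show ?thesis
      unfolding cterm_def using shifted_in(2)[OF assms(2-5)] by simp
  next
    assume "g (gcomp G (ginv G \<beta>) \<gamma>) = \<zero>\<^bsub>stalk S (gdom G \<beta>)\<^esub>"
    then have "act S \<beta> (g (gcomp G (ginv G \<beta>) \<gamma>)) = \<zero>\<^bsub>stalk S (gran G \<gamma>)\<^esub>"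
      using act_zero[OF assms(4)] assms(5) by simp
    then show ?thesis
      unfolding cterm_def using secs_apply[OF assms(1,4)] assms(5) by simp
  qed
qed

text \<open>Passing from a pair to its left factor is injective on the index set, and every \<beta>
  outside the support of \<open>f\<close> contributes zero. Leaving \<open>B\<close> free lets
  several products be compared over one index set.\<close>

lemma mult_apply:
  assumes f: "f \<in> secs" and g: "g \<in> secs" and \<gamma>: "\<gamma> \<in> arrows G"
    and B: "finite B" "B \<subseteq> {\<beta> \<in> arrows G. gran G \<beta> = gran G \<gamma>}" "supp_at f (gran G \<gamma>) \<subseteq> B"
  shows "(f \<star> g) \<gamma> = finsum (stalk S (gran G \<gamma>)) (cterm f g \<gamma>) B"
proof -
  let ?T = "stalk S (gran G \<gamma>)"
  interpret ring ?T using \<gamma> by (rule ring_at)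
  define P where "P = {(\<beta>, \<rho>). \<beta> \<in> arrows G \<and> \<rho> \<in> arrows G \<and> gdom G \<beta> = gran G \<rho> \<and>
    gcomp G \<beta> \<rho> = \<gamma> \<and> fmult S (f \<beta>) (act S \<beta> (g \<rho>)) \<noteq> fzero S (gran G \<gamma>)}"
  have P: "\<beta> \<in> arrows G \<and> gran G \<beta> = gran G \<gamma> \<and> \<rho> = gcomp G (ginv G \<beta>) \<gamma> \<and>
      fmult S (f \<beta>) (act S \<beta> (g \<rho>)) = cterm f g \<gamma> \<beta> \<and> cterm f g \<gamma> \<beta> \<noteq> \<zero>\<^bsub>?T\<^esub>"
    if "(\<beta>, \<rho>) \<in> P" for \<beta> \<rho>
  proof -
    have b: "\<beta> \<in> arrows G" "\<rho> \<in> arrows G" "gdom G \<beta> = gran G \<rho>" "\<gamma> = gcomp G \<beta> \<rho>"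
      and nz: "fmult S (f \<beta>) (act S \<beta> (g \<rho>)) \<noteq> fzero S (gran G \<gamma>)"
      using that by (auto simp: P_def)
    have \<rho>: "\<rho> = gcomp G (ginv G \<beta>) \<gamma>"
      using inv_comp_cancel[OF b(1-3)] b(4) by simp
    have eq: "fmult S (f \<beta>) (act S \<beta> (g \<rho>)) = cterm f g \<gamma> \<beta>"
      unfolding cterm_def \<rho>[symmetric] by (simp add: stalk_simps[of "gran G \<gamma>"])
    then have "cterm f g \<gamma> \<beta> \<noteq> \<zero>\<^bsub>?T\<^esub>"
      using nz by (simp add: stalk_simps(3)[of "gran G \<gamma>"])
    moreover have "gran G \<beta> = gran G \<gamma>"
      using ran_comp[OF b(1-3)] unfolding b(4)[symmetric] ..
    ultimately show ?thesis
      using b(1) \<rho> eq by (intro conjI)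
  qed
  have inj: "inj_on fst P"
  proof (rule inj_onI)
    fix p q assume *: "p \<in> P" "q \<in> P" "fst p = fst q"
    have "snd p = gcomp G (ginv G (fst p)) \<gamma>" "snd q = gcomp G (ginv G (fst q)) \<gamma>"
      using P[of "fst p" "snd p"] P[of "fst q" "snd q"] *(1,2) by simp_all
    then show "p = q"
      using *(3) by (simp add: prod_eq_iff)
  qed
  have fstP: "fst ` P = {\<beta> \<in> arrows G. gran G \<beta> = gran G \<gamma> \<and> cterm f g \<gamma> \<beta> \<noteq> \<zero>\<^bsub>?T\<^esub>}"
  proof (intro equalityI subsetI)
    fix \<beta> assume "\<beta> \<in> fst ` P"
    then obtain \<rho> where "(\<beta>, \<rho>) \<in> P" by force
    then show "\<beta> \<in> {\<beta> \<in> arrows G. gran G \<beta> = gran G \<gamma> \<and> cterm f g \<gamma> \<beta> \<noteq> \<zero>\<^bsub>?T\<^esub>}"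
      using P[of \<beta> \<rho>] by simp
  next
    fix \<beta> assume "\<beta> \<in> {\<beta> \<in> arrows G. gran G \<beta> = gran G \<gamma> \<and> cterm f g \<gamma> \<beta> \<noteq> \<zero>\<^bsub>?T\<^esub>}"
    then have b: "\<beta> \<in> arrows G" "gran G \<beta> = gran G \<gamma>" "cterm f g \<gamma> \<beta> \<noteq> \<zero>\<^bsub>?T\<^esub>" by auto
    then have "(\<beta>, gcomp G (ginv G \<beta>) \<gamma>) \<in> P"
      unfolding P_def using inv_comp[OF b(1) \<gamma> b(2)] comp_inv_cancel[OF b(1) \<gamma> b(2)]
      by (simp add: cterm_def stalk_simps[of "gran G \<gamma>"])
    then show "\<beta> \<in> fst ` P" by force
  qed
  have closed: "cterm f g \<gamma> \<in> B \<rightarrow> carrier ?T"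
    using cterm_closed[OF f g \<gamma>] B(2) by auto
  have sub: "fst ` P \<subseteq> B"
  proof
    fix \<beta> assume "\<beta> \<in> fst ` P"
    then have b: "\<beta> \<in> arrows G" "gran G \<beta> = gran G \<gamma>" "cterm f g \<gamma> \<beta> \<noteq> \<zero>\<^bsub>?T\<^esub>"
      unfolding fstP by auto
    then have "\<beta> \<in> supp_at f (gran G \<gamma>)"
      using cterm_zero[OF f g \<gamma> b(1,2)] by (auto simp: supp_at_def)
    then show "\<beta> \<in> B" using B(3) by blast
  qed
  have closedP: "cterm f g \<gamma> \<in> fst ` P \<rightarrow> carrier ?T"
    using closed sub by blast
  have "(f \<star> g) \<gamma> =
      finsum ?T (\<lambda>(\<beta>, \<rho>). fmult S (f \<beta>) (act S \<beta> (g \<rho>))) P"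
    using \<gamma> by (simp add: mult_eq convolution_def P_def)
  also have "\<dots> = finsum ?T (\<lambda>p. cterm f g \<gamma> (fst p)) P"
  proof (rule add.finprod_cong'[OF refl])
    show "(case p of (\<beta>, \<rho>) \<Rightarrow> fmult S (f \<beta>) (act S \<beta> (g \<rho>))) = cterm f g \<gamma> (fst p)" if "p \<in> P" for p
    proof -
      have "(fst p, snd p) \<in> P" using that by simp
      from P[OF this] show ?thesis unfolding case_prod_unfold by blast
    qed
  qed (use closedP in auto)
  also have "\<dots> = finsum ?T (cterm f g \<gamma>) (fst ` P)"
    using closedP inj by (rule add.finprod_reindex[symmetric])
  also have "\<dots> = finsum ?T (cterm f g \<gamma>) B"
  proof (rule add.finprod_mono_neutral_cong_left[OF B(1) sub])
    show "cterm f g \<gamma> \<beta> = \<zero>\<^bsub>?T\<^esub>" if "\<beta> \<in> B - fst ` P" for \<beta>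
      using that B(2) unfolding fstP by auto
  qed (use closed in auto)
  finally show ?thesis .
qed

lemma mult_apply_supp:
  assumes f: "finsec f" and g: "g \<in> secs" and \<gamma>: "\<gamma> \<in> arrows G"
  shows "(f \<star> g) \<gamma> =
    finsum (stalk S (gran G \<gamma>)) (cterm f g \<gamma>) (supp_at f (gran G \<gamma>))"
  using f ran_in_units[OF \<gamma>]
  by (intro mult_apply[OF finsec_secs[OF f] g \<gamma>]) (auto simp: finsec_def supp_at_def)

lemma mult_in_secs:
  assumes "finsec f" "g \<in> secs"
  shows "f \<star> g \<in> secs"
  unfolding secs_iff
proof (intro conjI ballI)
  show "f \<star> g \<in> extensional (arrows G)"
    by (simp add: mult_eq convolution_def)
  fix \<gamma> assume \<gamma>: "\<gamma> \<in> arrows G"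
  interpret ring "stalk S (gran G \<gamma>)" using \<gamma> by (rule ring_at)
  show "(f \<star> g) \<gamma> \<in> carrier (stalk S (gran G \<gamma>))"
    unfolding mult_apply_supp[OF assms \<gamma>]
    using cterm_closed[OF finsec_secs[OF assms(1)] assms(2) \<gamma>]
    by (intro finsum_closed) (auto simp: supp_at_def)
qed

text \<open>Products with characteristic functions, diagonal elements and bisection sections are all
  computed through this: each leaves at most one factorisation with a nonzero term.\<close>

lemma mult_apply_single:
  assumes f: "finsec f" and g: "g \<in> secs" and \<gamma>: "\<gamma> \<in> arrows G"
    and \<beta>: "\<beta> \<in> arrows G" "gran G \<beta> = gran G \<gamma>"
    and z: "\<And>\<delta>. \<lbrakk>\<delta> \<in> arrows G; gran G \<delta> = gran G \<gamma>; \<delta> \<noteq> \<beta>\<rbrakk> \<Longrightarrow>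
      f \<delta> = \<zero>\<^bsub>stalk S (gran G \<gamma>)\<^esub> \<or> g (gcomp G (ginv G \<delta>) \<gamma>) = \<zero>\<^bsub>stalk S (gdom G \<delta>)\<^esub>"
  shows "(f \<star> g) \<gamma> = cterm f g \<gamma> \<beta>"
proof -
  let ?T = "stalk S (gran G \<gamma>)"
  interpret ring ?T using \<gamma> by (rule ring_at)
  let ?B = "insert \<beta> (supp_at f (gran G \<gamma>))"
  have fin: "finite ?B"
    using f ran_in_units[OF \<gamma>] by (simp add: finsec_def)
  have B: "?B \<subseteq> {\<beta> \<in> arrows G. gran G \<beta> = gran G \<gamma>}"
    using \<beta> by (auto simp: supp_at_def)
  have closed: "cterm f g \<gamma> \<delta> \<in> carrier ?T" if "\<delta> \<in> ?B" for \<delta>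
    using cterm_closed[OF finsec_secs[OF f] g \<gamma>] that B by blast
  have "(f \<star> g) \<gamma> = finsum ?T (cterm f g \<gamma>) ?B"
    using mult_apply[OF finsec_secs[OF f] g \<gamma> fin B] by blast
  also have "\<dots> = finsum ?T (cterm f g \<gamma>) {\<beta>}"
  proof (rule add.finprod_mono_neutral_cong_right[OF fin])
    fix \<delta> assume "\<delta> \<in> ?B - {\<beta>}"
    then have "\<delta> \<in> arrows G" "gran G \<delta> = gran G \<gamma>" "\<delta> \<noteq> \<beta>" using B by auto
    then show "cterm f g \<gamma> \<delta> = \<zero>\<^bsub>?T\<^esub>"
      using z by (intro cterm_zero[OF finsec_secs[OF f] g \<gamma>]) auto
  qed (use closed in auto)
  also have "\<dots> = cterm f g \<gamma> \<beta>"
    using closed[of \<beta>] by simp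
  finally show ?thesis .
qed

text \<open>The single-term formula with \<gamma> itself as the designated left factor, whose term
  vanishes as well.\<close>

lemma mult_apply_zero:
  assumes f: "finsec f" and g: "g \<in> secs" and \<gamma>: "\<gamma> \<in> arrows G"
    and z: "\<And>\<delta>. \<lbrakk>\<delta> \<in> arrows G; gran G \<delta> = gran G \<gamma>\<rbrakk> \<Longrightarrow>
      f \<delta> = \<zero>\<^bsub>stalk S (gran G \<gamma>)\<^esub> \<or> g (gcomp G (ginv G \<delta>) \<gamma>) = \<zero>\<^bsub>stalk S (gdom G \<delta>)\<^esub>"
  shows "(f \<star> g) \<gamma> = \<zero>\<^bsub>stalk S (gran G \<gamma>)\<^esub>"
  using mult_apply_single[OF f g \<gamma> \<gamma> refl] z cterm_zero[OF finsec_secs[OF f] g \<gamma> \<gamma> refl]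
  by (metis \<gamma>)

lemma l_distr_secs:
  assumes f: "finsec f" and f': "finsec f'" and g: "g \<in> secs"
  shows "(f \<oplus>\<^bsub>R\<^esub> f') \<star> g =
    f \<star> g \<oplus>\<^bsub>R\<^esub> f' \<star> g"
proof (rule secs_ext)
  show "(f \<oplus>\<^bsub>R\<^esub> f') \<star> g \<in> secs"
    using finsec_add[OF f f'] g by (rule mult_in_secs)
  show "f \<star> g \<oplus>\<^bsub>R\<^esub> f' \<star> g \<in> secs"
    using f f' g by (intro add_in_secs mult_in_secs)
  fix \<gamma> assume \<gamma>: "\<gamma> \<in> arrows G"
  let ?T = "stalk S (gran G \<gamma>)"
  interpret ring ?T using \<gamma> by (rule ring_at)
  have x: "gran G \<gamma> \<in> units G" using \<gamma> by (rule ran_in_units)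
  \<comment> \<open>One index set has to serve all three products; surplus elements contribute
    zero.\<close>
  let ?B = "supp_at f (gran G \<gamma>) \<union> supp_at f' (gran G \<gamma>) \<union> supp_at (f \<oplus>\<^bsub>R\<^esub> f') (gran G \<gamma>)"
  have fin: "finite ?B"
    using f f' finsec_add[OF f f'] x by (simp add: finsec_def)
  have B: "?B \<subseteq> {\<beta> \<in> arrows G. gran G \<beta> = gran G \<gamma>}"
    by (auto simp: supp_at_def)
  have fs: "f \<in> secs" "f' \<in> secs" "f \<oplus>\<^bsub>R\<^esub> f' \<in> secs"
    using f f' finsec_add[OF f f'] by (auto simp: finsec_def)
  have c: "cterm f g \<gamma> \<beta> \<in> carrier ?T" "cterm f' g \<gamma> \<beta> \<in> carrier ?T" if "\<beta> \<in> ?B" for \<beta>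
    using that B cterm_closed[OF _ g \<gamma>] fs by blast+
  have "((f \<oplus>\<^bsub>R\<^esub> f') \<star> g) \<gamma> =
      finsum ?T (cterm (f \<oplus>\<^bsub>R\<^esub> f') g \<gamma>) ?B"
    using mult_apply[OF fs(3) g \<gamma> fin B] by blast
  also have "\<dots> = finsum ?T (\<lambda>\<beta>. cterm f g \<gamma> \<beta> \<oplus>\<^bsub>?T\<^esub> cterm f' g \<gamma> \<beta>) ?B"
  proof (rule add.finprod_cong'[OF refl])
    fix \<beta> assume \<beta>: "\<beta> \<in> ?B"
    then have b: "\<beta> \<in> arrows G" "gran G \<beta> = gran G \<gamma>" using B by auto
    show "cterm (f \<oplus>\<^bsub>R\<^esub> f') g \<gamma> \<beta> = cterm f g \<gamma> \<beta> \<oplus>\<^bsub>?T\<^esub> cterm f' g \<gamma> \<beta>"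
      using secs_apply[OF fs(1) b(1)] secs_apply[OF fs(2) b(1)] shifted_in(2)[OF g \<gamma> b] b
      by (simp add: cterm_def add_apply l_distr)
  qed (use c in auto)
  also have "\<dots> = finsum ?T (cterm f g \<gamma>) ?B \<oplus>\<^bsub>?T\<^esub> finsum ?T (cterm f' g \<gamma>) ?B"
    using c by (intro finsum_addf) auto
  also have "finsum ?T (cterm f g \<gamma>) ?B = (f \<star> g) \<gamma>"
    using mult_apply[OF fs(1) g \<gamma> fin B] by (simp add: sup.assoc)
  also have "finsum ?T (cterm f' g \<gamma>) ?B = (f' \<star> g) \<gamma>"
    using mult_apply[OF fs(2) g \<gamma> fin B] by (simp add: le_supI1)
  finally show "((f \<oplus>\<^bsub>R\<^esub> f') \<star> g) \<gamma> =
      (f \<star> g \<oplus>\<^bsub>R\<^esub> f' \<star> g) \<gamma>"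
    using \<gamma> by (simp add: add_apply)
qed

lemma r_distr_secs:
  assumes f: "finsec f" and g: "g \<in> secs" and g': "g' \<in> secs"
  shows "f \<star> (g \<oplus>\<^bsub>R\<^esub> g') =
    f \<star> g \<oplus>\<^bsub>R\<^esub> f \<star> g'"
proof (rule secs_ext)
  note gg = add_in_secs[OF g g']
  show "f \<star> (g \<oplus>\<^bsub>R\<^esub> g') \<in> secs"
    using f gg by (rule mult_in_secs)
  show "f \<star> g \<oplus>\<^bsub>R\<^esub> f \<star> g' \<in> secs"
    using f g g' by (intro add_in_secs mult_in_secs)
  fix \<gamma> assume \<gamma>: "\<gamma> \<in> arrows G"
  let ?T = "stalk S (gran G \<gamma>)"
  interpret ring ?T using \<gamma> by (rule ring_at)
  let ?B = "supp_at f (gran G \<gamma>)"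
  have b: "\<beta> \<in> arrows G" "gran G \<beta> = gran G \<gamma>" if "\<beta> \<in> ?B" for \<beta>
    using that by (auto simp: supp_at_def)
  have c: "cterm f g \<gamma> \<beta> \<in> carrier ?T" "cterm f g' \<gamma> \<beta> \<in> carrier ?T" if "\<beta> \<in> ?B" for \<beta>
    using cterm_closed[OF finsec_secs[OF f] _ \<gamma> b[OF that]] g g' by auto
  have "finsum ?T (cterm f (g \<oplus>\<^bsub>R\<^esub> g') \<gamma>) ?B =
      finsum ?T (\<lambda>\<beta>. cterm f g \<gamma> \<beta> \<oplus>\<^bsub>?T\<^esub> cterm f g' \<gamma> \<beta>) ?B"
  proof (rule add.finprod_cong'[OF refl])
    fix \<beta> assume \<beta>: "\<beta> \<in> ?B"
    let ?\<rho> = "gcomp G (ginv G \<beta>) \<gamma>"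
    have \<rho>: "?\<rho> \<in> arrows G" "gran G ?\<rho> = gdom G \<beta>"
      using inv_comp[OF b(1)[OF \<beta>] \<gamma> b(2)[OF \<beta>]] by auto
    have "act S \<beta> ((g \<oplus>\<^bsub>R\<^esub> g') ?\<rho>) = act S \<beta> (g ?\<rho>) \<oplus>\<^bsub>?T\<^esub> act S \<beta> (g' ?\<rho>)"
      using ring_hom_add[OF act_ring_hom[OF b(1)[OF \<beta>]] shifted_in(1)[OF g \<gamma> b[OF \<beta>]]
        shifted_in(1)[OF g' \<gamma> b[OF \<beta>]]] \<rho> b(2)[OF \<beta>] by (simp add: add_apply)
    then show "cterm f (g \<oplus>\<^bsub>R\<^esub> g') \<gamma> \<beta> = cterm f g \<gamma> \<beta> \<oplus>\<^bsub>?T\<^esub> cterm f g' \<gamma> \<beta>"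
      using secs_apply[OF finsec_secs[OF f] b(1)[OF \<beta>]] b(2)[OF \<beta>]
        shifted_in(2)[OF g \<gamma> b[OF \<beta>]] shifted_in(2)[OF g' \<gamma> b[OF \<beta>]]
      by (simp add: cterm_def r_distr)
  qed (use c in auto)
  also have "\<dots> = finsum ?T (cterm f g \<gamma>) ?B \<oplus>\<^bsub>?T\<^esub> finsum ?T (cterm f g' \<gamma>) ?B"
    using c by (intro finsum_addf) auto
  finally show "(f \<star> (g \<oplus>\<^bsub>R\<^esub> g')) \<gamma> =
      (f \<star> g \<oplus>\<^bsub>R\<^esub> f \<star> g') \<gamma>"
    using \<gamma> mult_apply_supp[OF f gg \<gamma>] mult_apply_supp[OF f g \<gamma>] mult_apply_supp[OF f g' \<gamma>]
    by (simp add: add_apply)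
qed

text \<open>The actual support of \<open>f \<star> g\<close> can be smaller because of cancellation.
  Associativity needs all these products, since the translate of the index set by the inverse of
  \<beta> must still cover the support of \<open>g\<close>.\<close>

definition supp_comp :: "('g \<Rightarrow> 'e) \<Rightarrow> ('g \<Rightarrow> 'e) \<Rightarrow> 'g \<Rightarrow> 'g set" where
  "supp_comp f g x = (\<Union>\<beta>\<in>supp_at f x. gcomp G \<beta> ` supp_at g (gdom G \<beta>))"

lemma supp_comp:
  assumes f: "finsec f" and g: "finsec g" and x: "x \<in> units G"
  shows "finite (supp_comp f g x)" "supp_comp f g x \<subseteq> {\<delta> \<in> arrows G. gran G \<delta> = x}"
    "supp_at (f \<star> g) x \<subseteq> supp_comp f g x"
proof -
  show "finite (supp_comp f g x)"
    unfolding supp_comp_def using f g x dom_in_units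
    by (intro finite_UN_I finite_imageI) (auto simp: finsec_def supp_at_def)
  show "supp_comp f g x \<subseteq> {\<delta> \<in> arrows G. gran G \<delta> = x}"
    by (auto simp: supp_comp_def supp_at_def comp_closed ran_comp)
  show "supp_at (f \<star> g) x \<subseteq> supp_comp f g x"
  proof
    fix \<gamma> assume "\<gamma> \<in> supp_at (f \<star> g) x"
    then have \<gamma>: "\<gamma> \<in> arrows G" "gran G \<gamma> = x"
      and nz: "(f \<star> g) \<gamma> \<noteq> \<zero>\<^bsub>stalk S (gran G \<gamma>)\<^esub>"
      by (auto simp: supp_at_def)
    then obtain \<beta> where \<beta>: "\<beta> \<in> arrows G" "gran G \<beta> = gran G \<gamma>"
      "f \<beta> \<noteq> \<zero>\<^bsub>stalk S (gran G \<gamma>)\<^esub>" "g (gcomp G (ginv G \<beta>) \<gamma>) \<noteq> \<zero>\<^bsub>stalk S (gdom G \<beta>)\<^esub>"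
      using mult_apply_zero[OF f finsec_secs[OF g] \<gamma>(1)] by blast
    then have "\<beta> \<in> supp_at f x" "gcomp G (ginv G \<beta>) \<gamma> \<in> supp_at g (gdom G \<beta>)"
      using \<gamma> inv_comp[OF \<beta>(1) \<gamma>(1) \<beta>(2)] by (auto simp: supp_at_def)
    moreover have "\<gamma> = gcomp G \<beta> (gcomp G (ginv G \<beta>) \<gamma>)"
      using comp_inv_cancel[OF \<beta>(1) \<gamma>(1) \<beta>(2)] by simp
    ultimately show "\<gamma> \<in> supp_comp f g x"
      unfolding supp_comp_def by blast
  qed
qed

lemma finsec_mult:
  assumes f: "finsec f" and g: "finsec g"
  shows "finsec (f \<star> g)"
  unfolding finsec_def
proof (intro conjI ballI)
  show "f \<star> g \<in> secs"
    using f finsec_secs[OF g] by (rule mult_in_secs)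
  show "finite (supp_at (f \<star> g) x)" if "x \<in> units G" for x
    using supp_comp(3,1)[OF f g that] by (rule finite_subset)
qed

text \<open>Both sides expand to one double sum, with \<beta> in \<open>F\<close> and \<delta> in
  \<open>B\<close>: in a factorisation of \<gamma> into three arrows, \<beta> is the first factor
  and \<delta> the product of the first two. The two bracketings sum in opposite orders.\<close>

lemma m_assoc_secs:
  assumes f: "finsec f" and g: "finsec g" and h: "h \<in> secs"
  shows "(f \<star> g) \<star> h = f \<star> (g \<star> h)"
proof (rule secs_ext)
  note fs = finsec_secs[OF f] and gs = finsec_secs[OF g]
  note gh = mult_in_secs[OF g h] and fg = finsec_mult[OF f g]
  show "(f \<star> g) \<star> h \<in> secs"
    using fg h by (rule mult_in_secs)
  show "f \<star> (g \<star> h) \<in> secs"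
    using f gh by (rule mult_in_secs)
  fix \<gamma> assume \<gamma>: "\<gamma> \<in> arrows G"
  define T where "T = stalk S (gran G \<gamma>)"
  interpret T: ring T unfolding T_def using \<gamma> by (rule ring_at)
  have x: "gran G \<gamma> \<in> units G" using \<gamma> by (rule ran_in_units)
  define F where "F = supp_at f (gran G \<gamma>)"
  define B where "B = supp_comp f g (gran G \<gamma>)"
  have F: "finite F" "\<And>\<beta>. \<beta> \<in> F \<Longrightarrow> \<beta> \<in> arrows G \<and> gran G \<beta> = gran G \<gamma>"
    using f x by (auto simp: F_def finsec_def supp_at_def)
  have B: "finite B" "\<And>\<delta>. \<delta> \<in> B \<Longrightarrow> \<delta> \<in> arrows G \<and> gran G \<delta> = gran G \<gamma>"
    "supp_at (f \<star> g) (gran G \<gamma>) \<subseteq> B"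
    using supp_comp[OF f g x] by (auto simp: B_def)
  define a where "a \<beta> \<delta> = act S \<beta> (g (gcomp G (ginv G \<beta>) \<delta>))" for \<beta> \<delta>
  define b where "b \<delta> = act S \<delta> (h (gcomp G (ginv G \<delta>) \<gamma>))" for \<delta>
  have fT: "f \<beta> \<in> carrier T" if "\<beta> \<in> F" for \<beta>
    using secs_apply[OF fs, of \<beta>] F(2)[OF that] by (auto simp: T_def)
  have aT: "a \<beta> \<delta> \<in> carrier T" if "\<beta> \<in> F" "\<delta> \<in> B" for \<beta> \<delta>
    using shifted_in(2)[OF gs, of \<delta> \<beta>] F(2)[OF that(1)] B(2)[OF that(2)] by (simp add: a_def T_def)
  have bT: "b \<delta> \<in> carrier T" if "\<delta> \<in> B" for \<delta>
    using shifted_in(2)[OF h \<gamma>, of \<delta>] B(2)[OF that] by (simp add: b_def T_def)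
  have 1: "(f \<star> g) \<delta> = (\<Oplus>\<^bsub>T\<^esub>\<beta>\<in>F. f \<beta> \<otimes>\<^bsub>T\<^esub> a \<beta> \<delta>)" if "\<delta> \<in> B" for \<delta>
  proof -
    have d: "\<delta> \<in> arrows G" "gran G \<delta> = gran G \<gamma>" using B(2)[OF that] by auto
    have "(f \<star> g) \<delta> = finsum (stalk S (gran G \<delta>)) (cterm f g \<delta>) (supp_at f (gran G \<delta>))"
      using f gs d(1) by (rule mult_apply_supp)
    then show ?thesis
      by (simp add: d(2) F_def[symmetric] T_def[symmetric] cterm_def[abs_def] a_def)
  qed
  have "((f \<star> g) \<star> h) \<gamma> =
      finsum T (cterm (f \<star> g) h \<gamma>) B"
    unfolding T_def using B by (intro mult_apply[OF finsec_secs[OF fg] h \<gamma>]) auto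
  also have "\<dots> = (\<Oplus>\<^bsub>T\<^esub>\<delta>\<in>B. \<Oplus>\<^bsub>T\<^esub>\<beta>\<in>F. f \<beta> \<otimes>\<^bsub>T\<^esub> (a \<beta> \<delta> \<otimes>\<^bsub>T\<^esub> b \<delta>))"
  proof (rule T.add.finprod_cong'[OF refl])
    fix \<delta> assume d: "\<delta> \<in> B"
    have "cterm (f \<star> g) h \<gamma> \<delta> = (\<Oplus>\<^bsub>T\<^esub>\<beta>\<in>F. f \<beta> \<otimes>\<^bsub>T\<^esub> a \<beta> \<delta>) \<otimes>\<^bsub>T\<^esub> b \<delta>"
      using 1[OF d] by (simp add: cterm_def b_def T_def)
    also have "\<dots> = (\<Oplus>\<^bsub>T\<^esub>\<beta>\<in>F. f \<beta> \<otimes>\<^bsub>T\<^esub> a \<beta> \<delta> \<otimes>\<^bsub>T\<^esub> b \<delta>)"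
      using F(1) bT[OF d] fT aT[OF _ d] by (intro T.finsum_ldistr) auto
    also have "\<dots> = (\<Oplus>\<^bsub>T\<^esub>\<beta>\<in>F. f \<beta> \<otimes>\<^bsub>T\<^esub> (a \<beta> \<delta> \<otimes>\<^bsub>T\<^esub> b \<delta>))"
      using bT[OF d] fT aT[OF _ d] by (intro T.add.finprod_cong'[OF refl]) (auto simp: T.m_assoc)
    finally show "cterm (f \<star> g) h \<gamma> \<delta> =
        (\<Oplus>\<^bsub>T\<^esub>\<beta>\<in>F. f \<beta> \<otimes>\<^bsub>T\<^esub> (a \<beta> \<delta> \<otimes>\<^bsub>T\<^esub> b \<delta>))" .
  qed (use fT aT bT in \<open>auto intro!: T.finsum_closed\<close>)
  also have "\<dots> = (\<Oplus>\<^bsub>T\<^esub>\<beta>\<in>F. \<Oplus>\<^bsub>T\<^esub>\<delta>\<in>B. f \<beta> \<otimes>\<^bsub>T\<^esub> (a \<beta> \<delta> \<otimes>\<^bsub>T\<^esub> b \<delta>))"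
    using B(1) F(1) fT aT bT by (intro T.finsum_swap) auto
  also have "\<dots> = finsum T (cterm f (g \<star> h) \<gamma>) F"
  proof (rule T.add.finprod_cong'[OF refl])
    show "cterm f (g \<star> h) \<gamma> \<in> F \<rightarrow> carrier T"
      unfolding T_def using F(2) cterm_closed[OF fs gh \<gamma>] by auto
    fix \<beta> assume bF: "\<beta> \<in> F"
    then have \<beta>: "\<beta> \<in> arrows G" "gran G \<beta> = gran G \<gamma>" using F(2) by auto
    let ?\<rho> = "gcomp G (ginv G \<beta>) \<gamma>"
    let ?l = "gcomp G (ginv G \<beta>)"
    have \<rho>: "?\<rho> \<in> arrows G" "gran G ?\<rho> = gdom G \<beta>"
      using inv_comp[OF \<beta>(1) \<gamma> \<beta>(2)] by auto
    define D where "D = stalk S (gdom G \<beta>)"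
    interpret D: ring D unfolding D_def using \<beta>(1) by (rule ring_dom)
    have l: "?l \<delta> \<in> arrows G" "gran G (?l \<delta>) = gdom G \<beta>" "gdom G (?l \<delta>) = gdom G \<delta>"
      "gcomp G \<beta> (?l \<delta>) = \<delta>" if "\<delta> \<in> B" for \<delta>
      using inv_comp[OF \<beta>(1), of \<delta>] comp_inv_cancel[OF \<beta>(1), of \<delta>] B(2)[OF that] \<beta>(2) by auto
    \<comment> \<open>Left translation by the inverse of \<beta> turns \<open>B\<close> into an
      index set for \<open>g \<star> h\<close> evaluated at \<open>?\<rho>\<close>.\<close>
    have inj: "inj_on ?l B"
      using l(4) by (metis inj_onI)
    have lB: "?l ` B \<subseteq> {\<delta> \<in> arrows G. gran G \<delta> = gran G ?\<rho>}"
      using l \<rho>(2) by auto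
    have sB: "supp_at g (gran G ?\<rho>) \<subseteq> ?l ` B"
    proof
      fix \<epsilon> assume e: "\<epsilon> \<in> supp_at g (gran G ?\<rho>)"
      then have "gcomp G \<beta> \<epsilon> \<in> B"
        using bF \<rho>(2) by (auto simp: B_def supp_comp_def F_def)
      moreover have "\<epsilon> = ?l (gcomp G \<beta> \<epsilon>)"
        using inv_comp_cancel[OF \<beta>(1), of \<epsilon>] e \<rho>(2) by (simp add: supp_at_def)
      ultimately show "\<epsilon> \<in> ?l ` B" by blast
    qed
    have cD: "cterm g h ?\<rho> \<epsilon> \<in> carrier D" if "\<epsilon> \<in> ?l ` B" for \<epsilon>
      using cterm_closed[OF gs h \<rho>(1)] that lB \<rho>(2) unfolding D_def by auto
    have "(g \<star> h) ?\<rho> = finsum D (cterm g h ?\<rho>) (?l ` B)"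
      using mult_apply[OF gs h \<rho>(1) _ lB sB] B(1) \<rho>(2) by (simp add: D_def)
    also have "\<dots> = (\<Oplus>\<^bsub>D\<^esub>\<delta>\<in>B. cterm g h ?\<rho> (?l \<delta>))"
      using cD inj by (intro D.add.finprod_reindex) auto
    finally have "act S \<beta> ((g \<star> h) ?\<rho>) = act S \<beta> (\<Oplus>\<^bsub>D\<^esub>\<delta>\<in>B. cterm g h ?\<rho> (?l \<delta>))"
      by simp
    also have "\<dots> = (\<Oplus>\<^bsub>T\<^esub>\<delta>\<in>B. act S \<beta> (cterm g h ?\<rho> (?l \<delta>)))"
      using act_ring_hom[OF \<beta>(1)] \<beta>(2) cD B(1)
      by (intro ring_hom_finsum[OF D.ring_axioms T.ring_axioms]) (auto simp: D_def T_def)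
    also have "\<dots> = (\<Oplus>\<^bsub>T\<^esub>\<delta>\<in>B. a \<beta> \<delta> \<otimes>\<^bsub>T\<^esub> b \<delta>)"
    proof (rule T.add.finprod_cong'[OF refl])
      fix \<delta> assume d: "\<delta> \<in> B"
      then have \<delta>: "\<delta> \<in> arrows G" "gran G \<delta> = gran G \<gamma>" using B(2) by auto
      have s: "gcomp G (ginv G (?l \<delta>)) ?\<rho> = gcomp G (ginv G \<delta>) \<gamma>"
        using inv_comp_inv_comp[OF \<beta>(1) \<delta>(1) \<gamma> \<beta>(2) \<delta>(2)] .
      let ?e = "h (gcomp G (ginv G \<delta>) \<gamma>)"
      have e: "?e \<in> carrier (stalk S (gdom G \<delta>))"
        using shifted_in(1)[OF h \<gamma> \<delta>] .
      have ae: "act S (?l \<delta>) ?e \<in> carrier D"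
        using act_in[OF l(1)[OF d]] e l(2,3)[OF d] by (simp add: D_def)
      have gl: "g (?l \<delta>) \<in> carrier D"
        using secs_apply[OF gs l(1)[OF d]] l(2)[OF d] by (simp add: D_def)
      have "act S \<beta> (cterm g h ?\<rho> (?l \<delta>)) = act S \<beta> (g (?l \<delta>) \<otimes>\<^bsub>D\<^esub> act S (?l \<delta>) ?e)"
        unfolding cterm_def s \<rho>(2) D_def ..
      also have "\<dots> = act S \<beta> (g (?l \<delta>)) \<otimes>\<^bsub>T\<^esub> act S \<beta> (act S (?l \<delta>) ?e)"
        using ring_hom_mult[OF act_ring_hom[OF \<beta>(1)], folded D_def, OF gl ae] \<beta>(2)
        by (simp add: T_def)
      \<comment> \<open>Acting by the inverse of \<beta> times \<delta> and then by \<beta> is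
        acting by \<delta>; so the contribution of \<open>h\<close> no longer depends on
        \<beta>.\<close>
      also have "act S \<beta> (act S (?l \<delta>) ?e) = act S (gcomp G \<beta> (?l \<delta>)) ?e"
        using e l(2,3)[OF d] by (intro act_act \<beta>(1) l(1)[OF d]) (auto simp: in_stalk_iff)
      also have "\<dots> = b \<delta>"
        unfolding l(4)[OF d] b_def ..
      finally show "act S \<beta> (cterm g h ?\<rho> (?l \<delta>)) = a \<beta> \<delta> \<otimes>\<^bsub>T\<^esub> b \<delta>"
        unfolding a_def .
    qed (use aT[OF bF] bT in auto)
    finally have "cterm f (g \<star> h) \<gamma> \<beta> = f \<beta> \<otimes>\<^bsub>T\<^esub> (\<Oplus>\<^bsub>T\<^esub>\<delta>\<in>B. a \<beta> \<delta> \<otimes>\<^bsub>T\<^esub> b \<delta>)"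
      by (simp add: cterm_def T_def)
    also have "\<dots> = (\<Oplus>\<^bsub>T\<^esub>\<delta>\<in>B. f \<beta> \<otimes>\<^bsub>T\<^esub> (a \<beta> \<delta> \<otimes>\<^bsub>T\<^esub> b \<delta>))"
      using B(1) fT[OF bF] aT[OF bF] bT by (intro T.finsum_rdistr) auto
    finally show "(\<Oplus>\<^bsub>T\<^esub>\<delta>\<in>B. f \<beta> \<otimes>\<^bsub>T\<^esub> (a \<beta> \<delta> \<otimes>\<^bsub>T\<^esub> b \<delta>)) = cterm f (g \<star> h) \<gamma> \<beta>" ..
  qed
  also have "\<dots> = (f \<star> (g \<star> h)) \<gamma>"
    unfolding T_def F_def by (rule mult_apply_supp[OF f gh \<gamma>, symmetric])
  finally show "((f \<star> g) \<star> h) \<gamma> =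
    (f \<star> (g \<star> h)) \<gamma>" .
qed

text \<open>On the product bisection the convolution has a single term, and both factors depend
  continuously on the arrow by \<open>cob_section\<close> and \<open>cob_left_factor\<close>. Off
  it, either no arrow of \<open>U\<close> has the required range or the right factor misses
  \<open>V\<close>.\<close>

lemma bis_section_mult:
  assumes s: "bis_section U s" and t: "bis_section V t"
  shows "bis_section (set_comp G U V) (s \<star> t)"
proof -
  have sU: "s \<in> secs" "cob G U" "continuous_map (subtopology (arrow_top G) U) (total S) s"
    and sz: "\<And>\<gamma>. \<gamma> \<in> arrows G - U \<Longrightarrow> s \<gamma> = \<zero>\<^bsub>stalk S (gran G \<gamma>)\<^esub>"
    using s by (auto simp: bis_section_def)
  have tV: "t \<in> secs" "cob G V" "continuous_map (subtopology (arrow_top G) V) (total S) t"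
    and tz: "\<And>\<gamma>. \<gamma> \<in> arrows G - V \<Longrightarrow> t \<gamma> = \<zero>\<^bsub>stalk S (gran G \<gamma>)\<^esub>"
    using t by (auto simp: bis_section_def)
  note sf = bis_section_finsec[OF s]
  have bis: "bisection G U" "bisection G V" using sU(2) tV(2) by (auto simp: cob_def)
  let ?W = "set_comp G U V"
  let ?\<beta> = "\<lambda>\<gamma>. inv_into U (gran G) (gran G \<gamma>)"
  let ?\<rho> = "\<lambda>\<gamma>. gcomp G (ginv G (?\<beta> \<gamma>)) \<gamma>"
  have inU: "\<delta> = ?\<beta> \<gamma>" if "\<delta> \<in> U" "gran G \<delta> = gran G \<gamma>" for \<gamma> \<delta>
  proof -
    have "inv_into U (gran G) (gran G \<delta>) = \<delta>"
      using bis(1) that(1) by (simp add: bisection_def)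
    then show ?thesis using that(2) by simp
  qed
  have W: "\<gamma> \<in> ?W \<longleftrightarrow> \<gamma> \<in> arrows G \<and> gran G \<gamma> \<in> gran G ` U \<and> ?\<rho> \<gamma> \<in> V" for \<gamma>
    using bis by (rule set_comp_factor)
  have \<beta>: "?\<beta> \<gamma> \<in> U" "?\<beta> \<gamma> \<in> arrows G" "gran G (?\<beta> \<gamma>) = gran G \<gamma>" if "gran G \<gamma> \<in> gran G ` U" for \<gamma>
    using inv_into_into[OF that] f_inv_into_f[OF that] cob_subset[OF sU(2)] by auto
  have val: "(s \<star> t) \<gamma> = cterm s t \<gamma> (?\<beta> \<gamma>)"
    if "\<gamma> \<in> arrows G" "gran G \<gamma> \<in> gran G ` U" for \<gamma>
  proof (rule mult_apply_single[OF sf tV(1) that(1) \<beta>(2,3)[OF that(2)]])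
    fix \<delta> assume d: "\<delta> \<in> arrows G" "gran G \<delta> = gran G \<gamma>" "\<delta> \<noteq> ?\<beta> \<gamma>"
    then have "\<delta> \<notin> U" using inU by blast
    then show "s \<delta> = \<zero>\<^bsub>stalk S (gran G \<gamma>)\<^esub> \<or>
        t (gcomp G (ginv G \<delta>) \<gamma>) = \<zero>\<^bsub>stalk S (gdom G \<delta>)\<^esub>"
      using sz[of \<delta>] d by simp
  qed
  have zero: "(s \<star> t) \<gamma> = \<zero>\<^bsub>stalk S (gran G \<gamma>)\<^esub>" if "\<gamma> \<in> arrows G - ?W" for \<gamma>
  proof (cases "gran G \<gamma> \<in> gran G ` U")
    case True
    have \<gamma>: "\<gamma> \<in> arrows G" using that by blast
    have r: "?\<rho> \<gamma> \<in> arrows G - V" "gran G (?\<rho> \<gamma>) = gdom G (?\<beta> \<gamma>)"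
      using W[of \<gamma>] that True inv_comp[OF \<beta>(2)[OF True] \<gamma> \<beta>(3)[OF True]] by auto
    then have "t (?\<rho> \<gamma>) = \<zero>\<^bsub>stalk S (gdom G (?\<beta> \<gamma>))\<^esub>"
      using tz[OF r(1)] by simp
    then show ?thesis
      using val[OF \<gamma> True] cterm_zero[OF sU(1) tV(1) \<gamma> \<beta>(2,3)[OF True]] by simp
  next
    case False
    then have nU: "\<delta> \<notin> U" if "gran G \<delta> = gran G \<gamma>" for \<delta> using that by (metis imageI)
    show ?thesis
    proof (rule mult_apply_zero[OF sf tV(1)])
      fix \<delta> assume "\<delta> \<in> arrows G" "gran G \<delta> = gran G \<gamma>"
      then show "s \<delta> = \<zero>\<^bsub>stalk S (gran G \<gamma>)\<^esub> \<or>
          t (gcomp G (ginv G \<delta>) \<gamma>) = \<zero>\<^bsub>stalk S (gdom G \<delta>)\<^esub>"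
        using sz[of \<delta>] nU[of \<delta>] by simp
    qed (use that in blast)
  qed
  have WA: "?W \<subseteq> {\<gamma> \<in> arrows G. gran G \<gamma> \<in> gran G ` U}"
    using W by blast
  have tW: "topspace (subtopology (arrow_top G) ?W) = ?W"
    using WA by (auto simp: arrows_def)
  have c\<beta>: "continuous_map (subtopology (arrow_top G) ?W) (arrow_top G) ?\<beta>"
    using cob_section[OF sU(2)] WA by (rule continuous_map_from_subtopology_mono)
  have c\<rho>: "continuous_map (subtopology (arrow_top G) ?W) (arrow_top G) ?\<rho>"
    using cob_left_factor[OF sU(2)] WA by (rule continuous_map_from_subtopology_mono)
  have "continuous_map (subtopology (arrow_top G) ?W) (subtopology (arrow_top G) U) ?\<beta>"
  proof (rule continuous_map_into_subtopology[OF c\<beta>])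
    show "?\<beta> \<in> topspace (subtopology (arrow_top G) ?W) \<rightarrow> U"
      unfolding tW using \<beta>(1) WA by blast
  qed
  then have cs: "continuous_map (subtopology (arrow_top G) ?W) (total S) (\<lambda>\<gamma>. s (?\<beta> \<gamma>))"
    using continuous_map_compose[OF _ sU(3)] by (simp add: o_def)
  have "continuous_map (subtopology (arrow_top G) ?W) (subtopology (arrow_top G) V) ?\<rho>"
  proof (rule continuous_map_into_subtopology[OF c\<rho>])
    show "?\<rho> \<in> topspace (subtopology (arrow_top G) ?W) \<rightarrow> V"
      unfolding tW using W by blast
  qed
  then have ct: "continuous_map (subtopology (arrow_top G) ?W) (total S) (\<lambda>\<gamma>. t (?\<rho> \<gamma>))"
    using continuous_map_compose[OF _ tV(3)] by (simp add: o_def)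
  have p: "proj S (t (?\<rho> \<gamma>)) = gdom G (?\<beta> \<gamma>)" "proj S (s (?\<beta> \<gamma>)) = gran G \<gamma>"
    "proj S (act S (?\<beta> \<gamma>) (t (?\<rho> \<gamma>))) = gran G \<gamma>" if "\<gamma> \<in> ?W" for \<gamma>
  proof -
    have \<gamma>: "\<gamma> \<in> arrows G" "gran G \<gamma> \<in> gran G ` U" using that WA by auto
    show "proj S (t (?\<rho> \<gamma>)) = gdom G (?\<beta> \<gamma>)" "proj S (act S (?\<beta> \<gamma>) (t (?\<rho> \<gamma>))) = gran G \<gamma>"
      using shifted_in[OF tV(1) \<gamma>(1) \<beta>(2,3)[OF \<gamma>(2)]] by (auto simp: in_stalk_iff)
    show "proj S (s (?\<beta> \<gamma>)) = gran G \<gamma>"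
      using secs_apply[OF sU(1) \<beta>(2)[OF \<gamma>(2)]] \<beta>(3)[OF \<gamma>(2)] by (simp add: in_stalk_iff)
  qed
  have "continuous_map (subtopology (arrow_top G) ?W) (total S)
      (\<lambda>\<gamma>. fmult S (s (?\<beta> \<gamma>)) (act S (?\<beta> \<gamma>) (t (?\<rho> \<gamma>))))"
    by (rule continuous_map_fmult[OF cs continuous_map_act[OF c\<beta> ct]]) (simp_all only: tW p)
  then have "continuous_map (subtopology (arrow_top G) ?W) (total S) (s \<star> t)"
  proof (rule continuous_map_eq)
    fix \<gamma> assume "\<gamma> \<in> topspace (subtopology (arrow_top G) ?W)"
    then have "\<gamma> \<in> arrows G" "gran G \<gamma> \<in> gran G ` U" unfolding tW using WA by auto
    then show "fmult S (s (?\<beta> \<gamma>)) (act S (?\<beta> \<gamma>) (t (?\<rho> \<gamma>))) = (s \<star> t) \<gamma>"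
      using val by (simp add: cterm_def stalk_simps[of "gran G \<gamma>"])
  qed
  then show ?thesis
    using zero cob_set_comp[OF sU(2) tV(2)] mult_in_secs[OF sf tV(1)] by (simp add: bis_section_def)
qed

lemma Gamma_zero_in: "\<zero>\<^bsub>R\<^esub> \<in> carrier R"
  using abelian_group_Gamma by (simp add: abelian_group_def abelian_monoid.zero_closed)

lemma Gamma_add_in: "\<lbrakk>f \<in> carrier R; g \<in> carrier R\<rbrakk>
    \<Longrightarrow> f \<oplus>\<^bsub>R\<^esub> g \<in> carrier R"
  using abelian_group_Gamma by (simp add: abelian_group_def abelian_monoid.a_closed)

lemma zero_mult: "g \<in> secs \<Longrightarrow> \<zero>\<^bsub>R\<^esub> \<star> g = \<zero>\<^bsub>R\<^esub>"
  using Gamma_finsec[OF Gamma_zero_in]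
  by (intro secs_ext mult_in_secs zero_in_secs)
    (auto simp: zero_apply intro!: mult_apply_zero)

lemma mult_zero: "finsec f \<Longrightarrow> f \<star> \<zero>\<^bsub>R\<^esub> = \<zero>\<^bsub>R\<^esub>"
  by (intro secs_ext mult_in_secs zero_in_secs)
    (auto simp: zero_apply inv_comp zero_in_secs intro!: mult_apply_zero)

text \<open>Distributivity reduces the claim, in each factor in turn, to a product of two bisection
  sections.\<close>

lemma Gamma_mult_in:
  assumes f: "f \<in> carrier R" and g: "g \<in> carrier R"
  shows "f \<star> g \<in> carrier R"
  using f
proof (induction rule: Gamma_induct)
  case zero
  then show ?case using zero_mult[OF Gamma_secs[OF g]] Gamma_zero_in by simp
next
  case (add f f')
  then show ?case
    using l_distr_secs[OF Gamma_finsec Gamma_finsec Gamma_secs[OF g]] Gamma_add_in by simp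
next
  case (bis U f)
  show ?case using g
  proof (induction rule: Gamma_induct)
    case zero
    then show ?case using mult_zero[OF bis_section_finsec[OF bis]] Gamma_zero_in by simp
  next
    case (bis V g)
    then show ?case using bis_in_Gamma bis_section_mult[OF \<open>bis_section U f\<close>] by blast
  next
    case (add g g')
    then show ?case
      using r_distr_secs[OF bis_section_finsec[OF bis] Gamma_secs Gamma_secs] Gamma_add_in by simp
  qed
qed

sublocale Gamma: nonunital_ring R
proof -
  interpret abelian_group R by (rule abelian_group_Gamma)
  show "nonunital_ring R"
    by unfold_locales
      (simp_all add: Gamma_mult_in m_assoc_secs l_distr_secs r_distr_secs Gamma_finsec Gamma_secs)
qed

section \<open>Characteristic functions and diagonal elements\<close>

lemma Gamma_neg: "f \<in> carrier R \<Longrightarrow> \<ominus>\<^bsub>R\<^esub> f = neg f"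
proof -
  assume f: "f \<in> carrier R"
  have fs: "f \<in> secs" using f by (rule Gamma_secs)
  interpret sg: comm_group "section_group G S" by (rule comm_group_section_group)
  have "\<ominus>\<^bsub>R\<^esub> f \<oplus>\<^bsub>R\<^esub> f = \<zero>\<^bsub>R\<^esub>"
    using f by (rule Gamma.l_neg)
  then have "inv\<^bsub>section_group G S\<^esub> f = \<ominus>\<^bsub>R\<^esub> f"
    using f fs Gamma_secs[OF Gamma.a_inv_closed[OF f]]
    by (intro sg.inv_equality) (simp_all add: section_group_simps)
  moreover have "inv\<^bsub>section_group G S\<^esub> f = neg f"
    using fs neg_add[OF fs] neg_in_secs[OF fs]
    by (intro sg.inv_equality) (simp_all add: section_group_simps)
  ultimately show ?thesis by simp
qed

lemma minus_apply:
  assumes "f \<in> carrier R" "g \<in> carrier R" "\<gamma> \<in> arrows G"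
  shows "(f \<ominus>\<^bsub>R\<^esub> g) \<gamma> = f \<gamma> \<ominus>\<^bsub>stalk S (gran G \<gamma>)\<^esub> g \<gamma>"
proof -
  interpret ring "stalk S (gran G \<gamma>)" using assms(3) by (rule ring_at)
  show ?thesis
    using assms by (simp add: Gamma.minus_eq minus_eq add_apply Gamma_neg neg_apply)
qed

lemma bis_section_add:
  assumes s: "bis_section U s" and t: "bis_section U t"
  shows "bis_section U (s \<oplus>\<^bsub>R\<^esub> t)"
proof -
  have sU: "s \<in> secs" "cob G U" "continuous_map (subtopology (arrow_top G) U) (total S) s"
    and sz: "\<And>\<gamma>. \<gamma> \<in> arrows G - U \<Longrightarrow> s \<gamma> = \<zero>\<^bsub>stalk S (gran G \<gamma>)\<^esub>"
    using s by (auto simp: bis_section_def)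
  have tU: "t \<in> secs" "continuous_map (subtopology (arrow_top G) U) (total S) t"
    and tz: "\<And>\<gamma>. \<gamma> \<in> arrows G - U \<Longrightarrow> t \<gamma> = \<zero>\<^bsub>stalk S (gran G \<gamma>)\<^esub>"
    using t by (auto simp: bis_section_def)
  have arr: "\<gamma> \<in> arrows G" if "\<gamma> \<in> topspace (subtopology (arrow_top G) U)" for \<gamma>
    using that by (simp add: arrows_def)
  have p: "proj S (s \<gamma>) = gran G \<gamma>" "proj S (t \<gamma>) = gran G \<gamma>" if "\<gamma> \<in> arrows G" for \<gamma>
    using secs_apply[OF sU(1) that] secs_apply[OF tU(1) that] by (simp_all add: in_stalk_iff)
  have "continuous_map (subtopology (arrow_top G) U) (total S) (\<lambda>\<gamma>. fadd S (s \<gamma>) (t \<gamma>))"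
    using p arr by (intro continuous_map_fadd sU(3) tU(2)) simp
  then have "continuous_map (subtopology (arrow_top G) U) (total S) (s \<oplus>\<^bsub>R\<^esub> t)"
  proof (rule continuous_map_eq)
    fix \<gamma> assume "\<gamma> \<in> topspace (subtopology (arrow_top G) U)"
    then have "\<gamma> \<in> arrows G" by (rule arr)
    then show "fadd S (s \<gamma>) (t \<gamma>) = (s \<oplus>\<^bsub>R\<^esub> t) \<gamma>"
      by (simp add: add_apply stalk_simps[of "gran G \<gamma>"])
  qed
  moreover have "(s \<oplus>\<^bsub>R\<^esub> t) \<gamma> = \<zero>\<^bsub>stalk S (gran G \<gamma>)\<^esub>" if \<gamma>: "\<gamma> \<in> arrows G - U" for \<gamma>
  proof -
    interpret ring "stalk S (gran G \<gamma>)" using \<gamma> by (intro ring_at) simp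
    show ?thesis using \<gamma> sz tz by (simp add: add_apply)
  qed
  ultimately show ?thesis
    using sU tU by (simp add: bis_section_def add_in_secs)
qed

lemma bis_section_minus:
  assumes "bis_section U s" "bis_section U t"
  shows "bis_section U (s \<ominus>\<^bsub>R\<^esub> t)"
  using bis_section_add[OF assms(1) bis_section_neg[OF assms(2)]] Gamma_neg[OF bis_in_Gamma[OF assms(2)]]
  by (simp add: Gamma.minus_eq)

text \<open>For \<open>U\<close> inside the units these are idempotents that act as local
  identities; for a general bisection, multiplying by them translates along the arrows of
  \<open>U\<close>.\<close>

definition chi :: "'g set \<Rightarrow> 'g \<Rightarrow> 'e" where
  "chi U = (\<lambda>\<gamma>\<in>arrows G. if \<gamma> \<in> U then \<one>\<^bsub>stalk S (gran G \<gamma>)\<^esub> else \<zero>\<^bsub>stalk S (gran G \<gamma>)\<^esub>)"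

lemma chi_apply: "\<gamma> \<in> arrows G \<Longrightarrow>
    chi U \<gamma> = (if \<gamma> \<in> U then \<one>\<^bsub>stalk S (gran G \<gamma>)\<^esub> else \<zero>\<^bsub>stalk S (gran G \<gamma>)\<^esub>)"
  by (simp add: chi_def)

lemma chi_in_secs: "chi U \<in> secs"
  unfolding secs_iff
proof (intro conjI ballI)
  fix \<gamma> assume \<gamma>: "\<gamma> \<in> arrows G"
  interpret ring "stalk S (gran G \<gamma>)" using \<gamma> by (rule ring_at)
  show "chi U \<gamma> \<in> carrier (stalk S (gran G \<gamma>))"
    using \<gamma> by (simp add: chi_apply)
qed (simp add: chi_def)

lemma bis_section_chi:
  assumes U: "cob G U"
  shows "bis_section U (chi U)"
proof -
  have "continuous_map (subtopology (arrow_top G) U) (total S) (\<lambda>\<gamma>. fone S (gran G \<gamma>))"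
    by (intro continuous_map_comp_unit[OF continuous_fone] continuous_map_from_subtopology continuous_ran)
  then have "continuous_map (subtopology (arrow_top G) U) (total S) (chi U)"
  proof (rule continuous_map_eq)
    fix \<gamma> assume "\<gamma> \<in> topspace (subtopology (arrow_top G) U)"
    then have "\<gamma> \<in> arrows G" "\<gamma> \<in> U" by (auto simp: arrows_def)
    then show "fone S (gran G \<gamma>) = chi U \<gamma>"
      by (simp add: chi_apply stalk_simps(4)[of "gran G \<gamma>"])
  qed
  then show ?thesis
    using U chi_in_secs by (simp add: bis_section_def chi_apply)
qed

lemma chi_in_Gamma: "cob G U \<Longrightarrow> chi U \<in> carrier R"
  by (rule bis_in_Gamma[OF bis_section_chi])

lemma chi_finsec: "cob G U \<Longrightarrow> finsec (chi U)"
  by (rule bis_section_finsec[OF bis_section_chi])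

text \<open>A condition on supports only. Continuity on the unit space is stated separately where it
  matters, so the algebra below also covers products that are merely known to be supported on
  units.\<close>

definition diagonal :: "('g \<Rightarrow> 'e) \<Rightarrow> bool" where
  "diagonal a \<longleftrightarrow> a \<in> secs \<and> (\<forall>\<gamma> \<in> arrows G - units G. a \<gamma> = \<zero>\<^bsub>stalk S (gran G \<gamma>)\<^esub>)"

lemma diagonal_chi: "U \<subseteq> units G \<Longrightarrow> diagonal (chi U)"
  by (auto simp: diagonal_def chi_in_secs chi_apply)

lemma diagonal_finsec:
  assumes "diagonal a"
  shows "finsec a"
  unfolding finsec_def
proof (intro conjI ballI)
  show "a \<in> secs" using assms by (simp add: diagonal_def)
  fix x
  have "supp_at a x \<subseteq> {x}"
    using assms by (auto simp: supp_at_def diagonal_def unit_iff_ran)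
  then show "finite (supp_at a x)"
    by (rule finite_subset) simp
qed

text \<open>Only \<open>gran G \<gamma>\<close> contributes, being the one unit with that range, and
  units act trivially.\<close>

lemma diagonal_mult_apply:
  assumes a: "diagonal a" and f: "f \<in> secs" and \<gamma>: "\<gamma> \<in> arrows G"
  shows "(a \<star> f) \<gamma> = a (gran G \<gamma>) \<otimes>\<^bsub>stalk S (gran G \<gamma>)\<^esub> f \<gamma>"
proof -
  have x: "gran G \<gamma> \<in> units G" using \<gamma> by (rule ran_in_units)
  have "(a \<star> f) \<gamma> = cterm a f \<gamma> (gran G \<gamma>)"
  proof (rule mult_apply_single[OF diagonal_finsec[OF a] f \<gamma>])
    show "gran G \<gamma> \<in> arrows G" "gran G (gran G \<gamma>) = gran G \<gamma>"
      using x by (auto intro: unit_closed ran_unit)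
    fix \<delta> assume d: "\<delta> \<in> arrows G" "gran G \<delta> = gran G \<gamma>" "\<delta> \<noteq> gran G \<gamma>"
    then have "\<delta> \<notin> units G" using ran_unit by force
    then show "a \<delta> = \<zero>\<^bsub>stalk S (gran G \<gamma>)\<^esub> \<or> f (gcomp G (ginv G \<delta>) \<gamma>) = \<zero>\<^bsub>stalk S (gdom G \<delta>)\<^esub>"
      using a d by (simp add: diagonal_def)
  qed
  also have "\<dots> = a (gran G \<gamma>) \<otimes>\<^bsub>stalk S (gran G \<gamma>)\<^esub> act S (gran G \<gamma>) (f \<gamma>)"
    using x \<gamma> by (simp add: cterm_def inv_unit ran_comp_left)
  also have "act S (gran G \<gamma>) (f \<gamma>) = f \<gamma>"
    using secs_apply[OF f \<gamma>] act_unit[of "f \<gamma>"] by (simp add: in_stalk_iff)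
  finally show ?thesis .
qed

text \<open>A nonzero term at \<delta> needs the inverse of \<delta> times \<gamma> to be a unit,
  which forces \<open>\<delta> = \<gamma>\<close>.\<close>

lemma mult_diagonal_apply:
  assumes a: "diagonal a" and f: "finsec f" and \<gamma>: "\<gamma> \<in> arrows G"
  shows "(f \<star> a) \<gamma> = f \<gamma> \<otimes>\<^bsub>stalk S (gran G \<gamma>)\<^esub> act S \<gamma> (a (gdom G \<gamma>))"
proof -
  have as: "a \<in> secs" using a by (simp add: diagonal_def)
  have "(f \<star> a) \<gamma> = cterm f a \<gamma> \<gamma>"
  proof (rule mult_apply_single[OF f as \<gamma> \<gamma> refl])
    fix \<delta> assume d: "\<delta> \<in> arrows G" "gran G \<delta> = gran G \<gamma>" "\<delta> \<noteq> \<gamma>"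
    let ?\<rho> = "gcomp G (ginv G \<delta>) \<gamma>"
    have \<rho>: "?\<rho> \<in> arrows G" "gran G ?\<rho> = gdom G \<delta>"
      using inv_comp[OF d(1) \<gamma> d(2)] by auto
    have "?\<rho> \<notin> units G"
    proof
      assume "?\<rho> \<in> units G"
      then have "?\<rho> = gdom G \<delta>" using \<rho> ran_unit by metis
      then have "gcomp G \<delta> ?\<rho> = \<delta>" using comp_dom[OF d(1)] by simp
      then show False using comp_inv_cancel[OF d(1) \<gamma> d(2)] d(3) by simp
    qed
    then have "a ?\<rho> = \<zero>\<^bsub>stalk S (gran G ?\<rho>)\<^esub>"
      using a \<rho>(1) unfolding diagonal_def by blast
    then show "f \<delta> = \<zero>\<^bsub>stalk S (gran G \<gamma>)\<^esub> \<or> a ?\<rho> = \<zero>\<^bsub>stalk S (gdom G \<delta>)\<^esub>"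
      using \<rho>(2) by simp
  qed
  then show ?thesis
    by (simp add: cterm_def gdom_def)
qed

lemma chi_mult_apply:
  assumes V: "V \<subseteq> units G" and f: "f \<in> secs" and \<gamma>: "\<gamma> \<in> arrows G"
  shows "(chi V \<star> f) \<gamma> = (if gran G \<gamma> \<in> V then f \<gamma> else \<zero>\<^bsub>stalk S (gran G \<gamma>)\<^esub>)"
proof -
  interpret ring "stalk S (gran G \<gamma>)" using \<gamma> by (rule ring_at)
  have x: "gran G \<gamma> \<in> units G" using \<gamma> by (rule ran_in_units)
  show ?thesis
    using diagonal_mult_apply[OF diagonal_chi[OF V] f \<gamma>] secs_apply[OF f \<gamma>]
    by (simp add: chi_apply unit_closed[OF x] ran_unit[OF x])
qed

lemma mult_chi_apply:
  assumes V: "V \<subseteq> units G" and f: "finsec f" and \<gamma>: "\<gamma> \<in> arrows G"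
  shows "(f \<star> chi V) \<gamma> = (if gdom G \<gamma> \<in> V then f \<gamma> else \<zero>\<^bsub>stalk S (gran G \<gamma>)\<^esub>)"
proof -
  interpret ring "stalk S (gran G \<gamma>)" using \<gamma> by (rule ring_at)
  have x: "gdom G \<gamma> \<in> units G" using \<gamma> by (rule dom_in_units)
  show ?thesis
    using mult_diagonal_apply[OF diagonal_chi[OF V] f \<gamma>] secs_apply[OF finsec_secs[OF f] \<gamma>] \<gamma>
    by (simp add: chi_apply unit_closed[OF x] ran_unit[OF x] act_one act_zero)
qed

text \<open>The right factor must lie in \<open>U\<close> and have the domain of \<eta>, so it is
  \<rho>. The left factor acts on the identity of a stalk, which it preserves.\<close>

lemma mult_chi_bisection_apply:
  assumes U: "cob G U" and f: "finsec f" and \<rho>: "\<rho> \<in> U" and \<eta>: "\<eta> \<in> arrows G" "gdom G \<eta> = gdom G \<rho>"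
  shows "(f \<star> chi U) \<eta> = f (gcomp G \<eta> (ginv G \<rho>))"
proof -
  have \<rho>A: "\<rho> \<in> arrows G" using U \<rho> cob_subset by blast
  let ?\<beta> = "gcomp G \<eta> (ginv G \<rho>)"
  have \<beta>: "?\<beta> \<in> arrows G" "gran G ?\<beta> = gran G \<eta>" "gdom G ?\<beta> = gran G \<rho>"
    using \<eta> \<rho>A by (simp_all add: comp_closed ran_comp dom_comp inv_closed ran_inv dom_inv)
  have "gcomp G ?\<beta> \<rho> = gcomp G \<eta> (gcomp G (ginv G \<rho>) \<rho>)"
    using \<eta> \<rho>A by (intro comp_assoc) (simp_all add: inv_closed ran_inv dom_inv)
  then have \<beta>\<rho>: "gcomp G ?\<beta> \<rho> = \<eta>"
    using \<eta> \<rho>A comp_dom[OF \<eta>(1)] by (simp add: inv_comp_self)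
  then have l: "gcomp G (ginv G ?\<beta>) \<eta> = \<rho>"
    using inv_comp_cancel[OF \<beta>(1) \<rho>A \<beta>(3)] by simp
  interpret ring "stalk S (gran G \<eta>)" using \<eta>(1) by (rule ring_at)
  have "(f \<star> chi U) \<eta> = cterm f (chi U) \<eta> ?\<beta>"
  proof (rule mult_apply_single[OF f chi_in_secs \<eta>(1) \<beta>(1,2)])
    fix \<delta> assume d: "\<delta> \<in> arrows G" "gran G \<delta> = gran G \<eta>" "\<delta> \<noteq> ?\<beta>"
    let ?\<epsilon> = "gcomp G (ginv G \<delta>) \<eta>"
    have \<epsilon>: "?\<epsilon> \<in> arrows G" "gran G ?\<epsilon> = gdom G \<delta>" "gdom G ?\<epsilon> = gdom G \<eta>"
      using inv_comp[OF d(1) \<eta>(1) d(2)] by auto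
    have "?\<epsilon> \<notin> U"
    proof
      assume "?\<epsilon> \<in> U"
      moreover have "inj_on (gdom G) U" using U by (simp add: cob_def bisection_def)
      ultimately have "?\<epsilon> = \<rho>"
        using \<epsilon>(3) \<eta>(2) \<rho> by (simp add: inj_on_eq_iff)
      then have dr: "gcomp G \<delta> \<rho> = \<eta>" "gdom G \<delta> = gran G \<rho>"
        using comp_inv_cancel[OF d(1) \<eta>(1) d(2)] \<epsilon>(2) by simp_all
      have "?\<beta> = gcomp G \<delta> (gcomp G \<rho> (ginv G \<rho>))"
        unfolding dr(1)[symmetric] using d(1) \<rho>A dr(2)
        by (intro comp_assoc) (simp_all add: inv_closed ran_inv)
      also have "\<dots> = \<delta>"
        using comp_dom[OF d(1)] dr(2) \<rho>A by (simp add: comp_inv_self)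
      finally show False using d(3) by simp
    qed
    then show "f \<delta> = \<zero>\<^bsub>stalk S (gran G \<eta>)\<^esub> \<or> chi U ?\<epsilon> = \<zero>\<^bsub>stalk S (gdom G \<delta>)\<^esub>"
      using \<epsilon> by (simp add: chi_apply)
  qed
  also have "\<dots> = f ?\<beta> \<otimes>\<^bsub>stalk S (gran G \<eta>)\<^esub> act S ?\<beta> \<one>\<^bsub>stalk S (gran G \<rho>)\<^esub>"
    unfolding cterm_def l using \<rho> \<rho>A by (simp add: chi_apply)
  also have "\<dots> = f ?\<beta>"
    using act_one[OF \<beta>(1)] \<beta>(2,3) secs_apply[OF finsec_secs[OF f] \<beta>(1)] by simp
  finally show ?thesis .
qed

text \<open>The left factor must be \<beta>, the only arrow of \<open>U\<close> with the range of
  \<eta>. On this side the values of \<open>f\<close> are carried between stalks by the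
  action.\<close>

lemma chi_bisection_mult_apply:
  assumes U: "cob G U" and f: "f \<in> secs" and \<beta>: "\<beta> \<in> U" and \<eta>: "\<eta> \<in> arrows G" "gran G \<eta> = gran G \<beta>"
  shows "(chi U \<star> f) \<eta> = act S \<beta> (f (gcomp G (ginv G \<beta>) \<eta>))"
proof -
  have \<beta>A: "\<beta> \<in> arrows G" using U \<beta> cob_subset by blast
  interpret ring "stalk S (gran G \<eta>)" using \<eta>(1) by (rule ring_at)
  have "(chi U \<star> f) \<eta> = cterm (chi U) f \<eta> \<beta>"
  proof (rule mult_apply_single[OF chi_finsec[OF U] f \<eta>(1) \<beta>A \<eta>(2)[symmetric]])
    fix \<delta> assume d: "\<delta> \<in> arrows G" "gran G \<delta> = gran G \<eta>" "\<delta> \<noteq> \<beta>"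
    have "inj_on (gran G) U" using U by (simp add: cob_def bisection_def)
    then have "\<delta> \<notin> U"
      using d \<beta> \<eta>(2) by (auto simp: inj_on_eq_iff)
    then show "chi U \<delta> = \<zero>\<^bsub>stalk S (gran G \<eta>)\<^esub> \<or>
        f (gcomp G (ginv G \<delta>) \<eta>) = \<zero>\<^bsub>stalk S (gdom G \<delta>)\<^esub>"
      using d by (simp add: chi_apply)
  qed
  also have "\<dots> = act S \<beta> (f (gcomp G (ginv G \<beta>) \<eta>))"
    unfolding cterm_def using \<beta> \<beta>A shifted_in(2)[OF f \<eta>(1) \<beta>A \<eta>(2)[symmetric]]
    by (simp add: chi_apply \<eta>(2)[symmetric])
  finally show ?thesis .
qed

text \<open>If \<beta> and the inverse of \<delta> are composable, then \<beta> and \<delta> have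
  the same domain, so they coincide.\<close>

lemma set_comp_inv_units: "cob G U \<Longrightarrow> set_comp G U (ginv G ` U) \<subseteq> units G"
proof
  fix \<gamma> assume U: "cob G U" and "\<gamma> \<in> set_comp G U (ginv G ` U)"
  then obtain \<beta> \<delta> where b: "\<beta> \<in> U" "\<delta> \<in> U" "gdom G \<beta> = gran G (ginv G \<delta>)" "\<gamma> = gcomp G \<beta> (ginv G \<delta>)"
    by (auto simp: set_comp_def)
  then have A: "\<beta> \<in> arrows G" "\<delta> \<in> arrows G" using U cob_subset by blast+
  have "inj_on (gdom G) U" using U by (simp add: cob_def bisection_def)
  then have "\<beta> = \<delta>"
    using b A by (simp add: ran_inv inj_on_eq_iff)
  then show "\<gamma> \<in> units G"
    using b A by (simp add: comp_inv_self ran_in_units)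
qed

lemma diagonal_bis_section: "bis_section U f \<Longrightarrow> U \<subseteq> units G \<Longrightarrow> diagonal f"
  by (auto simp: bis_section_def diagonal_def)

text \<open>Multiplication by a diagonal element rescales each value within its stalk, so the
  bisection does not change. Therefore commutators with such elements do not increase the number of
  summands.\<close>

lemma bis_section_diagonal_mult:
  assumes a: "diagonal a" "continuous_map (unit_top G) (total S) a" and s: "bis_section U s"
  shows "bis_section U (a \<star> s)" "bis_section U (s \<star> a)"
proof -
  have sU: "s \<in> secs" "cob G U" "continuous_map (subtopology (arrow_top G) U) (total S) s"
    and sz: "\<And>\<gamma>. \<gamma> \<in> arrows G - U \<Longrightarrow> s \<gamma> = \<zero>\<^bsub>stalk S (gran G \<gamma>)\<^esub>"
    using s by (auto simp: bis_section_def)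
  note sf = bis_section_finsec[OF s]
  have as: "a \<in> secs" using a(1) by (simp add: diagonal_def)
  let ?X = "subtopology (arrow_top G) U"
  have arr: "\<gamma> \<in> arrows G" if "\<gamma> \<in> topspace ?X" for \<gamma>
    using that by (simp add: arrows_def)
  have ps: "proj S (s \<gamma>) = gran G \<gamma>" if "\<gamma> \<in> arrows G" for \<gamma>
    using secs_apply[OF sU(1) that] by (simp add: in_stalk_iff)
  have pa: "a x \<in> carrier (stalk S x)" if "x \<in> units G" for x
    using secs_apply[OF as unit_closed[OF that]] ran_unit[OF that] by simp
  have car: "continuous_map ?X (total S) (\<lambda>\<gamma>. a (gran G \<gamma>))"
    by (intro continuous_map_comp_unit[OF a(2)] continuous_map_from_subtopology continuous_ran)
  have cad: "continuous_map ?X (total S) (\<lambda>\<gamma>. a (gdom G \<gamma>))"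
    by (intro continuous_map_comp_unit[OF a(2)] continuous_map_from_subtopology continuous_dom)
  have "continuous_map ?X (total S) (\<lambda>\<gamma>. fmult S (a (gran G \<gamma>)) (s \<gamma>))"
    using arr ps pa ran_in_units by (intro continuous_map_fmult[OF car sU(3)]) (simp add: in_stalk_iff)
  then have 1: "continuous_map ?X (total S) (a \<star> s)"
  proof (rule continuous_map_eq)
    fix \<gamma> assume "\<gamma> \<in> topspace ?X"
    then have "\<gamma> \<in> arrows G" by (rule arr)
    then show "fmult S (a (gran G \<gamma>)) (s \<gamma>) = (a \<star> s) \<gamma>"
      using diagonal_mult_apply[OF a(1) sU(1)] by (simp add: stalk_simps[of "gran G \<gamma>"])
  qed
  have "continuous_map ?X (total S) (\<lambda>\<gamma>. act S \<gamma> (a (gdom G \<gamma>)))"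
  proof (rule continuous_map_act[OF _ cad])
    show "continuous_map ?X (arrow_top G) (\<lambda>\<gamma>. \<gamma>)" by (simp add: continuous_map_from_subtopology)
    show "gdom G \<gamma> = proj S (a (gdom G \<gamma>))" if "\<gamma> \<in> topspace ?X" for \<gamma>
      using pa[OF dom_in_units[OF arr[OF that]]] by (simp add: in_stalk_iff)
  qed
  then have "continuous_map ?X (total S) (\<lambda>\<gamma>. fmult S (s \<gamma>) (act S \<gamma> (a (gdom G \<gamma>))))"
  proof (rule continuous_map_fmult[OF sU(3)])
    fix \<gamma> assume "\<gamma> \<in> topspace ?X"
    then have \<gamma>: "\<gamma> \<in> arrows G" by (rule arr)
    show "proj S (s \<gamma>) = proj S (act S \<gamma> (a (gdom G \<gamma>)))"
      using ps[OF \<gamma>] act_in[OF \<gamma> pa[OF dom_in_units[OF \<gamma>]]] by (simp add: in_stalk_iff)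
  qed
  then have 2: "continuous_map ?X (total S) (s \<star> a)"
  proof (rule continuous_map_eq)
    fix \<gamma> assume "\<gamma> \<in> topspace ?X"
    then have "\<gamma> \<in> arrows G" by (rule arr)
    then show "fmult S (s \<gamma>) (act S \<gamma> (a (gdom G \<gamma>))) = (s \<star> a) \<gamma>"
      using mult_diagonal_apply[OF a(1) sf] by (simp add: stalk_simps[of "gran G \<gamma>"])
  qed
  have z: "(a \<star> s) \<gamma> = \<zero>\<^bsub>stalk S (gran G \<gamma>)\<^esub> \<and> (s \<star> a) \<gamma> = \<zero>\<^bsub>stalk S (gran G \<gamma>)\<^esub>"
    if "\<gamma> \<in> arrows G - U" for \<gamma>
  proof -
    have \<gamma>: "\<gamma> \<in> arrows G" using that by blast
    interpret ring "stalk S (gran G \<gamma>)" using \<gamma> by (rule ring_at)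
    show ?thesis
      using diagonal_mult_apply[OF a(1) sU(1) \<gamma>] mult_diagonal_apply[OF a(1) sf \<gamma>] sz[OF that]
        pa[OF ran_in_units[OF \<gamma>]] act_in[OF \<gamma> pa[OF dom_in_units[OF \<gamma>]]] by simp
  qed
  show "bis_section U (a \<star> s)" "bis_section U (s \<star> a)"
    using 1 2 z sU(2) mult_in_secs[OF diagonal_finsec[OF a(1)] sU(1)] mult_in_secs[OF sf as]
    by (auto simp: bis_section_def)
qed

section \<open>Decompositions into n bisection sections\<close>

primrec spans :: "nat \<Rightarrow> ('g \<Rightarrow> 'e) set" where
  "spans 0 = {\<zero>\<^bsub>R\<^esub>}"
| "spans (Suc n) = {s \<oplus>\<^bsub>R\<^esub> g |s g. (\<exists>U. bis_section U s) \<and> g \<in> spans n}"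

lemma spans_subset: "f \<in> spans n \<Longrightarrow> f \<in> carrier R"
  by (induction n arbitrary: f) (auto intro: bis_in_Gamma)

lemma spans_add: "\<lbrakk>f \<in> spans m; g \<in> spans n\<rbrakk> \<Longrightarrow> f \<oplus>\<^bsub>R\<^esub> g \<in> spans (m + n)"
proof (induction m arbitrary: f)
  case 0
  then show ?case using spans_subset by simp
next
  case (Suc m)
  then obtain s U h where s: "bis_section U s" "h \<in> spans m" "f = s \<oplus>\<^bsub>R\<^esub> h" by auto
  have "f \<oplus>\<^bsub>R\<^esub> g = s \<oplus>\<^bsub>R\<^esub> (h \<oplus>\<^bsub>R\<^esub> g)"
    using s Suc.prems(2) spans_subset bis_in_Gamma by (simp add: Gamma.a_assoc)
  moreover have "h \<oplus>\<^bsub>R\<^esub> g \<in> spans (m + n)"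
    using s Suc by blast
  ultimately show ?case using s(1) by auto
qed

text \<open>An element has many decompositions and none is canonical; only the least length is
  meaningful. As the zero section is itself a bisection section, length \<open>n\<close> includes
  all smaller lengths.\<close>

lemma Gamma_spans: "f \<in> carrier R \<Longrightarrow> \<exists>n. f \<in> spans n"
proof (induction rule: Gamma_induct)
  case zero
  have "\<zero>\<^bsub>R\<^esub> \<in> spans 0" by simp
  then show ?case ..
next
  case (bis U f)
  have "f = f \<oplus>\<^bsub>R\<^esub> \<zero>\<^bsub>R\<^esub>"
    using bis_in_Gamma[OF bis] by simp
  then have "f \<in> spans (Suc 0)"
    using bis by auto
  then show ?case ..
next
  case (add f g)
  then show ?case using spans_add by blast
qed

text \<open>The values of the summands at \<gamma> add up to \<open>f \<gamma>\<close>, so some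
  summand is nonzero there. Commutativity of addition moves it to the front and leaves a shorter sum
  \<open>g\<close>.\<close>

lemma spans_pick:
  assumes "f \<in> spans n" "\<gamma> \<in> arrows G" "f \<gamma> \<noteq> \<zero>\<^bsub>stalk S (gran G \<gamma>)\<^esub>"
  shows "\<exists>m U s g. n = Suc m \<and> bis_section U s \<and> g \<in> spans m \<and> f = s \<oplus>\<^bsub>R\<^esub> g \<and>
    s \<gamma> \<noteq> \<zero>\<^bsub>stalk S (gran G \<gamma>)\<^esub>"
  using assms(1,3)
proof (induction n arbitrary: f)
  case 0
  then show ?case using assms(2) by (simp add: zero_apply)
next
  case (Suc n)
  then obtain s U g where s: "bis_section U s" "g \<in> spans n" "f = s \<oplus>\<^bsub>R\<^esub> g" by auto
  show ?case
  proof (cases "s \<gamma> = \<zero>\<^bsub>stalk S (gran G \<gamma>)\<^esub>")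
    case False
    then show ?thesis using s by blast
  next
    case True
    interpret ring "stalk S (gran G \<gamma>)" using assms(2) by (rule ring_at)
    have "f \<gamma> = g \<gamma>"
      using s(3) True assms(2) secs_apply[OF Gamma_secs[OF spans_subset[OF s(2)]] assms(2)]
      by (simp add: add_apply)
    then obtain m V t h where t: "n = Suc m" "bis_section V t" "h \<in> spans m" "g = t \<oplus>\<^bsub>R\<^esub> h"
      "t \<gamma> \<noteq> \<zero>\<^bsub>stalk S (gran G \<gamma>)\<^esub>"
      using Suc.IH[OF s(2)] Suc.prems(2) by auto
    have "f = t \<oplus>\<^bsub>R\<^esub> (s \<oplus>\<^bsub>R\<^esub> h)"
      using s t(4) bis_in_Gamma[OF s(1)] bis_in_Gamma[OF t(2)] spans_subset[OF t(3)]
      by (simp add: Gamma.a_lcomm)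
    moreover have "s \<oplus>\<^bsub>R\<^esub> h \<in> spans n"
      using s(1) t(1,3) by auto
    ultimately show ?thesis using t(2,5) by blast
  qed
qed

lemma spans_mult_bis:
  assumes t: "bis_section V t" and f: "f \<in> spans n"
  shows "f \<star> t \<in> spans n"
  using f
proof (induction n arbitrary: f)
  case 0
  then show ?case using Gamma.l_null[OF bis_in_Gamma[OF t]] by simp
next
  case (Suc n)
  then obtain s U g where s: "bis_section U s" "g \<in> spans n" "f = s \<oplus>\<^bsub>R\<^esub> g" by auto
  have "f \<star> t = s \<star> t \<oplus>\<^bsub>R\<^esub> g \<star> t"
    using s(3) Gamma.l_distr[OF bis_in_Gamma[OF s(1)] spans_subset[OF s(2)] bis_in_Gamma[OF t]] by simp
  then show ?case
    using bis_section_mult[OF s(1) t] Suc.IH[OF s(2)] by auto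
qed

lemma commutator_add:
  assumes "a \<in> carrier R" "f \<in> carrier R" "g \<in> carrier R"
  shows "a \<star> (f \<oplus>\<^bsub>R\<^esub> g) \<ominus>\<^bsub>R\<^esub> (f \<oplus>\<^bsub>R\<^esub> g) \<star> a =
    (a \<star> f \<ominus>\<^bsub>R\<^esub> f \<star> a) \<oplus>\<^bsub>R\<^esub> (a \<star> g \<ominus>\<^bsub>R\<^esub> g \<star> a)"
  using assms
  by (simp add: Gamma.minus_eq Gamma.r_distr Gamma.l_distr Gamma.m_closed Gamma.minus_add Gamma.a_ac)

lemma spans_commutator:
  assumes a: "diagonal a" "continuous_map (unit_top G) (total S) a" "a \<in> carrier R"
    and f: "f \<in> spans n"
  shows "a \<star> f \<ominus>\<^bsub>R\<^esub> f \<star> a \<in> spans n"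
  using f
proof (induction n arbitrary: f)
  case 0
  then show ?case using Gamma.l_null[OF a(3)] Gamma.r_null[OF a(3)]
    by (simp add: Gamma.minus_eq Gamma.r_neg)
next
  case (Suc n)
  then obtain s U g where s: "bis_section U s" "g \<in> spans n" "f = s \<oplus>\<^bsub>R\<^esub> g" by auto
  have "bis_section U (a \<star> s \<ominus>\<^bsub>R\<^esub> s \<star> a)"
    by (intro bis_section_minus bis_section_diagonal_mult a s)
  then show ?case
    using commutator_add[OF a(3) bis_in_Gamma[OF s(1)] spans_subset[OF s(2)]] s(3) Suc.IH[OF s(2)]
    by auto
qed

lemma Gamma_units_diagonal:
  assumes "a \<in> Gamma_c_units G S" "a \<in> carrier R"
  shows "diagonal a" "continuous_map (unit_top G) (total S) a"
proof -
  obtain s where s: "continuous_map (unit_top G) (total S) s" "a = extend_by_zero G S s"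
    using assms(1) by (auto simp: Gamma_c_units_def compactly_supported_sections_def)
  show "diagonal a"
    using s(2) Gamma_secs[OF assms(2)] by (auto simp: diagonal_def extend_by_zero_def stalk_simps(3))
  show "continuous_map (unit_top G) (total S) a"
    using s(1)
  proof (rule continuous_map_eq)
    fix x assume "x \<in> topspace (unit_top G)"
    then have "x \<in> units G" by (simp add: topspace_unit_top)
    then show "s x = a x" using s(2) unit_closed by (simp add: extend_by_zero_def)
  qed
qed

text \<open>Each bisection has a compact open set of ranges, and such sets are closed under finite
  unions. The resulting \<open>chi K\<close> is a left identity for \<open>f\<close>.\<close>

lemma Gamma_supp:
  "f \<in> carrier R \<Longrightarrow> \<exists>K. cob G K \<and> K \<subseteq> units G \<and>
    (\<forall>\<gamma>\<in>arrows G. f \<gamma> \<noteq> \<zero>\<^bsub>stalk S (gran G \<gamma>)\<^esub> \<longrightarrow> gran G \<gamma> \<in> K)"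
proof (induction rule: Gamma_induct)
  case zero
  show ?case using cob_empty by (intro exI[of _ "{}"]) (simp add: zero_apply)
next
  case (bis U f)
  then have U: "cob G U" and z: "\<And>\<gamma>. \<gamma> \<in> arrows G - U \<Longrightarrow> f \<gamma> = \<zero>\<^bsub>stalk S (gran G \<gamma>)\<^esub>"
    by (auto simp: bis_section_def)
  have "gran G \<gamma> \<in> gran G ` U" if "\<gamma> \<in> arrows G" "f \<gamma> \<noteq> \<zero>\<^bsub>stalk S (gran G \<gamma>)\<^esub>" for \<gamma>
    using z[of \<gamma>] that by blast
  then show ?case
    using cob_ran[OF U] by (intro exI[of _ "gran G ` U"]) simp
next
  case (add f g)
  from add.IH(1) obtain K where K: "cob G K" "K \<subseteq> units G"
      "\<forall>\<gamma>\<in>arrows G. f \<gamma> \<noteq> \<zero>\<^bsub>stalk S (gran G \<gamma>)\<^esub> \<longrightarrow> gran G \<gamma> \<in> K"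
    by (elim exE conjE)
  from add.IH(2) obtain L where L: "cob G L" "L \<subseteq> units G"
      "\<forall>\<gamma>\<in>arrows G. g \<gamma> \<noteq> \<zero>\<^bsub>stalk S (gran G \<gamma>)\<^esub> \<longrightarrow> gran G \<gamma> \<in> L"
    by (elim exE conjE)
  have "gran G \<gamma> \<in> K \<union> L"
    if \<gamma>: "\<gamma> \<in> arrows G" "(f \<oplus>\<^bsub>R\<^esub> g) \<gamma> \<noteq> \<zero>\<^bsub>stalk S (gran G \<gamma>)\<^esub>" for \<gamma>
  proof (rule ccontr)
    interpret ring "stalk S (gran G \<gamma>)" using \<gamma>(1) by (rule ring_at)
    assume "gran G \<gamma> \<notin> K \<union> L"
    then have "f \<gamma> = \<zero>\<^bsub>stalk S (gran G \<gamma>)\<^esub>" "g \<gamma> = \<zero>\<^bsub>stalk S (gran G \<gamma>)\<^esub>"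
      using K(3) L(3) \<gamma>(1) by blast+
    then show False using \<gamma> by (simp add: add_apply)
  qed
  then show ?case
    using cob_Un[OF K(1) L(1) K(2) L(2)] K(2) L(2)
    by (intro exI[of _ "K \<union> L"] conjI ballI impI) simp_all
qed

section \<open>Germs of module elements\<close>

text \<open>A simple module consists of the compactly supported sections of a sheaf on the unit space. The
  germ of \<open>m\<close> at \<open>y\<close> in that sheaf vanishes if and only if the following holds.\<close>

definition germ_zero :: "('g \<Rightarrow> 'e, 'm, 'z) module_scheme \<Rightarrow> 'm \<Rightarrow> 'g \<Rightarrow> bool" where
  "germ_zero M m y \<longleftrightarrow> (\<exists>V. cob G V \<and> V \<subseteq> units G \<and> y \<in> V \<and> chi V \<odot>\<^bsub>M\<^esub> m = \<zero>\<^bsub>M\<^esub>)"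

text \<open>Through this, the vanishing of \<open>chi V\<close> on a module element passes to every
  smaller compact open set.\<close>

lemma chi_mult_chi:
  assumes V: "V \<subseteq> units G" and W: "W \<subseteq> V"
  shows "chi W \<star> chi V = chi W"
proof -
  have WU: "W \<subseteq> units G" using V W by blast
  note Wd = diagonal_chi[OF WU]
  show ?thesis
  proof (rule secs_ext[OF mult_in_secs[OF diagonal_finsec[OF Wd] chi_in_secs] chi_in_secs])
    fix \<gamma> assume \<gamma>: "\<gamma> \<in> arrows G"
    have "gdom G \<gamma> \<in> V" if "\<gamma> \<in> W"
    proof -
      have "\<gamma> \<in> V" "\<gamma> \<in> units G" using that W WU by blast+
      then show ?thesis by (simp add: dom_unit)
    qed
    then show "(chi W \<star> chi V) \<gamma> = chi W \<gamma>"
      using mult_chi_apply[OF V diagonal_finsec[OF Wd] \<gamma>] \<gamma> by (auto simp: chi_apply)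
  qed
qed

text \<open>Inclusion and exclusion for commuting idempotents. In this form every term on the right
  kills a module element that both \<open>chi V\<close> and \<open>chi W\<close> kill.\<close>

lemma chi_union:
  assumes V: "cob G V" "V \<subseteq> units G" and W: "cob G W" "W \<subseteq> units G"
  shows "chi (V \<union> W) = chi V \<oplus>\<^bsub>R\<^esub> (chi W \<ominus>\<^bsub>R\<^esub> chi W \<star> chi V)"
proof (rule secs_ext[OF chi_in_secs])
  have VR: "chi V \<in> carrier R" and WR: "chi W \<in> carrier R"
    using V W by (auto intro: chi_in_Gamma)
  have WVR: "chi W \<star> chi V \<in> carrier R" using WR VR by (rule Gamma.m_closed)
  show "chi V \<oplus>\<^bsub>R\<^esub> (chi W \<ominus>\<^bsub>R\<^esub> chi W \<star> chi V) \<in> secs"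
    using VR WR WVR by (intro Gamma_secs) simp
  fix \<gamma> assume \<gamma>: "\<gamma> \<in> arrows G"
  interpret ring "stalk S (gran G \<gamma>)" using \<gamma> by (rule ring_at)
  have WV: "(chi W \<star> chi V) \<gamma> = (if gran G \<gamma> \<in> W then chi V \<gamma> else \<zero>\<^bsub>stalk S (gran G \<gamma>)\<^esub>)"
    using chi_mult_apply[OF W(2) chi_in_secs \<gamma>] .
  show "chi (V \<union> W) \<gamma> = (chi V \<oplus>\<^bsub>R\<^esub> (chi W \<ominus>\<^bsub>R\<^esub> chi W \<star> chi V)) \<gamma>"
  proof (cases "\<gamma> \<in> units G")
    case True
    then have "gran G \<gamma> = \<gamma>" by (rule ran_unit)
    then have "(chi W \<star> chi V) \<gamma> =
        (if \<gamma> \<in> W \<and> \<gamma> \<in> V then \<one>\<^bsub>stalk S (gran G \<gamma>)\<^esub> else \<zero>\<^bsub>stalk S (gran G \<gamma>)\<^esub>)"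
      using WV \<gamma> by (simp add: chi_apply)
    then show ?thesis
      using \<gamma> minus_apply[OF WR WVR \<gamma>] by (simp add: add_apply chi_apply minus_eq r_neg)
  next
    case False
    then have "\<gamma> \<notin> V" "\<gamma> \<notin> W" using V(2) W(2) by auto
    then show ?thesis
      using \<gamma> minus_apply[OF WR WVR \<gamma>] WV by (simp add: add_apply chi_apply minus_eq)
  qed
qed

lemma chi_smult_Union:
  assumes M: "left_module R M" and m: "m \<in> carrier M"
    and F: "finite F" "\<And>V. V \<in> F \<Longrightarrow> cob G V \<and> V \<subseteq> units G \<and> chi V \<odot>\<^bsub>M\<^esub> m = \<zero>\<^bsub>M\<^esub>"
  shows "cob G (\<Union>F) \<and> \<Union>F \<subseteq> units G \<and> chi (\<Union>F) \<odot>\<^bsub>M\<^esub> m = \<zero>\<^bsub>M\<^esub>"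
  using F
proof (induction F)
  interpret M: left_module R M by (rule M)
  case empty
  have "chi {} = \<zero>\<^bsub>R\<^esub>"
    by (rule secs_ext[OF chi_in_secs zero_in_secs]) (simp add: chi_apply zero_apply)
  then show ?case using cob_empty M.zero_smult[OF m] by simp
next
  interpret M: left_module R M by (rule M)
  case (insert V F)
  let ?W = "\<Union>F"
  have V: "cob G V" "V \<subseteq> units G" "chi V \<odot>\<^bsub>M\<^esub> m = \<zero>\<^bsub>M\<^esub>"
    and W: "cob G ?W" "?W \<subseteq> units G" "chi ?W \<odot>\<^bsub>M\<^esub> m = \<zero>\<^bsub>M\<^esub>"
    using insert by simp_all
  have VR: "chi V \<in> carrier R" and WR: "chi ?W \<in> carrier R"
    using V W by (auto intro: chi_in_Gamma)
  have VWR: "chi V \<star> chi ?W \<in> carrier R" using VR WR by (rule Gamma.m_closed)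
  have "chi (?W \<union> V) \<odot>\<^bsub>M\<^esub> m = chi ?W \<odot>\<^bsub>M\<^esub> m \<oplus>\<^bsub>M\<^esub>
      (chi V \<odot>\<^bsub>M\<^esub> m \<oplus>\<^bsub>M\<^esub> (\<ominus>\<^bsub>M\<^esub> (chi V \<odot>\<^bsub>M\<^esub> (chi ?W \<odot>\<^bsub>M\<^esub> m))))"
    unfolding chi_union[OF W(1,2) V(1,2)] Gamma.minus_eq
    using VR WR VWR m by (simp add: M.smult_l_distr M.minus_smult[symmetric] M.smult_assoc)
  also have "\<dots> = \<zero>\<^bsub>M\<^esub>"
    unfolding W(3) V(3) M.smult_zero[OF VR] by simp
  finally show ?case
    using cob_Un[OF W(1) V(1) W(2) V(2)] V(2) W(2) by (simp add: Un_commute)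
qed

text \<open>A simple module is cyclic, so \<open>m\<close> is a multiple of a generator by some
  \<open>a\<close>, and a local identity \<open>chi K\<close> of \<open>a\<close> fixes
  \<open>m\<close>. Finitely many of the neighbourhoods that kill \<open>m\<close> cover the compact
  \<open>K\<close>, and their union kills \<open>m\<close>.\<close>

lemma germs_zero_imp_zero:
  assumes M: "simple_left_module R M" and m: "m \<in> carrier M"
    and z: "\<And>y. y \<in> units G \<Longrightarrow> germ_zero M m y"
  shows "m = \<zero>\<^bsub>M\<^esub>"
proof -
  interpret M: left_module R M using M by (simp add: simple_left_module_def)
  obtain n where n: "n \<in> carrier M" "carrier M = (\<lambda>a. a \<odot>\<^bsub>M\<^esub> n) ` carrier R"
    using M by (rule M.simple_imp_cyclic)
  obtain a where a: "a \<in> carrier R" "m = a \<odot>\<^bsub>M\<^esub> n" using m n(2) by auto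
  obtain K where K: "cob G K" "K \<subseteq> units G"
    "\<forall>\<gamma>\<in>arrows G. a \<gamma> \<noteq> \<zero>\<^bsub>stalk S (gran G \<gamma>)\<^esub> \<longrightarrow> gran G \<gamma> \<in> K"
    using Gamma_supp[OF a(1)] by (elim exE conjE)
  have KR: "chi K \<in> carrier R" using K(1) by (rule chi_in_Gamma)
  have "chi K \<star> a = a"
  proof (rule secs_ext[OF Gamma_secs[OF Gamma.m_closed[OF KR a(1)]] Gamma_secs[OF a(1)]])
    fix \<gamma> assume "\<gamma> \<in> arrows G"
    then show "(chi K \<star> a) \<gamma> = a \<gamma>"
      using chi_mult_apply[OF K(2) Gamma_secs[OF a(1)]] K(3) by auto
  qed
  then have Km: "chi K \<odot>\<^bsub>M\<^esub> m = m"
    using M.smult_assoc[OF KR a(1) n(1)] a(2) by simp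
  define F where "F = {V. cob G V \<and> V \<subseteq> units G \<and> chi V \<odot>\<^bsub>M\<^esub> m = \<zero>\<^bsub>M\<^esub>}"
  have "K \<subseteq> \<Union>F"
    using z K(2) unfolding F_def germ_zero_def by blast
  moreover have "openin (arrow_top G) V" if "V \<in> F" for V
    using that by (simp add: F_def cob_def)
  moreover have "compactin (arrow_top G) K" using K(1) by (simp add: cob_def)
  ultimately obtain F' where F': "finite F'" "F' \<subseteq> F" "K \<subseteq> \<Union>F'"
    using compactinD[of "arrow_top G" K F] by blast
  have W: "cob G (\<Union>F')" "\<Union>F' \<subseteq> units G" "chi (\<Union>F') \<odot>\<^bsub>M\<^esub> m = \<zero>\<^bsub>M\<^esub>"
  proof -
    have "\<And>V. V \<in> F' \<Longrightarrow> cob G V \<and> V \<subseteq> units G \<and> chi V \<odot>\<^bsub>M\<^esub> m = \<zero>\<^bsub>M\<^esub>"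
      using F'(2) by (auto simp: F_def)
    from chi_smult_Union[OF M.left_module_axioms m F'(1) this]
    show "cob G (\<Union>F')" "\<Union>F' \<subseteq> units G" "chi (\<Union>F') \<odot>\<^bsub>M\<^esub> m = \<zero>\<^bsub>M\<^esub>"
      by auto
  qed
  have "m = (chi K \<star> chi (\<Union>F')) \<odot>\<^bsub>M\<^esub> m"
    using chi_mult_chi[OF W(2) F'(3)] Km by simp
  also have "\<dots> = chi K \<odot>\<^bsub>M\<^esub> (chi (\<Union>F') \<odot>\<^bsub>M\<^esub> m)"
    using KR chi_in_Gamma[OF W(1)] m by (rule M.smult_assoc)
  finally show ?thesis
    using W(3) M.smult_zero[OF KR] by simp
qed

text \<open>At the range of an arrow in \<open>U\<close>, the new germ depends only on the germ of
  \<open>m\<close> at the domain of that arrow, which lies in the same orbit. At any other point,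
  \<open>s\<close> vanishes on all arrows with range nearby.\<close>

lemma germ_zero_bis_smult:
  assumes M: "left_module R M" and m: "m \<in> carrier M" and s: "bis_section U s"
    and y: "y \<in> orbit G x" and z: "\<And>z. z \<in> orbit G x \<Longrightarrow> germ_zero M m z"
  shows "germ_zero M (s \<odot>\<^bsub>M\<^esub> m) y"
proof -
  interpret M: left_module R M by (rule M)
  have U: "cob G U" and sz: "\<And>\<gamma>. \<gamma> \<in> arrows G - U \<Longrightarrow> s \<gamma> = \<zero>\<^bsub>stalk S (gran G \<gamma>)\<^esub>"
    using s by (auto simp: bis_section_def)
  note sR = bis_in_Gamma[OF s] and sf = bis_section_finsec[OF s]
  note ss = finsec_secs[OF sf]
  have yU: "y \<in> units G" using y orbit_subset by blast
  show ?thesis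
  proof (cases "y \<in> gran G ` U")
    case True
    then obtain \<gamma> where \<gamma>: "\<gamma> \<in> U" "y = gran G \<gamma>" by blast
    have \<gamma>A: "\<gamma> \<in> arrows G" using \<gamma>(1) cob_subset[OF U] by blast
    obtain \<eta> where \<eta>: "\<eta> \<in> arrows G" "gdom G \<eta> = x" "gran G \<eta> = gran G \<gamma>"
      using y \<gamma>(2) by (auto simp: orbit_def)
    have "gdom G \<gamma> \<in> orbit G x"
      using inv_comp[OF \<gamma>A \<eta>(1) \<eta>(3)[symmetric]] \<eta>(2) unfolding orbit_def by force
    then obtain W where W: "cob G W" "W \<subseteq> units G" "gdom G \<gamma> \<in> W" "chi W \<odot>\<^bsub>M\<^esub> m = \<zero>\<^bsub>M\<^esub>"
      using z unfolding germ_zero_def by blast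
    \<comment> \<open>The neighbourhood \<open>W\<close> of the domain, transported along
      \<open>U\<close> to the range side; \<open>inV\<close> then yields
      \<open>chi V \<star> s = s \<star> chi W\<close>.\<close>
    define V where "V = gran G ` set_comp G U W"
    have V: "cob G V" "V \<subseteq> units G"
      unfolding V_def using cob_ran[OF cob_set_comp[OF U W(1)]] by auto
    have inV: "gran G \<delta> \<in> V \<longleftrightarrow> gdom G \<delta> \<in> W" if \<delta>: "\<delta> \<in> U" for \<delta>
    proof
      have \<delta>A: "\<delta> \<in> arrows G" using \<delta> cob_subset[OF U] by blast
      show "gran G \<delta> \<in> V" if "gdom G \<delta> \<in> W"
      proof -
        have "gcomp G \<delta> (gdom G \<delta>) \<in> set_comp G U W"
          unfolding set_comp_def using \<delta> that ran_dom[OF \<delta>A, symmetric] by blast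
        then show ?thesis
          unfolding V_def using comp_dom[OF \<delta>A] by simp
      qed
      assume "gran G \<delta> \<in> V"
      then obtain \<beta> \<rho> where b: "\<beta> \<in> U" "\<rho> \<in> W" "gdom G \<beta> = gran G \<rho>"
        "gran G \<delta> = gran G (gcomp G \<beta> \<rho>)"
        by (auto simp: V_def set_comp_def)
      have A: "\<beta> \<in> arrows G" "\<rho> \<in> arrows G" and \<rho>: "\<rho> \<in> units G"
        using b cob_subset[OF U] W(2) unit_closed by auto
      have "gran G \<delta> = gran G \<beta>" using b(4) ran_comp[OF A b(3)] by simp
      moreover have "inj_on (gran G) U" using U by (simp add: cob_def bisection_def)
      ultimately have "\<delta> = \<beta>" using \<delta> b(1) by (simp add: inj_on_eq_iff)
      then show "gdom G \<delta> \<in> W" using b(2,3) ran_unit[OF \<rho>] by simp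
    qed
    have VR: "chi V \<in> carrier R" and WR: "chi W \<in> carrier R"
      using V(1) W(1) by (auto intro: chi_in_Gamma)
    have "chi V \<star> s = s \<star> chi W"
    proof (rule secs_ext[OF Gamma_secs[OF Gamma.m_closed[OF VR sR]] Gamma_secs[OF Gamma.m_closed[OF sR WR]]])
      fix \<delta> assume \<delta>: "\<delta> \<in> arrows G"
      show "(chi V \<star> s) \<delta> = (s \<star> chi W) \<delta>"
      proof (cases "\<delta> \<in> U")
        case True
        then show ?thesis
          using chi_mult_apply[OF V(2) ss \<delta>] mult_chi_apply[OF W(2) sf \<delta>] inV by simp
      next
        case False
        then show ?thesis
          using chi_mult_apply[OF V(2) ss \<delta>] mult_chi_apply[OF W(2) sf \<delta>] sz[of \<delta>] \<delta> by simp
      qed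
    qed
    then have "chi V \<odot>\<^bsub>M\<^esub> (s \<odot>\<^bsub>M\<^esub> m) = s \<odot>\<^bsub>M\<^esub> (chi W \<odot>\<^bsub>M\<^esub> m)"
      using M.smult_assoc[OF VR sR m] M.smult_assoc[OF sR WR m] by simp
    then have "chi V \<odot>\<^bsub>M\<^esub> (s \<odot>\<^bsub>M\<^esub> m) = \<zero>\<^bsub>M\<^esub>"
      using W(4) M.smult_zero[OF sR] by simp
    moreover have "y \<in> V"
      using inV[OF \<gamma>(1)] W(3) \<gamma>(2) by simp
    ultimately show ?thesis
      unfolding germ_zero_def using V by blast
  next
    case False
    \<comment> \<open>The ranges of \<open>U\<close> form a compact set in a Hausdorff space, so a
      whole neighbourhood of \<open>y\<close> avoids them.\<close>
    have "closedin (unit_top G) (gran G ` U)"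
      using cob_ran[OF U] by (intro closedin_compact_units) (simp add: cob_units_iff)
    then have "openin (unit_top G) (units G - gran G ` U)"
      by (simp add: closedin_def topspace_unit_top)
    then obtain V where V: "cob G V" "y \<in> V" "V \<subseteq> units G - gran G ` U"
      using cob_unit_nbhd[of "units G - gran G ` U" y] yU False by blast
    have VU: "V \<subseteq> units G" using V(3) by blast
    have VR: "chi V \<in> carrier R" using V(1) by (rule chi_in_Gamma)
    have "chi V \<star> s = \<zero>\<^bsub>R\<^esub>"
    proof (rule secs_ext[OF Gamma_secs[OF Gamma.m_closed[OF VR sR]] zero_in_secs])
      fix \<delta> assume \<delta>: "\<delta> \<in> arrows G"
      show "(chi V \<star> s) \<delta> = \<zero>\<^bsub>R\<^esub> \<delta>"
      proof (cases "\<delta> \<in> U")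
        case True
        then have "gran G \<delta> \<notin> V" using V(3) by blast
        then show ?thesis
          using chi_mult_apply[OF VU ss \<delta>] \<delta> by (simp add: zero_apply)
      next
        case False
        then show ?thesis
          using chi_mult_apply[OF VU ss \<delta>] sz[of \<delta>] \<delta> by (simp add: zero_apply)
      qed
    qed
    then have "chi V \<odot>\<^bsub>M\<^esub> (s \<odot>\<^bsub>M\<^esub> m) = \<zero>\<^bsub>M\<^esub>"
      using M.smult_assoc[OF VR sR m] M.zero_smult[OF m] by simp
    then show ?thesis
      unfolding germ_zero_def using V(1,2) VU by blast
  qed
qed

text \<open>Closure under the ring holds because a bisection section moves germs only within an
  orbit, by \<open>germ_zero_bis_smult\<close>. Sums use the intersection of the two
  neighbourhoods.\<close>

lemma submodule_germs_zero:
  assumes M: "left_module R M"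
  shows "submodule {m \<in> carrier M. \<forall>y\<in>orbit G x. germ_zero M m y} R M" (is "submodule ?N R M")
proof -
  interpret M: left_module R M by (rule M)
  have zero: "\<zero>\<^bsub>M\<^esub> \<in> ?N"
  proof -
    have "germ_zero M \<zero>\<^bsub>M\<^esub> y" if "y \<in> orbit G x" for y
    proof -
      have "openin (unit_top G) (units G)"
        using openin_topspace[of "unit_top G"] by (simp add: topspace_unit_top)
      moreover have "y \<in> units G" using that orbit_subset by blast
      ultimately obtain V where V: "cob G V" "y \<in> V" "V \<subseteq> units G"
        by (rule cob_unit_nbhd)
      then show ?thesis
        unfolding germ_zero_def using M.smult_zero[OF chi_in_Gamma[OF V(1)]] by blast
    qed
    then show ?thesis by simp
  qed
  have add: "m \<oplus>\<^bsub>M\<^esub> n \<in> ?N" if m: "m \<in> ?N" and n: "n \<in> ?N" for m n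
  proof -
    have mM: "m \<in> carrier M" and nM: "n \<in> carrier M" using m n by auto
    have "germ_zero M (m \<oplus>\<^bsub>M\<^esub> n) y" if y: "y \<in> orbit G x" for y
    proof -
      have "germ_zero M m y" "germ_zero M n y" using m n y by auto
      then obtain V W where V: "cob G V" "V \<subseteq> units G" "y \<in> V" "chi V \<odot>\<^bsub>M\<^esub> m = \<zero>\<^bsub>M\<^esub>"
        and W: "cob G W" "W \<subseteq> units G" "y \<in> W" "chi W \<odot>\<^bsub>M\<^esub> n = \<zero>\<^bsub>M\<^esub>"
        unfolding germ_zero_def by blast
      have I: "cob G (V \<inter> W)" using V W by (intro cob_Int)
      note IR = chi_in_Gamma[OF I] and VR = chi_in_Gamma[OF V(1)] and WR = chi_in_Gamma[OF W(1)]
      have "chi (V \<inter> W) \<odot>\<^bsub>M\<^esub> m = chi (V \<inter> W) \<odot>\<^bsub>M\<^esub> (chi V \<odot>\<^bsub>M\<^esub> m)"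
        using M.smult_assoc[OF IR VR mM] chi_mult_chi[OF V(2) Int_lower1] by simp
      moreover have "chi (V \<inter> W) \<odot>\<^bsub>M\<^esub> n = chi (V \<inter> W) \<odot>\<^bsub>M\<^esub> (chi W \<odot>\<^bsub>M\<^esub> n)"
        using M.smult_assoc[OF IR WR nM] chi_mult_chi[OF W(2) Int_lower2] by simp
      ultimately have "chi (V \<inter> W) \<odot>\<^bsub>M\<^esub> (m \<oplus>\<^bsub>M\<^esub> n) = \<zero>\<^bsub>M\<^esub>"
        using V(4) W(4) M.smult_zero[OF IR] by (simp add: M.smult_r_distr[OF IR mM nM])
      moreover have "V \<inter> W \<subseteq> units G" "y \<in> V \<inter> W" using V W by auto
      ultimately show ?thesis
        unfolding germ_zero_def using I by blast
    qed
    then show ?thesis using mM nM by simp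
  qed
  show ?thesis
  proof (rule M.submoduleI)
    show "?N \<subseteq> carrier M" by blast
    show "\<zero>\<^bsub>M\<^esub> \<in> ?N" by (rule zero)
    show "m \<oplus>\<^bsub>M\<^esub> n \<in> ?N" if "m \<in> ?N" "n \<in> ?N" for m n using that by (rule add)
    show "\<ominus>\<^bsub>M\<^esub> m \<in> ?N" if m: "m \<in> ?N" for m
    proof -
      have mM: "m \<in> carrier M" using m by blast
      have "germ_zero M (\<ominus>\<^bsub>M\<^esub> m) y" if y: "germ_zero M m y" for y
      proof -
        obtain V where V: "cob G V" "V \<subseteq> units G" "y \<in> V" "chi V \<odot>\<^bsub>M\<^esub> m = \<zero>\<^bsub>M\<^esub>"
          using y unfolding germ_zero_def by blast
        then have "chi V \<odot>\<^bsub>M\<^esub> (\<ominus>\<^bsub>M\<^esub> m) = \<zero>\<^bsub>M\<^esub>"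
          using M.smult_minus[OF chi_in_Gamma[OF V(1)] mM] by simp
        then show ?thesis unfolding germ_zero_def using V by blast
      qed
      then show ?thesis using m by simp
    qed
    show "a \<odot>\<^bsub>M\<^esub> m \<in> ?N" if a: "a \<in> carrier R" and m: "m \<in> ?N" for a m
      using a
    proof (induction rule: Gamma_induct)
      case zero
      have "\<zero>\<^bsub>R\<^esub> \<odot>\<^bsub>M\<^esub> m = \<zero>\<^bsub>M\<^esub>" using m by (intro M.zero_smult) blast
      then show ?case
        using \<open>\<zero>\<^bsub>M\<^esub> \<in> ?N\<close> by simp
    next
      case (bis U s)
      have mM: "m \<in> carrier M" and z: "\<And>y. y \<in> orbit G x \<Longrightarrow> germ_zero M m y" using m by auto
      show ?case
        using germ_zero_bis_smult[OF M mM bis _ z] M.smult_closed[OF bis_in_Gamma[OF bis] mM] by blast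
    next
      case (add f g)
      have mM: "m \<in> carrier M" using m by blast
      show ?case
        using \<open>\<And>n m. m \<in> ?N \<Longrightarrow> n \<in> ?N \<Longrightarrow> m \<oplus>\<^bsub>M\<^esub> n \<in> ?N\<close>[OF add.IH(1,2)]
        unfolding M.smult_l_distr[OF add.hyps mM] .
    qed
  qed
qed

end

section \<open>Ideals and dense orbits\<close>

context gsheaf_of_fields
begin

lemma stalk_one_not_zero: "x \<in> units G \<Longrightarrow> \<one>\<^bsub>stalk S x\<^esub> \<noteq> \<zero>\<^bsub>stalk S x\<^esub>"
proof -
  assume "x \<in> units G"
  then interpret field "stalk S x" by (rule field_stalk)
  show ?thesis by (rule one_not_zero)
qed

lemma unit_values: "\<lbrakk>f \<in> secs; x \<in> units G\<rbrakk> \<Longrightarrow> f x \<in> carrier (stalk S x)"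
  using secs_apply[of f x] unit_closed ran_unit by simp

text \<open>Both products are pointwise on the unit space, and the stalks are commutative.\<close>

lemma diagonals_commute:
  assumes a: "diagonal a" and b: "diagonal b"
  shows "a \<star> b = b \<star> a"
proof (rule secs_ext)
  have as: "a \<in> secs" and bs: "b \<in> secs" using a b by (auto simp: diagonal_def)
  show "a \<star> b \<in> secs" "b \<star> a \<in> secs"
    using mult_in_secs[OF diagonal_finsec] a b as bs by auto
  fix \<gamma> assume \<gamma>: "\<gamma> \<in> arrows G"
  let ?T = "stalk S (gran G \<gamma>)"
  have x: "gran G \<gamma> \<in> units G" using \<gamma> by (rule ran_in_units)
  interpret field ?T using x by (rule field_stalk)
  note v = secs_apply[OF as \<gamma>] secs_apply[OF bs \<gamma>] unit_values[OF as x] unit_values[OF bs x]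
  show "(a \<star> b) \<gamma> = (b \<star> a) \<gamma>"
  proof (cases "\<gamma> \<in> units G")
    case True
    then have "gran G \<gamma> = \<gamma>" by (rule ran_unit)
    then show ?thesis
      using diagonal_mult_apply[OF a bs \<gamma>] diagonal_mult_apply[OF b as \<gamma>] v m_comm by simp
  next
    case False
    then have "a \<gamma> = \<zero>\<^bsub>?T\<^esub>" "b \<gamma> = \<zero>\<^bsub>?T\<^esub>"
      using a b \<gamma> by (auto simp: diagonal_def)
    then show ?thesis
      using diagonal_mult_apply[OF a bs \<gamma>] diagonal_mult_apply[OF b as \<gamma>] v by simp
  qed
qed

text \<open>The inverse of a nonzero germ extends to a local section that stays inverse nearby.\<close>

lemma openin_nonzero:
  assumes a: "continuous_map (unit_top G) (total S) a" "\<And>x. x \<in> units G \<Longrightarrow> a x \<in> carrier (stalk S x)"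
  shows "openin (unit_top G) {x \<in> units G. a x \<noteq> \<zero>\<^bsub>stalk S x\<^esub>}"
proof (subst openin_subopen, intro ballI)
  fix x assume "x \<in> {x \<in> units G. a x \<noteq> \<zero>\<^bsub>stalk S x\<^esub>}"
  then have x: "x \<in> units G" "a x \<noteq> \<zero>\<^bsub>stalk S x\<^esub>" by auto
  interpret x: field "stalk S x" using x(1) by (rule field_stalk)
  have "a x \<in> Units (stalk S x)"
    using x a(2) x.field_Units by blast
  then obtain c where c: "c \<in> carrier (stalk S x)" "a x \<otimes>\<^bsub>stalk S x\<^esub> c = \<one>\<^bsub>stalk S x\<^esub>"
    by (auto simp: Units_def)
  have ctot: "c \<in> topspace (total S)" and pc: "proj S c = x"
    using c(1) by (auto simp: in_stalk_iff)
  obtain N q where N: "openin (unit_top G) N" "proj S c \<in> N"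
    and q: "continuous_map (subtopology (unit_top G) N) (total S) q"
    and qs: "\<And>y. y \<in> N \<Longrightarrow> q y \<in> topspace (total S) \<and> proj S (q y) = y" "q (proj S c) = c"
    using local_section[OF ctot] by metis
  have NU: "N \<subseteq> units G" using N(1) by (simp add: openin_unit_top)
  have tN: "topspace (subtopology (unit_top G) N) = N"
    using NU by (simp add: topspace_unit_top inf_absorb2)
  have qst: "q y \<in> carrier (stalk S y)" if "y \<in> N" for y
    using qs(1)[OF that] by (simp add: in_stalk_iff)
  have aN: "continuous_map (subtopology (unit_top G) N) (total S) a"
    using a(1) by (rule continuous_map_from_subtopology)
  let ?T = "{y \<in> N. fmult S (a y) (q y) = fone S y}"
  have "openin (subtopology (unit_top G) N)
    {y \<in> topspace (subtopology (unit_top G) N). fmult S (a y) (q y) = fone S y}"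
  proof (rule local_homeomorphism_agree[OF local_homeomorphism_proj])
    show "continuous_map (subtopology (unit_top G) N) (total S) (\<lambda>y. fmult S (a y) (q y))"
    proof (rule continuous_map_fmult[OF aN q])
      fix y assume "y \<in> topspace (subtopology (unit_top G) N)"
      then have "y \<in> N" "y \<in> units G" using tN NU by auto
      then show "proj S (a y) = proj S (q y)"
        using a(2) qst by (simp add: in_stalk_iff)
    qed
    show "continuous_map (subtopology (unit_top G) N) (total S) (fone S)"
      by (rule continuous_map_from_subtopology[OF continuous_fone])
    fix y assume "y \<in> topspace (subtopology (unit_top G) N)"
    then have y: "y \<in> N" "y \<in> units G" using tN NU by auto
    interpret field "stalk S y" using y(2) by (rule field_stalk)
    have "fmult S (a y) (q y) \<in> carrier (stalk S y)"
      using a(2)[OF y(2)] qst[OF y(1)] by (simp add: stalk_simps[of y])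
    then show "proj S (fmult S (a y) (q y)) = proj S (fone S y)"
      using fone_closed[OF y(2)] by (simp add: in_stalk_iff)
  qed
  then have "openin (subtopology (unit_top G) N) ?T"
    unfolding tN .
  then have T: "openin (unit_top G) ?T"
    using N(1) by (rule openin_trans_full)
  have "x \<in> ?T"
    using N(2) qs(2) c(2) pc by (simp add: stalk_simps[of x])
  moreover have "?T \<subseteq> {x \<in> units G. a x \<noteq> \<zero>\<^bsub>stalk S x\<^esub>}"
  proof
    fix y assume "y \<in> ?T"
    then have y: "y \<in> N" "y \<in> units G" "a y \<otimes>\<^bsub>stalk S y\<^esub> q y = \<one>\<^bsub>stalk S y\<^esub>"
      using NU by (auto simp: stalk_simps[of y])
    interpret field "stalk S y" using y(2) by (rule field_stalk)
    have "a y \<noteq> \<zero>\<^bsub>stalk S y\<^esub>"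
    proof
      assume "a y = \<zero>\<^bsub>stalk S y\<^esub>"
      then have "\<zero>\<^bsub>stalk S y\<^esub> = \<one>\<^bsub>stalk S y\<^esub>"
        using y(3) qst[OF y(1)] by simp
      then show False using stalk_one_not_zero[OF y(2)] by simp
    qed
    then show "y \<in> {x \<in> units G. a x \<noteq> \<zero>\<^bsub>stalk S x\<^esub>}" using y(2) by blast
  qed
  ultimately show "\<exists>T. openin (unit_top G) T \<and> x \<in> T \<and> T \<subseteq> {x \<in> units G. a x \<noteq> \<zero>\<^bsub>stalk S x\<^esub>}"
    using T by blast
qed

text \<open>A local section through \<open>e\<close>, cut off to a compact open set of units and
  extended by zero. It will supply a ring element whose value at a unit is a prescribed
  inverse.\<close>

lemma exists_diagonal_value:
  assumes x: "x \<in> units G" and e: "e \<in> carrier (stalk S x)"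
  obtains c where "c \<in> carrier R" "diagonal c" "c x = e"
proof -
  have etot: "e \<in> topspace (total S)" and pe: "proj S e = x"
    using e by (auto simp: in_stalk_iff)
  obtain N q where N: "openin (unit_top G) N" "proj S e \<in> N"
    and q: "continuous_map (subtopology (unit_top G) N) (total S) q"
    and qs: "\<And>y. y \<in> N \<Longrightarrow> q y \<in> topspace (total S) \<and> proj S (q y) = y" "q (proj S e) = e"
    using local_section[OF etot] by metis
  have NU: "N \<subseteq> units G" using N(1) by (simp add: openin_unit_top)
  obtain V where V: "cob G V" "proj S e \<in> V" "V \<subseteq> N"
    using N(1,2) by (rule cob_unit_nbhd)
  have VU: "V \<subseteq> units G" using V(3) NU by blast
  define c where "c = (\<lambda>\<gamma>\<in>arrows G. if \<gamma> \<in> V then q \<gamma> else \<zero>\<^bsub>stalk S (gran G \<gamma>)\<^esub>)"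
  have cs: "c \<in> secs"
    unfolding secs_iff
  proof (intro conjI ballI)
    show "c \<in> extensional (arrows G)" by (simp add: c_def)
    fix \<gamma> assume \<gamma>: "\<gamma> \<in> arrows G"
    interpret ring "stalk S (gran G \<gamma>)" using \<gamma> by (rule ring_at)
    have "q \<gamma> \<in> carrier (stalk S (gran G \<gamma>))" if "\<gamma> \<in> V"
    proof -
      have "\<gamma> \<in> N" "\<gamma> \<in> units G" using that V(3) VU by blast+
      then show ?thesis using qs(1) by (simp add: in_stalk_iff ran_unit)
    qed
    then show "c \<gamma> \<in> carrier (stalk S (gran G \<gamma>))"
      using \<gamma> by (simp add: c_def)
  qed
  have "subtopology (arrow_top G) V = subtopology (unit_top G) V"
    unfolding unit_top_def subtopology_subtopology using VU by (simp add: inf_absorb2)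
  moreover have "continuous_map (subtopology (unit_top G) V) (total S) q"
    using q V(3) by (rule continuous_map_from_subtopology_mono)
  ultimately have "continuous_map (subtopology (arrow_top G) V) (total S) q" by simp
  then have "continuous_map (subtopology (arrow_top G) V) (total S) c"
  proof (rule continuous_map_eq)
    fix \<gamma> assume "\<gamma> \<in> topspace (subtopology (arrow_top G) V)"
    then show "q \<gamma> = c \<gamma>" by (auto simp: c_def arrows_def)
  qed
  then have bis: "bis_section V c"
    using cs V(1) by (simp add: bis_section_def c_def)
  show thesis
  proof (rule that)
    show "c \<in> carrier R" using bis by (rule bis_in_Gamma)
    show "diagonal c" using bis VU by (rule diagonal_bis_section)
    show "c x = e" using V(2) qs(2) pe x unit_closed by (simp add: c_def)
  qed
qed

text \<open>Take a nonzero element of the ideal that is a sum of as few bisection sections as possible,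
  and translate one summand into the diagonal. Commutators with the diagonal kill this summand, so
  they vanish by minimality, and the element is diagonal by maximality.\<close>

lemma ideal_meets_diagonal:
  assumes max: "maximal_comm_subrng (Gamma_c_units G S) R"
    and I: "I \<subseteq> carrier R"
    and l: "\<And>a f. \<lbrakk>a \<in> carrier R; f \<in> I\<rbrakk> \<Longrightarrow> a \<star> f \<in> I"
    and r: "\<And>a f. \<lbrakk>a \<in> carrier R; f \<in> I\<rbrakk> \<Longrightarrow> f \<star> a \<in> I"
    and m: "\<And>f g. \<lbrakk>f \<in> I; g \<in> I\<rbrakk> \<Longrightarrow> f \<ominus>\<^bsub>R\<^esub> g \<in> I"
    and f0: "f0 \<in> I" "f0 \<noteq> \<zero>\<^bsub>R\<^esub>"
  obtains h where "h \<in> I" "h \<in> Gamma_c_units G S" "h \<noteq> \<zero>\<^bsub>R\<^esub>"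
proof -
  \<comment> \<open>Minimality is taken over all nonzero elements of the ideal at once, so that a
    commutator, which is another element of the ideal, can be compared with
    \<open>f\<close>.\<close>
  define P where "P n \<longleftrightarrow> (\<exists>f\<in>I. f \<noteq> \<zero>\<^bsub>R\<^esub> \<and> f \<in> spans n)" for n
  have "\<exists>n. P n" using Gamma_spans[of f0] f0 I unfolding P_def by blast
  define n where "n = (LEAST n. P n)"
  have "P n" unfolding n_def using \<open>\<exists>n. P n\<close> by (rule LeastI_ex)
  have least: "\<not> P k" if "k < n" for k using that unfolding n_def by (rule not_less_Least)
  obtain f where f: "f \<in> I" "f \<noteq> \<zero>\<^bsub>R\<^esub>" "f \<in> spans n" using \<open>P n\<close> unfolding P_def by blast
  have fR: "f \<in> carrier R" using f(1) I by blast
  obtain \<gamma> where \<gamma>: "\<gamma> \<in> arrows G" "f \<gamma> \<noteq> \<zero>\<^bsub>stalk S (gran G \<gamma>)\<^esub>"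
    using secs_ext[OF Gamma_secs[OF fR] zero_in_secs] f(2) zero_apply by metis
  obtain k U s g where s: "n = Suc k" "bis_section U s" "g \<in> spans k" "f = s \<oplus>\<^bsub>R\<^esub> g"
    "s \<gamma> \<noteq> \<zero>\<^bsub>stalk S (gran G \<gamma>)\<^esub>"
    using spans_pick[OF f(3) \<gamma>] by (elim exE conjE)
  have U: "cob G U" and \<gamma>U: "\<gamma> \<in> U"
    using s(2,5) \<gamma>(1) by (auto simp: bis_section_def)
  have U': "cob G (ginv G ` U)" using U by (rule cob_inv)
  \<comment> \<open>The summand \<open>s\<close> lives on \<open>U\<close>, so
    \<open>s \<star> ?t\<close> lives on the product of \<open>U\<close> with its inverse, which
    consists of units.\<close>
  let ?t = "chi (ginv G ` U)"
  note t = bis_section_chi[OF U']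
  have tR: "?t \<in> carrier R" using t by (rule bis_in_Gamma)
  have sR: "s \<in> carrier R" and gR: "g \<in> carrier R"
    using bis_in_Gamma[OF s(2)] spans_subset[OF s(3)] by auto
  define h where "h = f \<star> ?t"
  have hI: "h \<in> I" unfolding h_def using tR f(1) by (rule r)
  have hR: "h \<in> carrier R" using hI I by blast
  have h_eq: "h = s \<star> ?t \<oplus>\<^bsub>R\<^esub> g \<star> ?t"
    unfolding h_def s(4) using sR gR tR by (rule Gamma.l_distr)
  \<comment> \<open>Translation does not destroy the element: the value of \<open>f\<close> at
    \<gamma> reappears as the value of \<open>h\<close> at the range of \<gamma>.\<close>
  have "h (gran G \<gamma>) = f (gcomp G (gran G \<gamma>) (ginv G (ginv G \<gamma>)))"
    unfolding h_def
  proof (rule mult_chi_bisection_apply[OF U' Gamma_finsec[OF fR] imageI[OF \<gamma>U]])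
    show "gran G \<gamma> \<in> arrows G" "gdom G (gran G \<gamma>) = gdom G (ginv G \<gamma>)"
      using \<gamma>(1) dom_unit[OF ran_in_units] by (auto simp: ran_closed dom_inv)
  qed
  also have "\<dots> = f \<gamma>"
    using \<gamma>(1) by (simp add: inv_inv ran_comp_left)
  finally have "h (gran G \<gamma>) \<noteq> \<zero>\<^bsub>stalk S (gran G \<gamma>)\<^esub>"
    using \<gamma>(2) by simp
  moreover have "\<zero>\<^bsub>R\<^esub> (gran G \<gamma>) = \<zero>\<^bsub>stalk S (gran G \<gamma>)\<^esub>"
    using zero_apply[OF ran_closed[OF \<gamma>(1)]] ran_unit[OF ran_in_units[OF \<gamma>(1)]] by simp
  ultimately have h0: "h \<noteq> \<zero>\<^bsub>R\<^esub>" by metis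
  have st: "diagonal (s \<star> ?t)"
    using bis_section_mult[OF s(2) t] set_comp_inv_units[OF U] by (rule diagonal_bis_section)
  have stR: "s \<star> ?t \<in> carrier R" and gtR: "g \<star> ?t \<in> carrier R"
    using sR gR tR by (auto intro: Gamma.m_closed)
  have "h \<in> Gamma_c_units G S"
  proof (rule Gamma.in_maximal_comm_subrngI[OF max hR])
    fix b assume b: "b \<in> Gamma_c_units G S"
    have "subgroup (Gamma_c_units G S) (add_monoid R)"
      using max by (simp add: maximal_comm_subrng_def comm_subrng_def)
    then have bR: "b \<in> carrier R"
      using b subgroup.subset by fastforce
    note bd = Gamma_units_diagonal[OF b bR]
    let ?c = "b \<star> h \<ominus>\<^bsub>R\<^esub> h \<star> b"
    let ?gt = "g \<star> ?t"
    have gtc: "b \<star> ?gt \<ominus>\<^bsub>R\<^esub> ?gt \<star> b \<in> spans k"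
      using spans_commutator[OF bd bR spans_mult_bis[OF t s(3)]] .
    have "?c = (b \<star> (s \<star> ?t) \<ominus>\<^bsub>R\<^esub> (s \<star> ?t) \<star> b) \<oplus>\<^bsub>R\<^esub>
        (b \<star> ?gt \<ominus>\<^bsub>R\<^esub> ?gt \<star> b)"
      unfolding h_eq using bR stR gtR by (rule commutator_add)
    also have "b \<star> (s \<star> ?t) \<ominus>\<^bsub>R\<^esub> (s \<star> ?t) \<star> b = \<zero>\<^bsub>R\<^esub>"
      unfolding diagonals_commute[OF bd(1) st] using Gamma.m_closed[OF stR bR]
      by (simp add: Gamma.minus_eq Gamma.r_neg)
    also have "\<zero>\<^bsub>R\<^esub> \<oplus>\<^bsub>R\<^esub> (b \<star> ?gt \<ominus>\<^bsub>R\<^esub> ?gt \<star> b) = b \<star> ?gt \<ominus>\<^bsub>R\<^esub> ?gt \<star> b"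
      using spans_subset[OF gtc] by (rule Gamma.l_zero)
    finally have "?c \<in> spans k" using gtc by simp
    moreover have "?c \<in> I"
      using l[OF bR hI] r[OF bR hI] by (rule m)
    ultimately have "?c = \<zero>\<^bsub>R\<^esub>"
      using least[of k] s(1) unfolding P_def by blast
    then show "b \<star> h = h \<star> b"
      using Gamma.minus_eq_zeroD[OF Gamma.m_closed[OF bR hR] Gamma.m_closed[OF hR bR]] by simp
  qed
  with hI h0 that show thesis by blast
qed

lemma dense_orbitD:
  assumes "unit_top G closure_of orbit G x = units G" "openin (unit_top G) V" "V \<noteq> {}"
  obtains \<gamma> where "\<gamma> \<in> arrows G" "gdom G \<gamma> = x" "gran G \<gamma> \<in> V"
proof -
  obtain y where y: "y \<in> V" using assms(3) by blast
  then have "y \<in> unit_top G closure_of orbit G x"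
    using assms(1,2) by (auto simp: openin_unit_top)
  then obtain z where "z \<in> orbit G x" "z \<in> V"
    using assms(2) y by (auto simp: in_closure_of)
  then show thesis
    using that by (auto simp: orbit_def)
qed

section \<open>From a dense orbit to a faithful simple module\<close>

lemma dense_orbit_imp_left_primitive:
  assumes max: "maximal_comm_subrng (Gamma_c_units G S) R"
    and x: "x \<in> units G" and dense: "unit_top G closure_of orbit G x = units G"
  shows "left_primitive R"
proof -
  have xA: "x \<in> arrows G" using x by (rule unit_closed)
  interpret x: field "stalk S x" using x by (rule field_stalk)
  \<comment> \<open>The kernel of restriction to the arrows with domain \<open>x\<close>. It is a
    left ideal because in a factorisation of an arrow the right factor has the same domain as the
    arrow.\<close>
  define J where "J = {f \<in> carrier R. \<forall>\<gamma>\<in>arrows G. gdom G \<gamma> = x \<longrightarrow> f \<gamma> = \<zero>\<^bsub>stalk S (gran G \<gamma>)\<^esub>}"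
  have "openin (unit_top G) (units G)"
    using openin_topspace[of "unit_top G"] by (simp add: topspace_unit_top)
  then obtain K where K: "cob G K" "x \<in> K" "K \<subseteq> units G"
    using cob_unit_nbhd[of "units G" x] x by blast
  define e where "e = chi K"
  have eR: "e \<in> carrier R" unfolding e_def using K(1) by (rule chi_in_Gamma)
  have ed: "diagonal e" unfolding e_def using K(3) by (rule diagonal_chi)
  have ex: "e x = \<one>\<^bsub>stalk S x\<^esub>"
    using xA K(2) ran_unit[OF x] by (simp add: e_def chi_apply)
  have J: "left_ideal R J"
  proof (intro left_ideal.intro left_ideal_axioms.intro Gamma.nonunital_ring_axioms)
    show "subgroup J (add_monoid R)"
    proof (rule Gamma.add.subgroupI)
      have "\<zero>\<^bsub>R\<^esub> \<in> J" by (simp add: J_def zero_apply)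
      then show "J \<noteq> {}" by blast
    next
      fix f assume f: "f \<in> J"
      have "neg f \<gamma> = \<zero>\<^bsub>stalk S (gran G \<gamma>)\<^esub>" if \<gamma>: "\<gamma> \<in> arrows G" "gdom G \<gamma> = x" for \<gamma>
      proof -
        interpret ring "stalk S (gran G \<gamma>)" using \<gamma>(1) by (rule ring_at)
        show ?thesis using f \<gamma> by (simp add: neg_apply J_def)
      qed
      then show "\<ominus>\<^bsub>R\<^esub> f \<in> J"
        using f Gamma_neg[of f] Gamma.a_inv_closed[of f] by (simp add: J_def)
      fix g assume g: "g \<in> J"
      have "(f \<oplus>\<^bsub>R\<^esub> g) \<gamma> = \<zero>\<^bsub>stalk S (gran G \<gamma>)\<^esub>" if \<gamma>: "\<gamma> \<in> arrows G" "gdom G \<gamma> = x" for \<gamma>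
      proof -
        interpret ring "stalk S (gran G \<gamma>)" using \<gamma>(1) by (rule ring_at)
        show ?thesis using f g \<gamma> by (simp add: add_apply J_def)
      qed
      then show "f \<oplus>\<^bsub>R\<^esub> g \<in> J"
        using f g by (simp add: J_def)
    qed (auto simp: J_def)
    fix a f assume a: "a \<in> carrier R" and f: "f \<in> J"
    have fR: "f \<in> carrier R" using f by (simp add: J_def)
    have "(a \<star> f) \<gamma> = \<zero>\<^bsub>stalk S (gran G \<gamma>)\<^esub>" if \<gamma>: "\<gamma> \<in> arrows G" "gdom G \<gamma> = x" for \<gamma>
    proof (rule mult_apply_zero[OF Gamma_finsec[OF a] Gamma_secs[OF fR] \<gamma>(1)])
      fix \<delta> assume d: "\<delta> \<in> arrows G" "gran G \<delta> = gran G \<gamma>"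
      have "f (gcomp G (ginv G \<delta>) \<gamma>) = \<zero>\<^bsub>stalk S (gdom G \<delta>)\<^esub>"
        using f inv_comp[OF d(1) \<gamma>(1) d(2)] \<gamma>(2) by (simp add: J_def)
      then show "a \<delta> = \<zero>\<^bsub>stalk S (gran G \<gamma>)\<^esub> \<or> f (gcomp G (ginv G \<delta>) \<gamma>) = \<zero>\<^bsub>stalk S (gdom G \<delta>)\<^esub>" ..
    qed
    then show "a \<star> f \<in> J"
      using a fR by (simp add: J_def Gamma.m_closed)
  qed
  have "e \<notin> J"
    using ex stalk_one_not_zero[OF x] xA dom_unit[OF x] ran_unit[OF x] by (auto simp: J_def)
  with J obtain L where L: "left_ideal R L" "J \<subseteq> L" "e \<notin> L"
    and maxL: "\<And>K. left_ideal R K \<Longrightarrow> L \<subseteq> K \<Longrightarrow> e \<notin> K \<Longrightarrow> K = L"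
    using Gamma.exists_maximal_left_ideal_avoiding by metis
  interpret L: left_ideal R L by (rule L(1))
  \<comment> \<open>\<open>f\<close> and \<open>f \<star> e\<close> agree at every arrow with domain
    \<open>x\<close>, since \<open>x \<in> K\<close>. So a left ideal above \<open>L\<close> that
    contains \<open>e\<close> is everything, and maximality among those avoiding \<open>e\<close>
    becomes maximality among proper left ideals.\<close>
  have full: "H = carrier R" if H: "left_ideal R H" "L \<subseteq> H" "e \<in> H" for H
  proof (intro equalityI subsetI)
    interpret H: left_ideal R H by (rule H(1))
    show "f \<in> carrier R" if "f \<in> H" for f using that H.L_subset by blast
    fix f assume f: "f \<in> carrier R"
    have fe: "f \<star> e \<in> carrier R" using f eR by (rule Gamma.m_closed)
    have "(f \<ominus>\<^bsub>R\<^esub> f \<star> e) \<gamma> = \<zero>\<^bsub>stalk S (gran G \<gamma>)\<^esub>" if \<gamma>: "\<gamma> \<in> arrows G" "gdom G \<gamma> = x" for \<gamma>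
    proof -
      interpret ring "stalk S (gran G \<gamma>)" using \<gamma>(1) by (rule ring_at)
      have "(f \<star> e) \<gamma> = f \<gamma>"
        using mult_chi_apply[OF K(3) Gamma_finsec[OF f] \<gamma>(1)] \<gamma>(2) K(2) by (simp add: e_def)
      then show ?thesis
        using minus_apply[OF f fe \<gamma>(1)] secs_apply[OF Gamma_secs[OF f] \<gamma>(1)]
        by (simp add: minus_eq r_neg)
    qed
    then have "f \<ominus>\<^bsub>R\<^esub> f \<star> e \<in> J"
      using f fe by (simp add: J_def)
    then have 1: "f \<ominus>\<^bsub>R\<^esub> f \<star> e \<in> H" using L(2) H(2) by blast
    have 2: "f \<star> e \<in> H" using f H(3) by (rule H.l_mult_closed)
    have "(f \<ominus>\<^bsub>R\<^esub> f \<star> e) \<oplus>\<^bsub>R\<^esub> f \<star> e = f"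
      using f fe by (simp add: Gamma.minus_eq Gamma.a_assoc Gamma.l_neg)
    then show "f \<in> H" using H.add_in[OF 1 2] by simp
  qed
  have ee: "e \<star> e = e"
  proof (rule secs_ext)
    show "e \<star> e \<in> secs" "e \<in> secs"
      using Gamma_secs eR Gamma.m_closed by blast+
    fix \<gamma> assume "\<gamma> \<in> arrows G"
    then show "(e \<star> e) \<gamma> = e \<gamma>"
      using chi_mult_apply[OF K(3) Gamma_secs[OF eR]] K(3) ran_unit by (auto simp: e_def chi_apply)
  qed
  have simple: "simple_left_module R L.quotient_module"
  proof (rule L.simple_quotient[OF eR eR])
    show "e \<star> e \<notin> L" using ee L(3) by simp
    show "H = L \<or> H = carrier R" if "left_ideal R H" "L \<subseteq> H" for H
      using maxL full that by blast
  qed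
  let ?M = "L.quotient_module"
  interpret M: left_module R ?M by (rule L.left_module_quotient)
  define I where "I = {a \<in> carrier R. \<forall>m\<in>carrier ?M. a \<odot>\<^bsub>?M\<^esub> m = \<zero>\<^bsub>?M\<^esub>}"
  have IR: "I \<subseteq> carrier R" by (auto simp: I_def)
  have Il: "a \<star> f \<in> I" if "a \<in> carrier R" "f \<in> I" for a f
    using that by (simp add: I_def Gamma.m_closed M.smult_assoc M.smult_zero)
  have Ir: "f \<star> a \<in> I" if "a \<in> carrier R" "f \<in> I" for a f
    using that by (simp add: I_def Gamma.m_closed M.smult_assoc M.smult_closed)
  have Im: "f \<ominus>\<^bsub>R\<^esub> g \<in> I" if "f \<in> I" "g \<in> I" for f g
    using that M.minus_smult[of g, symmetric] by (simp add: I_def Gamma.minus_eq M.smult_l_distr)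
  have I0: "f = \<zero>\<^bsub>R\<^esub>" if f: "f \<in> I" for f
  proof (rule ccontr)
    assume "f \<noteq> \<zero>\<^bsub>R\<^esub>"
    then obtain h where h: "h \<in> I" "h \<in> Gamma_c_units G S" "h \<noteq> \<zero>\<^bsub>R\<^esub>"
      using ideal_meets_diagonal[OF max IR Il Ir Im f] by blast
    have hR: "h \<in> carrier R" using h(1) IR by blast
    note hs = Gamma_secs[OF hR]
    note hd = Gamma_units_diagonal[OF h(2) hR]
    define V where "V = {y \<in> units G. h y \<noteq> \<zero>\<^bsub>stalk S y\<^esub>}"
    have V: "openin (unit_top G) V"
      unfolding V_def using hd(2) unit_values[OF hs] by (rule openin_nonzero)
    have "V \<noteq> {}"
    proof
      assume "V = {}"
      have "h = \<zero>\<^bsub>R\<^esub>"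
      proof (rule secs_ext[OF hs zero_in_secs])
        fix \<gamma> assume \<gamma>: "\<gamma> \<in> arrows G"
        show "h \<gamma> = \<zero>\<^bsub>R\<^esub> \<gamma>"
        proof (cases "\<gamma> \<in> units G")
          case True
          then show ?thesis using \<open>V = {}\<close> ran_unit[OF True] \<gamma> by (auto simp: V_def zero_apply)
        next
          case False
          then show ?thesis using hd(1) \<gamma> by (simp add: diagonal_def zero_apply)
        qed
      qed
      then show False using h(3) by simp
    qed
    then obtain \<gamma> where \<gamma>: "\<gamma> \<in> arrows G" "gdom G \<gamma> = x" "gran G \<gamma> \<in> V"
      using dense_orbitD[OF dense V] by blast
    define y where "y = gran G \<gamma>"
    have y: "y \<in> units G" "h y \<noteq> \<zero>\<^bsub>stalk S y\<^esub>" using \<gamma>(3) by (auto simp: V_def y_def)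
    have "openin (arrow_top G) (arrows G)"
      unfolding arrows_def by (rule openin_topspace)
    then obtain U where U: "cob G U" "\<gamma> \<in> U"
      using cob_nbhd[of "arrows G" \<gamma>] \<gamma>(1) by blast
    have U': "cob G (ginv G ` U)" using U(1) by (rule cob_inv)
    let ?s = "chi U" and ?t = "chi (ginv G ` U)"
    have sR: "?s \<in> carrier R" and tR: "?t \<in> carrier R"
      using U(1) U' by (auto intro: chi_in_Gamma)
    \<comment> \<open>The conjugate \<open>b\<close> carries \<open>h\<close> from \<open>y\<close>,
      the range of \<gamma>, back to the domain \<open>x\<close>. It stays in \<open>I\<close>
      because \<open>I\<close> is a two-sided ideal.\<close>
    define k where "k = h \<star> ?s"
    have kI: "k \<in> I" unfolding k_def using sR h(1) by (rule Ir)
    have kR: "k \<in> carrier R" using kI IR by blast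
    define b where "b = ?t \<star> k"
    have bI: "b \<in> I" unfolding b_def using tR kI by (rule Il)
    have bR: "b \<in> carrier R" using bI IR by blast
    have kbis: "bis_section U k"
      unfolding k_def using hd bis_section_chi[OF U(1)] by (rule bis_section_diagonal_mult(1))
    \<comment> \<open>Lets \<open>set_comp_inv_units\<close>, applied to the inverse of
      \<open>U\<close>, show that \<open>b\<close> is supported on units.\<close>
    have "ginv G ` ginv G ` U = U"
      using cob_subset[OF U(1)] inv_inv by (force simp: image_image)
    then have "set_comp G (ginv G ` U) U \<subseteq> units G"
      using set_comp_inv_units[OF U'] by simp
    then have bd: "diagonal b"
      unfolding b_def using bis_section_mult[OF bis_section_chi[OF U'] kbis]
      by (intro diagonal_bis_section)
    have k\<gamma>: "k \<gamma> = h y"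
    proof -
      interpret ring "stalk S (gran G \<gamma>)" using \<gamma>(1) by (rule ring_at)
      show ?thesis
        using diagonal_mult_apply[OF hd(1) Gamma_secs[OF sR] \<gamma>(1)] U(2) \<gamma>(1) unit_values[OF hs y(1)]
        by (simp add: k_def chi_apply y_def)
    qed
    have i\<gamma>: "ginv G \<gamma> \<in> arrows G" "gran G (ginv G \<gamma>) = x" "gdom G (ginv G \<gamma>) = y"
      using \<gamma> by (simp_all add: inv_closed ran_inv dom_inv y_def)
    have "b x = act S (ginv G \<gamma>) (k (gcomp G (ginv G (ginv G \<gamma>)) x))"
      unfolding b_def using i\<gamma>(2) xA ran_unit[OF x]
      by (intro chi_bisection_mult_apply[OF U' Gamma_secs[OF kR] imageI[OF U(2)]]) simp_all
    also have "gcomp G (ginv G (ginv G \<gamma>)) x = \<gamma>"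
      using comp_dom[OF \<gamma>(1)] \<gamma>(1,2) by (simp add: inv_inv)
    finally have bx: "b x = act S (ginv G \<gamma>) (h y)" unfolding k\<gamma> .
    \<comment> \<open>Acting by \<gamma> undoes the action of its inverse, so a zero value at
      \<open>x\<close> would make \<open>h y\<close> zero.\<close>
    have bx0: "b x \<noteq> \<zero>\<^bsub>stalk S x\<^esub>"
    proof
      assume "b x = \<zero>\<^bsub>stalk S x\<^esub>"
      then have "act S \<gamma> (act S (ginv G \<gamma>) (h y)) = \<zero>\<^bsub>stalk S y\<^esub>"
        using bx act_zero[OF \<gamma>(1)] \<gamma>(2) by (simp add: y_def)
      moreover have "act S \<gamma> (act S (ginv G \<gamma>) (h y)) = act S (gcomp G \<gamma> (ginv G \<gamma>)) (h y)"
        using unit_values[OF hs y(1)] i\<gamma> \<gamma>(1,2) by (intro act_act) (auto simp: in_stalk_iff)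
      moreover have "act S (gcomp G \<gamma> (ginv G \<gamma>)) (h y) = h y"
        using act_unit[of "h y"] unit_values[OF hs y(1)] comp_inv_self[OF \<gamma>(1)]
        by (simp add: in_stalk_iff y_def)
      ultimately show False using y(2) by simp
    qed
    have bxc: "b x \<in> carrier (stalk S x)" using Gamma_secs[OF bR] x by (rule unit_values)
    then have "b x \<in> Units (stalk S x)" using bx0 x.field_Units by blast
    then obtain v where v: "v \<in> carrier (stalk S x)" "v \<otimes>\<^bsub>stalk S x\<^esub> b x = \<one>\<^bsub>stalk S x\<^esub>"
      by (auto simp: Units_def)
    obtain c where c: "c \<in> carrier R" "diagonal c" "c x = v"
      using x v(1) by (rule exists_diagonal_value)
    have beR: "b \<star> e \<in> carrier R" using bR eR by (rule Gamma.m_closed)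
    have cbeR: "c \<star> (b \<star> e) \<in> carrier R" using c(1) beR by (rule Gamma.m_closed)
    have "b \<odot>\<^bsub>?M\<^esub> L.coset e = \<zero>\<^bsub>?M\<^esub>"
      using bI eR by (simp add: I_def L.quotient_carrier)
    then have "b \<star> e \<in> L"
      using bR eR beR by (simp add: L.quotient_smult L.coset_eq_zero_iff)
    with c(1) have 1: "c \<star> (b \<star> e) \<in> L"
      by (rule L.l_mult_closed)
    \<comment> \<open>At \<open>x\<close> the three values multiply to the identity of the stalk,
      which is \<open>e x\<close>. Any other arrow with domain \<open>x\<close> is not a unit, and
      there \<open>e\<close> vanishes.\<close>
    have "(e \<ominus>\<^bsub>R\<^esub> c \<star> (b \<star> e)) \<delta> = \<zero>\<^bsub>stalk S (gran G \<delta>)\<^esub>"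
      if \<delta>: "\<delta> \<in> arrows G" "gdom G \<delta> = x" for \<delta>
    proof -
      interpret ring "stalk S (gran G \<delta>)" using \<delta>(1) by (rule ring_at)
      have ry: "gran G \<delta> \<in> units G" using \<delta>(1) by (rule ran_in_units)
      have val: "(c \<star> (b \<star> e)) \<delta> =
          c (gran G \<delta>) \<otimes>\<^bsub>stalk S (gran G \<delta>)\<^esub> (b (gran G \<delta>) \<otimes>\<^bsub>stalk S (gran G \<delta>)\<^esub> e \<delta>)"
        using diagonal_mult_apply[OF c(2) Gamma_secs[OF beR] \<delta>(1)]
          diagonal_mult_apply[OF bd Gamma_secs[OF eR] \<delta>(1)] by simp
      have "(c \<star> (b \<star> e)) \<delta> = e \<delta>"
      proof (cases "\<delta> \<in> units G")
        case True
        then have "\<delta> = x" using \<delta>(2) dom_unit by simp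
        then show ?thesis
          using val ran_unit[OF x] c(3) v ex bxc by simp
      next
        case False
        then have "e \<delta> = \<zero>\<^bsub>stalk S (gran G \<delta>)\<^esub>"
          using ed \<delta>(1) by (simp add: diagonal_def)
        then show ?thesis
          using val unit_values[OF Gamma_secs[OF c(1)] ry] unit_values[OF Gamma_secs[OF bR] ry] by simp
      qed
      then show ?thesis
        using minus_apply[OF eR cbeR \<delta>(1)] secs_apply[OF Gamma_secs[OF eR] \<delta>(1)]
        by (simp add: minus_eq r_neg)
    qed
    then have "e \<ominus>\<^bsub>R\<^esub> c \<star> (b \<star> e) \<in> J"
      using eR cbeR by (simp add: J_def)
    then have 2: "e \<ominus>\<^bsub>R\<^esub> c \<star> (b \<star> e) \<in> L" using L(2) by blast
    have "(e \<ominus>\<^bsub>R\<^esub> c \<star> (b \<star> e)) \<oplus>\<^bsub>R\<^esub> c \<star> (b \<star> e) = e"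
      using eR cbeR by (simp add: Gamma.minus_eq Gamma.a_assoc Gamma.l_neg)
    then show False using L.add_in[OF 2 1] L(3) by simp
  qed
  have "faithful_left_module R ?M"
    unfolding faithful_left_module_def using M.left_module_axioms I0 by (auto simp: I_def)
  with simple show ?thesis by (rule left_primitiveI)
qed

section \<open>From a faithful simple module to a dense orbit\<close>

lemma left_primitive_imp_dense_orbit:
  assumes "left_primitive R"
  shows "\<exists>x \<in> units G. unit_top G closure_of orbit G x = units G"
proof -
  obtain M :: "('a \<Rightarrow> 'b, ('a \<Rightarrow> 'b) set) module"
    where simple: "simple_left_module R M" and faithful: "faithful_left_module R M"
    using assms unfolding left_primitive_def by blast
  interpret M: left_module R M using simple by (simp add: simple_left_module_def)
  obtain a n where "a \<in> carrier R" "n \<in> carrier M" "a \<odot>\<^bsub>M\<^esub> n \<noteq> \<zero>\<^bsub>M\<^esub>"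
    using simple unfolding simple_left_module_def by blast
  then obtain m where m: "m \<in> carrier M" "m \<noteq> \<zero>\<^bsub>M\<^esub>"
    using M.smult_closed by blast
  then obtain x where x: "x \<in> units G" "\<not> germ_zero M m x"
    using germs_zero_imp_zero[OF simple m(1)] by blast
  \<comment> \<open>Simplicity leaves two possibilities for \<open>?N\<close>. As \<open>x\<close>
    lies in its own orbit and the germ of \<open>m\<close> at \<open>x\<close> is nonzero,
    \<open>m\<close> is outside \<open>?N\<close>, so \<open>?N\<close> is zero.\<close>
  let ?N = "{m \<in> carrier M. \<forall>y\<in>orbit G x. germ_zero M m y}"
  have "x \<in> orbit G x"
    unfolding orbit_def using unit_closed[OF x(1)] dom_unit[OF x(1)] ran_unit[OF x(1)] by force
  then have "m \<notin> ?N" using x(2) by blast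
  then have "?N \<noteq> carrier M" using m(1) by blast
  then have N0: "?N = {\<zero>\<^bsub>M\<^esub>}"
    using simple submodule_germs_zero[OF M.left_module_axioms, of x]
    unfolding simple_left_module_def by blast
  have "units G \<subseteq> unit_top G closure_of orbit G x"
  proof
    fix z assume z: "z \<in> units G"
    show "z \<in> unit_top G closure_of orbit G x"
    proof (rule ccontr)
      assume "z \<notin> unit_top G closure_of orbit G x"
      then obtain T where T: "openin (unit_top G) T" "z \<in> T" "T \<inter> orbit G x = {}"
        using z by (auto simp: in_closure_of topspace_unit_top)
      obtain K where K: "cob G K" "z \<in> K" "K \<subseteq> T"
        using T(1,2) by (rule cob_unit_nbhd)
      have KU: "K \<subseteq> units G" using K(3) T(1) by (auto simp: openin_unit_top)
      have KR: "chi K \<in> carrier R" using K(1) by (rule chi_in_Gamma)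
      \<comment> \<open>\<open>K\<close> is closed and disjoint from the orbit, so each orbit point
        has a neighbourhood \<open>V\<close> with \<open>chi V \<star> chi K\<close> zero. Hence
        \<open>chi K\<close> applied to \<open>n\<close> has zero germs along the orbit and lies in
        \<open>?N\<close>.\<close>
      have "chi K \<odot>\<^bsub>M\<^esub> n = \<zero>\<^bsub>M\<^esub>" if n: "n \<in> carrier M" for n
      proof -
        have "germ_zero M (chi K \<odot>\<^bsub>M\<^esub> n) y" if y: "y \<in> orbit G x" for y
        proof -
          have "closedin (unit_top G) K"
            using K(1) KU by (intro closedin_compact_units) (simp add: cob_units_iff)
          then have "openin (unit_top G) (units G - K)"
            by (simp add: closedin_def topspace_unit_top)
          moreover have "y \<in> units G - K"
            using y orbit_subset K(3) T(3) by blast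
          ultimately obtain V where V: "cob G V" "y \<in> V" "V \<subseteq> units G - K"
            by (rule cob_unit_nbhd)
          have VU: "V \<subseteq> units G" using V(3) by blast
          have VR: "chi V \<in> carrier R" using V(1) by (rule chi_in_Gamma)
          have "chi V \<star> chi K = \<zero>\<^bsub>R\<^esub>"
          proof (rule secs_ext[OF Gamma_secs[OF Gamma.m_closed[OF VR KR]] zero_in_secs])
            fix \<delta> assume \<delta>: "\<delta> \<in> arrows G"
            show "(chi V \<star> chi K) \<delta> = \<zero>\<^bsub>R\<^esub> \<delta>"
            proof (cases "\<delta> \<in> K")
              case True
              then have "gran G \<delta> \<notin> V"
                using V(3) KU ran_unit[of \<delta>] by (metis DiffD2 subsetD)
              then show ?thesis
                using chi_mult_apply[OF VU chi_in_secs \<delta>] \<delta> by (simp add: zero_apply)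
            next
              case False
              then show ?thesis
                using chi_mult_apply[OF VU chi_in_secs \<delta>] \<delta> by (simp add: chi_apply zero_apply)
            qed
          qed
          then have "chi V \<odot>\<^bsub>M\<^esub> (chi K \<odot>\<^bsub>M\<^esub> n) = \<zero>\<^bsub>M\<^esub>"
            using M.smult_assoc[OF VR KR n] M.zero_smult[OF n] by simp
          then show ?thesis
            unfolding germ_zero_def using V(1,2) VU by blast
        qed
        then have "chi K \<odot>\<^bsub>M\<^esub> n \<in> ?N"
          using M.smult_closed[OF KR n] by blast
        then show ?thesis unfolding N0 by simp
      qed
      then have "chi K = \<zero>\<^bsub>R\<^esub>"
        using faithful KR unfolding faithful_left_module_def by blast
      then have "chi K z = \<zero>\<^bsub>R\<^esub> z" by simp
      \<comment> \<open>The value of \<open>chi K\<close> at \<open>z\<close> is the identity of a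
        field, hence nonzero.\<close>
      then show False
        using K(2) z unit_closed[OF z] ran_unit[OF z] stalk_one_not_zero[OF z]
        by (simp add: chi_apply zero_apply)
    qed
  qed
  moreover have "unit_top G closure_of orbit G x \<subseteq> units G"
    using closure_of_subset_topspace[of "unit_top G"] by (simp add: topspace_unit_top)
  ultimately show ?thesis using x(1) by blast
qed

end

theorem theorem4p22:
  fixes G :: "'g groupoid" and S :: "('g, 'e) ring_gsheaf"
  assumes "ample_groupoid G"
    and "gsheaf_of_fields G S"
    and "maximal_comm_subrng (Gamma_c_units G S) (Gamma_c G S)"
  shows "left_primitive (Gamma_c G S) \<longleftrightarrow>
    (\<exists>x \<in> units G. unit_top G closure_of orbit G x = units G)"
proof -
  interpret gsheaf_of_fields G S by fact
  show ?thesis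
    using left_primitive_imp_dense_orbit dense_orbit_imp_left_primitive[OF assms(3)] by blast
qed

end
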